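(* Let $K$ be a finite-dimensional $1$-connected complex Lie group with simple Lie algebra $\mathfrak{k}$, let $\Sigma$ be a compact connected Riemann surface of genus $g$, $p_1,\dots,p_k\in\Sigma$ distinct points with $k\ge1$, $\Sigma_k=\Sigma\setminus\{p_1,\dots,p_k\}$, and assume $\ell=2g+k-1\geq1$. Let $\alpha_1,\dots,\alpha_\ell:\mathbb{S}^1\to\Sigma_k$ be smoothly embedded circles generating $\pi_1(\Sigma_k)$, let $G=\mathcal{O}(\Sigma_k,K)$, and let $\phi:G\to\prod_{i=1}^\ell K^{\mathbb{S}^1}$, $\phi(f)=(f\circ\alpha_i)_{i=1}^{\ell}$, where $K^{\mathbb{S}^1}=\mathcal{C}^\infty(\mathbb{S}^1,K)$. Let $\lambda\in\mathbb{C}$ and $\xi\in\Omega^1(\Sigma_k,\mathfrak{k})$. Then $\phi$ induces an injection $$\bar\phi:G/\mathrm{Stab}(\xi,\lambda)\to\prod_{i=1}^\ell K^{\mathbb{S}^1}\Big/\prod_{i=1}^\ell K_{C_i},$$ where $(C_1,\dots,C_\ell)$ are the conjugacy classes in $K$ given by the image of $\lambda\partial+\xi$ under the period (monodromy) map $P$ with values in $\mathrm{Hom}(\pi_1(\Sigma_k),K)/K\cong K^\ell/K$, and $K_{C_i}$ is the stabilizer of the conjugacy class $C_i$ in $K$, so that $K/K_{C_i}=C_i$.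
   Context: $G=\mathcal{O}(\Sigma_k,K)$ is the group of holomorphic maps $\Sigma_k\to K$; $\Omega^1(\Sigma_k,\mathfrak{k})$ is the space of holomorphic $\mathfrak{k}$-valued $1$-forms. The group $G$ acts (on the right) on the operators $\lambda\partial+\xi$ with $\lambda\in\mathbb{C}$, $\xi\in\Omega^1(\Sigma_k,\mathfrak{k})$ by $(\lambda\partial+\xi)\cdot f=\lambda\partial+\delta(f)+\mathrm{Ad}(f)^{-1}\xi$ with $\delta(f)=f^{-1}df$; $\mathrm{Stab}(\xi,\lambda)$ is the stabilizer of $\lambda\partial+\xi$. In the coset space $G/\mathrm{Stab}(\xi,\lambda)$, which is identified with the orbit of $\lambda\partial+\xi$, two elements $f,g$ are identified iff $fg^{-1}\in\mathrm{Stab}(\xi,\lambda)$; the same convention is used for the target coset space. The period map $P$ sends $\xi$ to the class, modulo conjugation by $K$, of the homomorphism $\pi_1(\Sigma_k)\to K$, $[\gamma]\mapsto\mathrm{evol}_K(\gamma^*\xi)$, where $\mathrm{evol}_K(\eta)=c(1)$ for the solution $c:[0,1]\to K$ of $c'(t)=c(t)\cdot\eta(t)$, $c(0)=1$. Here $\pi_1(\Sigma_k)$ is free on $\ell$ generators, $K$ acts on $K^\ell$ by simultaneous conjugation, and $C_i$ is the conjugacy class of the $i$-th component. $K_{C_i}$ is the centralizer in $K$ of the monodromy of $\xi$ along $\alpha_i$ (an element of $C_i$). It is regarded as a subgroup of the loop group $K^{\mathbb{S}^1}$ via its canonical identification with the stabilizer of $\alpha_i^*\xi$ in $K^{\mathbb{S}^1}$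 under the analogous action $\eta\cdot h=\delta(h)+\mathrm{Ad}(h)^{-1}\eta$ on smooth $\mathfrak{k}$-valued $1$-forms $\eta$ on $\mathbb{S}^1$ (the identification being evaluation of $h$ at the base point of $\mathbb{S}^1$). *)

theory Defs
  imports "HOL-Analysis.Analysis" "HOL-Homology.Homology"
begin

section \<open>Complex manifolds\<close>

text \<open>Finite-dimensional complex vector spaces, carrying a Euclidean structure so that the
  analysis library applies; the model spaces of complex manifolds.\<close>

class complex_euclidean = euclidean_space +
  fixes scaleC :: "complex \<Rightarrow> 'a \<Rightarrow> 'a" (infixr "*\<^sub>C" 75)
  assumes scaleC_add_right: "a *\<^sub>C (x + y) = a *\<^sub>C x + a *\<^sub>C y"
    and scaleC_add_left: "(a + b) *\<^sub>C x = a *\<^sub>C x + b *\<^sub>C x"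
    and scaleC_scaleC: "a *\<^sub>C (b *\<^sub>C x) = (a * b) *\<^sub>C x"
    and scaleC_of_real: "complex_of_real r *\<^sub>C x = r *\<^sub>R x"

instantiation complex :: complex_euclidean
begin
definition scaleC_complex :: "complex \<Rightarrow> complex \<Rightarrow> complex"
  where "scaleC_complex a x = a * x"
instance
  by standard (auto simp: scaleC_complex_def algebra_simps scaleR_conv_of_real)
end

instantiation prod :: (complex_euclidean, complex_euclidean) complex_euclidean
begin
definition scaleC_prod :: "complex \<Rightarrow> 'a \<times> 'b \<Rightarrow> 'a \<times> 'b"
  where "scaleC_prod a x = (a *\<^sub>C fst x, a *\<^sub>C snd x)"
instance
  by standard
    (auto simp: scaleC_prod_def scaleC_add_right scaleC_add_left scaleC_scaleC scaleC_of_real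
      prod_eq_iff)
end

instantiation vec :: (complex_euclidean, finite) complex_euclidean
begin
definition scaleC_vec :: "complex \<Rightarrow> 'a ^ 'b \<Rightarrow> 'a ^ 'b"
  where "scaleC_vec a x = (\<chi> i. a *\<^sub>C x $ i)"
instance
  by standard
    (auto simp: scaleC_vec_def scaleC_add_right scaleC_add_left scaleC_scaleC scaleC_of_real
      vec_eq_iff)
end

definition holo_on :: "'v::complex_euclidean set \<Rightarrow> ('v \<Rightarrow> 'w::complex_euclidean) \<Rightarrow> bool"
  where "holo_on S f \<longleftrightarrow>
    (\<forall>x\<in>S. \<exists>D. (f has_derivative D) (at x) \<and> (\<forall>c v. D (c *\<^sub>C v) = c *\<^sub>C D v))"

type_synonym ('a, 'v) chart = "'a set \<times> ('a \<Rightarrow> 'v)"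

definition chart_inv :: "('a, 'v) chart \<Rightarrow> 'v \<Rightarrow> 'a"
  where "chart_inv \<phi> = inv_into (fst \<phi>) (snd \<phi>)"

text \<open>An atlas need not be maximal. The underlying point set of the manifold is the whole type.\<close>

definition complex_atlas :: "('a::t2_space, 'v::complex_euclidean) chart set \<Rightarrow> bool"
  where "complex_atlas A \<longleftrightarrow>
    (\<Union>\<phi>\<in>A. fst \<phi>) = UNIV \<and>
    (\<forall>\<phi>\<in>A. open (fst \<phi>) \<and> open (snd \<phi> ` fst \<phi>) \<and>
      homeomorphism (fst \<phi>) (snd \<phi> ` fst \<phi>) (snd \<phi>) (chart_inv \<phi>)) \<and>
    (\<forall>\<phi>\<in>A. \<forall>\<psi>\<in>A. holo_on (snd \<phi> ` (fst \<phi> \<inter> fst \<psi>)) (snd \<psi> \<circ> chart_inv \<phi>))"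

definition prod_atlas :: "('a, 'v) chart set \<Rightarrow> ('b, 'w) chart set \<Rightarrow> ('a \<times> 'b, 'v \<times> 'w) chart set"
  where "prod_atlas A B =
    {(fst \<phi> \<times> fst \<psi>, map_prod (snd \<phi>) (snd \<psi>)) |\<phi> \<psi>. \<phi> \<in> A \<and> \<psi> \<in> B}"

definition holo_map :: "('a::t2_space, 'v::complex_euclidean) chart set \<Rightarrow>
    ('b::t2_space, 'w::complex_euclidean) chart set \<Rightarrow> 'a set \<Rightarrow> ('a \<Rightarrow> 'b) \<Rightarrow> bool"
  where "holo_map A B S f \<longleftrightarrow> continuous_on S f \<and>
    (\<forall>\<phi>\<in>A. \<forall>\<psi>\<in>B.
      holo_on (snd \<phi> ` (S \<inter> fst \<phi> \<inter> f -` fst \<psi>)) (snd \<psi> \<circ> f \<circ> chart_inv \<phi>))"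

text \<open>Infinite differentiability of a function of a real variable: \<open>D n\<close> is the \<open>n\<close>-th derivative.\<close>

definition smooth_fun :: "real set \<Rightarrow> (real \<Rightarrow> 'v::real_normed_vector) \<Rightarrow> bool"
  where "smooth_fun T f \<longleftrightarrow> (\<exists>D. (\<forall>t\<in>T. D (0::nat) t = f t) \<and>
    (\<forall>n. \<forall>t\<in>T. (D n has_vector_derivative D (Suc n) t) (at t within T)))"

definition smooth_curve ::
    "('a::t2_space, 'v::complex_euclidean) chart set \<Rightarrow> real set \<Rightarrow> (real \<Rightarrow> 'a) \<Rightarrow> bool"
  where "smooth_curve A T \<gamma> \<longleftrightarrow> continuous_on T \<gamma> \<and>
    (\<forall>\<phi>\<in>A. smooth_fun (T \<inter> \<gamma> -` fst \<phi>) (snd \<phi> \<circ> \<gamma>))"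

definition piecewise_smooth_path ::
    "('a::t2_space, 'v::complex_euclidean) chart set \<Rightarrow> 'a set \<Rightarrow> (real \<Rightarrow> 'a) \<Rightarrow> bool"
  where "piecewise_smooth_path A S \<gamma> \<longleftrightarrow> path \<gamma> \<and> path_image \<gamma> \<subseteq> S \<and>
    (\<exists>F. finite F \<and> F \<subseteq> {0..1} \<and> 0 \<in> F \<and> 1 \<in> F \<and>
      (\<forall>a\<in>F. \<forall>b\<in>F. a < b \<and> F \<inter> {a<..<b} = {} \<longrightarrow> smooth_curve A {a..b} \<gamma>))"

section \<open>Complex Lie groups\<close>

definition complex_lie_group ::
    "'k::t2_space monoid \<Rightarrow> ('k, 'v::complex_euclidean) chart set \<Rightarrow> bool"
  where "complex_lie_group K B \<longleftrightarrow> group K \<and> carrier K = UNIV \<and> complex_atlas B \<and>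
    holo_map (prod_atlas B B) B UNIV (\<lambda>(x, y). x \<otimes>\<^bsub>K\<^esub> y) \<and>
    holo_map B B UNIV (\<lambda>x. inv\<^bsub>K\<^esub> x)"

text \<open>Below, \<open>\<kappa>\<close> is a chart around the identity. Its differential at the identity identifies the
  Lie algebra \<open>\<kk> = T\<^sub>1 K\<close> with the model space \<open>'v\<close>. The adjoint representation is the
  differential of conjugation, and the Lie bracket is the differential of \<open>Ad\<close>.\<close>

definition Ad :: "'k monoid \<Rightarrow> ('k, 'v::complex_euclidean) chart \<Rightarrow> 'k \<Rightarrow> 'v \<Rightarrow> 'v"
  where "Ad K \<kappa> x = frechet_derivative
    (\<lambda>v. snd \<kappa> (x \<otimes>\<^bsub>K\<^esub> chart_inv \<kappa> v \<otimes>\<^bsub>K\<^esub> inv\<^bsub>K\<^esub> x)) (at (snd \<kappa> \<one>\<^bsub>K\<^esub>))"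

definition lie_bracket :: "'k monoid \<Rightarrow> ('k, 'v::complex_euclidean) chart \<Rightarrow> 'v \<Rightarrow> 'v \<Rightarrow> 'v"
  where "lie_bracket K \<kappa> u v =
    frechet_derivative (\<lambda>w. Ad K \<kappa> (chart_inv \<kappa> w) v) (at (snd \<kappa> \<one>\<^bsub>K\<^esub>)) u"

definition lie_ideal :: "('v::complex_euclidean \<Rightarrow> 'v \<Rightarrow> 'v) \<Rightarrow> 'v set \<Rightarrow> bool"
  where "lie_ideal br I \<longleftrightarrow> 0 \<in> I \<and> (\<forall>x\<in>I. \<forall>y\<in>I. x + y \<in> I) \<and>
    (\<forall>c. \<forall>x\<in>I. c *\<^sub>C x \<in> I) \<and> (\<forall>u. \<forall>x\<in>I. br u x \<in> I)"

definition simple_bracket :: "('v::complex_euclidean \<Rightarrow> 'v \<Rightarrow> 'v) \<Rightarrow> bool"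
  where "simple_bracket br \<longleftrightarrow> (\<exists>u v. br u v \<noteq> 0) \<and> (\<forall>I. lie_ideal br I \<longrightarrow> I = {0} \<or> I = UNIV)"

definition pointwise_group :: "'x set \<Rightarrow> ('x \<Rightarrow> 'k) set \<Rightarrow> 'k monoid \<Rightarrow> ('x \<Rightarrow> 'k) monoid"
  where "pointwise_group X F K = \<lparr>carrier = F,
    monoid.mult = (\<lambda>f g. \<lambda>x\<in>X. f x \<otimes>\<^bsub>K\<^esub> g x), one = (\<lambda>x\<in>X. \<one>\<^bsub>K\<^esub>)\<rparr>"

definition holo_group :: "('a::t2_space, complex) chart set \<Rightarrow> 'a set \<Rightarrow>
    ('k::t2_space, 'v::complex_euclidean) chart set \<Rightarrow> 'k monoid \<Rightarrow> ('a \<Rightarrow> 'k) monoid"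
  where "holo_group A S B K = pointwise_group S {f \<in> extensional S. holo_map A B S f} K"

text \<open>The circle is the unit circle in the complex plane, with coordinate \<open>t\<close> given by
  \<open>e\<^sup>2\<^sup>\<pi>\<^sup>i\<^sup>t\<close> and base point \<open>1\<close>.\<close>

definition circ :: "real \<Rightarrow> complex"
  where "circ t = cis (2 * pi * t)"

definition loop_group ::
    "('k::t2_space, 'v::complex_euclidean) chart set \<Rightarrow> 'k monoid \<Rightarrow> (complex \<Rightarrow> 'k) monoid"
  where "loop_group B K = pointwise_group (sphere 0 1)
    {h \<in> extensional (sphere 0 1). smooth_curve B UNIV (h \<circ> circ)} K"

section \<open>Lie algebra valued forms and the gauge action\<close>

text \<open>A form is given by its coefficients: on the domain of a chart \<open>\<phi> = (U, z)\<close> it is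
  \<open>\<xi> \<phi> dz\<close>. Off the domain of definition the coefficient is \<open>0\<close>, so that equality of forms is
  equality of functions.\<close>

type_synonym ('a, 'v) form = "('a, complex) chart \<Rightarrow> 'a \<Rightarrow> 'v"

definition holo_forms ::
    "('a::t2_space, complex) chart set \<Rightarrow> 'a set \<Rightarrow> ('a, 'v::complex_euclidean) form set"
  where "holo_forms A S = {\<xi>.
    (\<forall>\<phi> p. \<phi> \<notin> A \<or> p \<notin> fst \<phi> \<inter> S \<longrightarrow> \<xi> \<phi> p = 0) \<and>
    (\<forall>\<phi>\<in>A. holo_on (snd \<phi> ` (fst \<phi> \<inter> S)) (\<xi> \<phi> \<circ> chart_inv \<phi>)) \<and>
    (\<forall>\<phi>\<in>A. \<forall>\<psi>\<in>A. \<forall>p \<in> fst \<phi> \<inter> fst \<psi> \<inter> S.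
      \<xi> \<phi> p = deriv (snd \<psi> \<circ> chart_inv \<phi>) (snd \<phi> p) *\<^sub>C \<xi> \<psi> p)}"

text \<open>\<open>\<delta>(f) = f\<^sup>-\<^sup>1 df\<close>; the value of the Frechet derivative at \<open>1\<close> is the complex derivative.\<close>

definition log_deriv :: "'k monoid \<Rightarrow> ('k, 'v::complex_euclidean) chart \<Rightarrow>
    ('a, complex) chart set \<Rightarrow> 'a set \<Rightarrow> ('a \<Rightarrow> 'k) \<Rightarrow> ('a, 'v) form"
  where "log_deriv K \<kappa> A S f = (\<lambda>\<phi> p. if \<phi> \<in> A \<and> p \<in> fst \<phi> \<inter> S then
    frechet_derivative (\<lambda>w. snd \<kappa> (inv\<^bsub>K\<^esub> (f p) \<otimes>\<^bsub>K\<^esub> f (chart_inv \<phi> w))) (at (snd \<phi> p)) 1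
    else 0)"

text \<open>The operator \<open>\<lambda>\<partial> + \<xi>\<close> is the pair \<open>(\<lambda>, \<xi>)\<close>.\<close>

definition gauge_act :: "'k monoid \<Rightarrow> ('k, 'v::complex_euclidean) chart \<Rightarrow>
    ('a, complex) chart set \<Rightarrow> 'a set \<Rightarrow> complex \<times> ('a, 'v) form \<Rightarrow> ('a \<Rightarrow> 'k) \<Rightarrow>
    complex \<times> ('a, 'v) form"
  where "gauge_act K \<kappa> A S D f = (fst D,
    \<lambda>\<phi> p. log_deriv K \<kappa> A S f \<phi> p +
      (if \<phi> \<in> A \<and> p \<in> fst \<phi> \<inter> S then Ad K \<kappa> (inv\<^bsub>K\<^esub> (f p)) (snd D \<phi> p) else 0))"

definition Stab :: "'k::t2_space monoid \<Rightarrow> ('k, 'v::complex_euclidean) chart set \<Rightarrow>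
    ('k, 'v) chart \<Rightarrow> ('a::t2_space, complex) chart set \<Rightarrow> 'a set \<Rightarrow> ('a, 'v) form \<Rightarrow> complex \<Rightarrow>
    ('a \<Rightarrow> 'k) set"
  where "Stab K B \<kappa> A S \<xi> lam =
    {f \<in> carrier (holo_group A S B K). gauge_act K \<kappa> A S (lam, \<xi>) f = (lam, \<xi>)}"

text \<open>The coefficient of \<open>dt\<close> in \<open>\<gamma>\<^sup>*\<xi>\<close>; by the transformation law for the coefficients it does not
  depend on the chosen chart. Smooth forms on the circle are likewise given by their coefficient
  functions of the coordinate \<open>t\<close>.\<close>

definition pullback ::
    "('a, complex) chart set \<Rightarrow> (real \<Rightarrow> 'a) \<Rightarrow> ('a, 'v::complex_euclidean) form \<Rightarrow> real \<Rightarrow> 'v"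
  where "pullback A \<gamma> \<xi> t = (let \<phi> = SOME \<phi>. \<phi> \<in> A \<and> \<gamma> t \<in> fst \<phi> in
    vector_derivative (snd \<phi> \<circ> \<gamma>) (at t) *\<^sub>C \<xi> \<phi> (\<gamma> t))"

definition loop_stab :: "'k::t2_space monoid \<Rightarrow> ('k, 'v::complex_euclidean) chart set \<Rightarrow>
    ('k, 'v) chart \<Rightarrow> (real \<Rightarrow> 'v) \<Rightarrow> (complex \<Rightarrow> 'k) set"
  where "loop_stab K B \<kappa> \<eta> = {h \<in> carrier (loop_group B K). \<forall>t.
    vector_derivative (\<lambda>s. snd \<kappa> (inv\<^bsub>K\<^esub> (h (circ t)) \<otimes>\<^bsub>K\<^esub> h (circ s))) (at t) +
      Ad K \<kappa> (inv\<^bsub>K\<^esub> (h (circ t))) (\<eta> t) = \<eta> t}"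

section \<open>Monodromy\<close>

text \<open>\<open>c' = c \<cdot> \<eta>\<close>, \<open>c(0) = 1\<close>, \<open>c(1) = x\<close>. The finite set accommodates the end points and the
  corners of piecewise smooth paths, where \<open>\<eta>\<close> is not defined by a two-sided derivative.\<close>

definition has_evol :: "'k::t2_space monoid \<Rightarrow> ('k, 'v::complex_euclidean) chart \<Rightarrow>
    (real \<Rightarrow> 'v) \<Rightarrow> 'k \<Rightarrow> bool"
  where "has_evol K \<kappa> \<eta> x \<longleftrightarrow> (\<exists>c. continuous_on {0..1} c \<and> c 0 = \<one>\<^bsub>K\<^esub> \<and> c 1 = x \<and>
    (\<exists>F. finite F \<and> (\<forall>t \<in> {0..1} - F.
      ((\<lambda>s. snd \<kappa> (inv\<^bsub>K\<^esub> (c t) \<otimes>\<^bsub>K\<^esub> c s)) has_vector_derivative \<eta> t) (at t within {0..1}))))"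

definition evol :: "'k::t2_space monoid \<Rightarrow> ('k, 'v::complex_euclidean) chart \<Rightarrow>
    (real \<Rightarrow> 'v) \<Rightarrow> 'k"
  where "evol K \<kappa> \<eta> = (THE x. has_evol K \<kappa> \<eta> x)"

definition hclass :: "'a::topological_space set \<Rightarrow> (real \<Rightarrow> 'a) \<Rightarrow> (real \<Rightarrow> 'a) set"
  where "hclass S p = {q. homotopic_paths S p q}"

definition pi1 :: "'a::topological_space set \<Rightarrow> 'a \<Rightarrow> (real \<Rightarrow> 'a) set monoid"
  where "pi1 S x0 = \<lparr>
    carrier = {hclass S p |p.
      path p \<and> path_image p \<subseteq> S \<and> pathstart p = x0 \<and> pathfinish p = x0},
    monoid.mult = (\<lambda>X Y. {r. \<exists>p\<in>X. \<exists>q\<in>Y. homotopic_paths S (p +++ q) r}),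
    one = hclass S (\<lambda>_. x0)\<rparr>"

text \<open>The value of the period map at \<open>\<xi>\<close>, as a \<open>K\<close>-conjugacy class of homomorphisms, i.e. the set of
  all conjugates of \<open>[\<gamma>] \<mapsto> evol(\<gamma>\<^sup>*\<xi>)\<close>. Every homotopy class contains piecewise smooth loops.\<close>

definition period_map :: "'k::t2_space monoid \<Rightarrow> ('k, 'v::complex_euclidean) chart \<Rightarrow>
    ('a::t2_space, complex) chart set \<Rightarrow> 'a set \<Rightarrow> 'a \<Rightarrow> ('a, 'v) form \<Rightarrow>
    ((real \<Rightarrow> 'a) set \<Rightarrow> 'k) set"
  where "period_map K \<kappa> A S x0 \<xi> = {\<rho> \<in> hom (pi1 S x0) K. \<exists>y \<in> carrier K. \<forall>\<gamma>.
    piecewise_smooth_path A S \<gamma> \<and> pathstart \<gamma> = x0 \<and> pathfinish \<gamma> = x0 \<longrightarrow>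
      has_evol K \<kappa> (pullback A \<gamma> \<xi>) (inv\<^bsub>K\<^esub> y \<otimes>\<^bsub>K\<^esub> \<rho> (hclass S \<gamma>) \<otimes>\<^bsub>K\<^esub> y)}"

definition conj_class :: "('k, 'm) monoid_scheme \<Rightarrow> 'k \<Rightarrow> 'k set"
  where "conj_class K x = {inv\<^bsub>K\<^esub> y \<otimes>\<^bsub>K\<^esub> x \<otimes>\<^bsub>K\<^esub> y |y. y \<in> carrier K}"

definition centralizer :: "('k, 'm) monoid_scheme \<Rightarrow> 'k \<Rightarrow> 'k set"
  where "centralizer K x = {y \<in> carrier K. y \<otimes>\<^bsub>K\<^esub> x = x \<otimes>\<^bsub>K\<^esub> y}"

definition monodromy :: "'k::t2_space monoid \<Rightarrow> ('k, 'v::complex_euclidean) chart \<Rightarrow>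
    ('a, complex) chart set \<Rightarrow> ('a, 'v) form \<Rightarrow> (complex \<Rightarrow> 'a) \<Rightarrow> 'k"
  where "monodromy K \<kappa> A \<xi> \<alpha> = evol K \<kappa> (pullback A (\<alpha> \<circ> circ) \<xi>)"

text \<open>The centralizer of the monodromy along \<open>\<alpha>\<close>, as a subgroup of the loop group: the loops in the
  stabilizer of \<open>\<alpha>\<^sup>*\<xi>\<close> whose value at the base point \<open>1\<close> is in the centralizer.\<close>

definition centralizer_loops :: "'k::t2_space monoid \<Rightarrow> ('k, 'v::complex_euclidean) chart set \<Rightarrow>
    ('k, 'v) chart \<Rightarrow> ('a, complex) chart set \<Rightarrow> ('a, 'v) form \<Rightarrow> (complex \<Rightarrow> 'a) \<Rightarrow>
    (complex \<Rightarrow> 'k) set"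
  where "centralizer_loops K B \<kappa> A \<xi> \<alpha> =
    {h \<in> loop_stab K B \<kappa> (pullback A (\<alpha> \<circ> circ) \<xi>). h 1 \<in> centralizer K (monodromy K \<kappa> A \<xi> \<alpha>)}"

section \<open>Riemann surfaces\<close>

definition compact_riemann_surface :: "('a::t2_space, complex) chart set \<Rightarrow> bool"
  where "compact_riemann_surface A \<longleftrightarrow>
    complex_atlas A \<and> compact (UNIV :: 'a set) \<and> connected (UNIV :: 'a set)"

text \<open>The first homology of the surface is free abelian of rank \<open>2 g\<close>.\<close>

definition has_genus :: "'a::t2_space itself \<Rightarrow> nat \<Rightarrow> bool"
  where "has_genus _ g \<longleftrightarrow>
    homology_group 1 (euclidean :: 'a topology) \<cong> free_Abelian_group {..<2 * g}"

text \<open>By compactness of the circle, an injective immersion is an embedding.\<close>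

definition embedded_circle ::
    "('a::t2_space, complex) chart set \<Rightarrow> 'a set \<Rightarrow> (complex \<Rightarrow> 'a) \<Rightarrow> bool"
  where "embedded_circle A S \<alpha> \<longleftrightarrow> \<alpha> ` sphere 0 1 \<subseteq> S \<and> inj_on \<alpha> (sphere 0 1) \<and>
    smooth_curve A UNIV (\<alpha> \<circ> circ) \<and>
    (\<forall>t. \<forall>\<phi>\<in>A. \<alpha> (circ t) \<in> fst \<phi> \<longrightarrow> vector_derivative (snd \<phi> \<circ> \<alpha> \<circ> circ) (at t) \<noteq> 0)"

text \<open>The based loop obtained from the circle \<open>\<alpha>\<close> and a path \<open>\<tau>\<close> from the base point of the
  surface to \<open>\<alpha> 1\<close>; if all circles pass through the base point, \<open>\<tau>\<close> can be constant.\<close>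

definition lasso :: "(real \<Rightarrow> 'a::topological_space) \<Rightarrow> (complex \<Rightarrow> 'a) \<Rightarrow> real \<Rightarrow> 'a"
  where "lasso \<tau> \<alpha> = \<tau> +++ (\<alpha> \<circ> circ) +++ reversepath \<tau>"

definition restrict_to_circles :: "nat \<Rightarrow> (nat \<Rightarrow> complex \<Rightarrow> 'a) \<Rightarrow> ('a \<Rightarrow> 'k) \<Rightarrow>
    nat \<Rightarrow> complex \<Rightarrow> 'k"
  where "restrict_to_circles l \<alpha> f = (\<lambda>i\<in>{..<l}. \<lambda>x\<in>sphere 0 1. f (\<alpha> i x))"

end

theory Submission
  imports Defs "HOL-Complex_Analysis.Complex_Analysis"
begin

text \<open>Uniqueness for \<open>c' = c \<cdot> \<eta>\<close> shows that the monodromy along a circle is conjugate to the value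
  of the period map on any lasso around it, and that every loop stabilizing \<open>\<alpha>\<^sup>*\<xi>\<close> takes a value
  centralizing the monodromy at the base point. Hence the group by which the target is divided is the
  full stabilizer of \<open>\<alpha>\<^sub>i\<^sup>*\<xi>\<close>, and restriction to the circles maps \<open>Stab\<close> into it.

  For injectivity, let \<open>h = f g\<^sup>-\<^sup>1\<close> stabilize the pullback of \<open>\<xi>\<close> to one of the circles. The form
  \<open>\<delta>(h) + Ad(h)\<^sup>-\<^sup>1 \<xi> - \<xi>\<close> is holomorphic and vanishes along that circle, whose tangent vectors are
  nonzero; by the identity theorem and connectedness of the surface it vanishes identically. That it is
  holomorphic, and that products of smooth loops are smooth, needs the regularity of functions of
  several complex variables, obtained by differentiating a one-variable Cauchy integral
  \<open>F'(x) b = 1/(2\<pi>r) \<integral> e\<^sup>-\<^sup>i\<^sup>\<theta> F(x + r e\<^sup>i\<^sup>\<theta> b) d\<theta>\<close> in the parameter \<open>x\<close>.\<close>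

section \<open>Several complex variables\<close>

text \<open>\<open>K\<close> is an abstract manifold, so the derivative of a \<open>K\<close>-valued
  map is taken after translating the map to the identity, in the single chart
  \<open>\<kappa>\<close>; each rule for such derivatives comes from a fixed holomorphic map of the
  translated factors. \<open>holo_on\<close> demands complex linear derivatives but says nothing
  about their continuity, while smooth loops involve derivatives of all orders; the Cauchy integral
  bridges this gap because its integrand contains the map and not its derivative.

  Solutions of \<open>c' = c \<cdot> \<eta>\<close> are never constructed. Their existence along
  lassos is part of what membership of \<open>\<rho>\<close> in the period map means, and existence
  along the circles is obtained by cutting up a solution along a lasso. Uniqueness reduces to the
  constancy of curves with vanishing logarithmic derivative.

  In the identity theorem the connected space is the whole surface and not \<open>S\<close>.
  Vanishing is therefore formulated for germs at every point, punctures included, and it propagates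
  across a puncture because a punctured disc is connected.\<close>

lemma scaleC_one [simp]: "1 *\<^sub>C x = x"
  using scaleC_of_real[of 1 x] by simp

lemma scaleC_zero_left [simp]: "0 *\<^sub>C x = 0"
  using scaleC_of_real[of 0 x] by simp

lemma scaleC_zero_right [simp]: "a *\<^sub>C 0 = 0"
  using scaleC_add_right[of a 0 0] by simp

lemma scaleC_scaleR: "a *\<^sub>C (r *\<^sub>R x) = r *\<^sub>R (a *\<^sub>C x)"
  by (metis scaleC_of_real scaleC_scaleC mult.commute)

lemma scaleR_scaleC: "(r *\<^sub>R a) *\<^sub>C x = r *\<^sub>R (a *\<^sub>C x)"
  by (metis scaleC_of_real scaleC_scaleC scaleR_conv_of_real)

lemma scaleC_eq_0_iff [simp]: "a *\<^sub>C x = 0 \<longleftrightarrow> a = 0 \<or> x = 0"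
proof -
  have "x = 0" if "a *\<^sub>C x = 0" "a \<noteq> 0"
  proof -
    have "inverse a *\<^sub>C (a *\<^sub>C x) = x"
      using that(2) by (simp add: scaleC_scaleC)
    with that(1) show ?thesis by simp
  qed
  then show ?thesis by auto
qed

lemma bounded_bilinear_scaleC: "bounded_bilinear (scaleC :: complex \<Rightarrow> 'v::complex_euclidean \<Rightarrow> 'v)"
  unfolding bilinear_conv_bounded_bilinear[symmetric] bilinear_def
  by (auto intro!: linearI simp: scaleC_add_left scaleC_add_right scaleC_scaleR scaleR_scaleC)

interpretation scaleC: bounded_bilinear "scaleC :: complex \<Rightarrow> 'v::complex_euclidean \<Rightarrow> 'v"
  by (rule bounded_bilinear_scaleC)

lemmas [continuous_intros] = scaleC.continuous_on
lemmas [derivative_intros] = scaleC.FDERIV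

text \<open>The only complex linear functional with real part \<open>v \<bullet> b\<close>: its
  imaginary part at \<open>v\<close> is minus its real part at \<open>\<i> *\<^sub>C v\<close>. It
  reduces vector-valued statements to scalar complex analysis, and real parts recover the Euclidean
  components.\<close>

definition complex_coord :: "'v::complex_euclidean \<Rightarrow> 'v \<Rightarrow> complex"
  where "complex_coord b v = Complex (v \<bullet> b) (- ((\<i> *\<^sub>C v) \<bullet> b))"

lemma Re_complex_coord [simp]: "Re (complex_coord b v) = v \<bullet> b"
  by (simp add: complex_coord_def)

lemma complex_coord_scaleC: "complex_coord b (a *\<^sub>C v) = a * complex_coord b v"
proof -
  have "a *\<^sub>C x = Re a *\<^sub>R x + Im a *\<^sub>R (\<i> *\<^sub>C x)" for x :: 'a
  proof -
    have "a = of_real (Re a) + of_real (Im a) * \<i>"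
      by (simp add: complex_eq mult.commute)
    then have "a *\<^sub>C x = (of_real (Re a) + of_real (Im a) * \<i>) *\<^sub>C x" by (rule arg_cong)
    then show ?thesis
      by (simp only: scaleC_add_left scaleC_of_real flip: scaleC_scaleC)
  qed
  moreover have "\<i> *\<^sub>C \<i> *\<^sub>C v = - v"
    using scaleC_scaleC[of \<i> \<i> v] scaleC_of_real[of "-1" v] by simp
  ultimately show ?thesis
    by (simp add: complex_coord_def complex_eq_iff inner_add_left scaleC_add_right scaleC_scaleR
        algebra_simps)
qed

lemma bounded_linear_complex_coord: "bounded_linear (complex_coord b)"
  unfolding linear_conv_bounded_linear[symmetric]
  by (rule linearI)
    (simp_all add: complex_coord_def complex_eq_iff inner_add_left scaleC_add_right scaleC_scaleR)

section \<open>Calculus of holomorphic maps between vector spaces\<close>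

lemma holo_onI:
  assumes "\<And>x. x \<in> S \<Longrightarrow> (f has_derivative D x) (at x)"
    and "\<And>x c v. x \<in> S \<Longrightarrow> D x (c *\<^sub>C v) = c *\<^sub>C D x v"
  shows "holo_on S f"
  using assms unfolding holo_on_def by blast

lemma holo_on_has_derivative:
  assumes "holo_on S f" "x \<in> S"
  shows "(f has_derivative frechet_derivative f (at x)) (at x)"
  using assms unfolding holo_on_def by (metis differentiableI frechet_derivative_works)

lemma holo_on_frechet_scaleC:
  assumes "holo_on S f" "x \<in> S"
  shows "frechet_derivative f (at x) (c *\<^sub>C v) = c *\<^sub>C frechet_derivative f (at x) v"
  using assms unfolding holo_on_def by (metis frechet_derivative_at)

lemma holo_on_subset: "holo_on S f \<Longrightarrow> T \<subseteq> S \<Longrightarrow> holo_on T f"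
  unfolding holo_on_def by blast

lemma holo_on_continuous_on: "holo_on S f \<Longrightarrow> continuous_on S f"
  by (meson continuous_at_imp_continuous_on has_derivative_continuous holo_on_has_derivative)

lemma holo_on_eventually_cong:
  assumes "holo_on S f" "\<And>x. x \<in> S \<Longrightarrow> \<forall>\<^sub>F y in nhds x. g y = f y"
  shows "holo_on S g"
  unfolding holo_on_def
proof
  fix x assume x: "x \<in> S"
  obtain D where D: "(f has_derivative D) (at x)" "\<forall>c v. D (c *\<^sub>C v) = c *\<^sub>C D v"
    using assms(1) x unfolding holo_on_def by blast
  obtain T where "open T" "x \<in> T" "\<And>y. y \<in> T \<Longrightarrow> f y = g y"
    using assms(2)[OF x] unfolding eventually_nhds by metis
  then have "(g has_derivative D) (at x)"
    using has_derivative_transform_within_open[OF D(1)] by blast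
  with D show "\<exists>D. (g has_derivative D) (at x) \<and> (\<forall>c v. D (c *\<^sub>C v) = c *\<^sub>C D v)" by blast
qed

text \<open>\<open>holo_on\<close> speaks of two-sided derivatives in the full space, so agreement
  has to hold near each point; openness of \<open>S\<close> supplies the neighbourhoods.\<close>

lemma holo_on_cong:
  assumes "holo_on S f" "open S" "\<And>x. x \<in> S \<Longrightarrow> g x = f x"
  shows "holo_on S g"
  using assms(1)
  by (rule holo_on_eventually_cong) (use assms(2,3) in \<open>auto simp: eventually_nhds\<close>)

lemma holo_on_locally:
  assumes "\<And>x. x \<in> S \<Longrightarrow> \<exists>T. x \<in> T \<and> holo_on T f"
  shows "holo_on S f"
  using assms unfolding holo_on_def by blast

lemma holo_on_compose:
  assumes "holo_on S f" "holo_on T g" "f ` S \<subseteq> T"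
  shows "holo_on S (\<lambda>x. g (f x))"
  unfolding holo_on_def
proof
  fix x assume "x \<in> S"
  moreover then have "f x \<in> T" using assms(3) by blast
  ultimately obtain D E where "(f has_derivative D) (at x)" "\<forall>c v. D (c *\<^sub>C v) = c *\<^sub>C D v"
    "(g has_derivative E) (at (f x))" "\<forall>c v. E (c *\<^sub>C v) = c *\<^sub>C E v"
    using assms(1,2) unfolding holo_on_def by meson
  then show "\<exists>D. ((\<lambda>x. g (f x)) has_derivative D) (at x) \<and> (\<forall>c v. D (c *\<^sub>C v) = c *\<^sub>C D v)"
    by (intro exI[of _ "\<lambda>v. E (D v)"]) (auto intro: has_derivative_compose)
qed

lemma holo_on_const: "holo_on S (\<lambda>_. c)"
  by (rule holo_onI[where D = "\<lambda>_ _. 0"]) auto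

lemma holo_on_ident: "holo_on S (\<lambda>x. x)"
  by (rule holo_onI[where D = "\<lambda>_ h. h"]) (auto intro!: derivative_eq_intros)

lemma holo_on_fst: "holo_on S fst"
  by (rule holo_onI[where D = "\<lambda>_. fst"])
    (auto intro!: derivative_eq_intros simp: scaleC_prod_def)

lemma holo_on_snd: "holo_on S snd"
  by (rule holo_onI[where D = "\<lambda>_. snd"])
    (auto intro!: derivative_eq_intros simp: scaleC_prod_def)

lemma holo_on_Pair:
  assumes "holo_on S f" "holo_on S g"
  shows "holo_on S (\<lambda>x. (f x, g x))"
  by (rule holo_onI, rule has_derivative_Pair; (rule holo_on_has_derivative[of S])?)
    (use assms in \<open>auto simp: scaleC_prod_def holo_on_frechet_scaleC\<close>)

lemma holo_on_add:
  assumes "holo_on S f" "holo_on S g"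
  shows "holo_on S (\<lambda>x. f x + g x)"
  by (rule holo_onI, rule has_derivative_add; (rule holo_on_has_derivative[of S])?)
    (use assms in \<open>auto simp: scaleC_add_right holo_on_frechet_scaleC\<close>)

lemma holo_on_diff:
  assumes "holo_on S f" "holo_on S g"
  shows "holo_on S (\<lambda>x. f x - g x)"
  by (rule holo_onI, rule has_derivative_diff; (rule holo_on_has_derivative[of S])?)
    (use assms in \<open>auto simp: scaleC.diff_right holo_on_frechet_scaleC\<close>)

lemma holo_on_scaleC:
  assumes "holo_on S f" "holo_on S g"
  shows "holo_on S (\<lambda>x. f x *\<^sub>C g x)"
  by (rule holo_onI, rule scaleC.FDERIV; (rule holo_on_has_derivative[of S])?)
    (use assms in \<open>auto simp: scaleC_add_right holo_on_frechet_scaleC scaleC_scaleC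
      scaleC_complex_def mult.commute\<close>)

lemma holo_on_complex_has_field_derivative:
  fixes f :: "complex \<Rightarrow> complex"
  assumes "holo_on S f" "z \<in> S"
  shows "(f has_field_derivative frechet_derivative f (at z) 1) (at z)"
proof -
  have "frechet_derivative f (at z) h = frechet_derivative f (at z) 1 * h" for h
    using holo_on_frechet_scaleC[OF assms, of h 1] by (simp add: scaleC_complex_def mult.commute)
  then have "frechet_derivative f (at z) = (*) (frechet_derivative f (at z) 1)"
    by blast
  then show ?thesis
    using holo_on_has_derivative[OF assms] unfolding has_field_derivative_def by metis
qed

lemma holo_on_imp_holomorphic_on:
  fixes f :: "complex \<Rightarrow> complex"
  shows "holo_on S f \<Longrightarrow> f holomorphic_on S"
  unfolding holomorphic_on_def field_differentiable_def
  by (meson holo_on_complex_has_field_derivative has_field_derivative_at_within)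

lemma holo_on_complex_coord: "holo_on S (complex_coord b)"
  by (rule holo_onI[where D = "\<lambda>_. complex_coord b"])
    (auto intro!: bounded_linear_imp_has_derivative bounded_linear_complex_coord
      simp: complex_coord_scaleC scaleC_complex_def)

section \<open>Cauchy integrals along complex lines\<close>

lemma holo_on_affine: "holo_on S (\<lambda>s. x + s *\<^sub>C b)"
  by (intro holo_on_add holo_on_scaleC holo_on_const holo_on_ident)

text \<open>On the complex line through \<open>x\<close> in direction \<open>b\<close>, each
  coordinate of \<open>F\<close> is holomorphic in one variable, and Cauchy's formula for the first
  derivative applies. The integrand involves \<open>F\<close> alone, so regularity in
  \<open>x\<close> can be read off under the integral.\<close>

lemma frechet_derivative_Cauchy:
  fixes F :: "'v::complex_euclidean \<Rightarrow> 'w::complex_euclidean"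
  assumes F: "holo_on U F" and r: "r > 0" and U: "\<And>s. s \<in> cball 0 r \<Longrightarrow> x + s *\<^sub>C b \<in> U"
  shows "((\<lambda>\<theta>. (1 / (2 * pi * r)) *\<^sub>R (cis (- \<theta>) *\<^sub>C F (x + (complex_of_real r * cis \<theta>) *\<^sub>C b)))
    has_integral frechet_derivative F (at x) b) (cbox 0 (2 * pi))"
proof (subst has_integral_componentwise_iff, intro ballI)
  fix c :: 'w assume "c \<in> Basis"
  define g where "g s = complex_coord c (F (x + s *\<^sub>C b))" for s
  have hol: "holo_on (cball 0 r) g"
    unfolding g_def
    by (rule holo_on_compose[OF _ holo_on_complex_coord subset_UNIV],
        rule holo_on_compose[OF holo_on_affine F]) (use U in blast)
  have "x + 0 *\<^sub>C b \<in> U" using U[of 0] r by simp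
  then have x: "x \<in> U" by simp
  have "(g has_derivative (\<lambda>s. complex_coord c (frechet_derivative F (at x) (s *\<^sub>C b)))) (at 0)"
    unfolding g_def
    apply (rule bounded_linear.has_derivative[OF bounded_linear_complex_coord])
    apply (rule has_derivative_compose[where g = F])
    by (auto intro!: derivative_eq_intros holo_on_has_derivative[OF F x])
  then have "(g has_field_derivative complex_coord c (frechet_derivative F (at x) b)) (at 0)"
    by (simp add: has_field_derivative_def holo_on_frechet_scaleC[OF F x] complex_coord_scaleC
        mult.commute[of _ "complex_coord _ _"])
  then have deriv: "deriv g 0 = complex_coord c (frechet_derivative F (at x) b)"
    by (rule DERIV_imp_deriv)
  have "((\<lambda>u. g u / (u - 0) ^ Suc 1) has_contour_integral 2 * pi * \<i> / fact 1 * (deriv ^^ 1) g 0)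
      (circlepath 0 r)"
    by (rule Cauchy_has_contour_integral_higher_derivative_circlepath)
      (use hol r in \<open>auto intro!: holo_on_continuous_on holo_on_imp_holomorphic_on
        intro: holo_on_subset\<close>)
  then have "((\<lambda>u. g u / u\<^sup>2) has_contour_integral 2 * pi * \<i> * complex_coord c (frechet_derivative F (at x) b))
      (part_circlepath 0 r 0 (2 * pi))"
    by (simp add: circlepath_def power2_eq_square deriv)
  then have "((\<lambda>\<theta>. g (0 + r * cis \<theta>) / (0 + r * cis \<theta>)\<^sup>2 * r * \<i> * cis \<theta>) has_integral
      2 * pi * \<i> * complex_coord c (frechet_derivative F (at x) b)) {0..2 * pi}"
    by (subst (asm) has_contour_integral_part_circlepath_iff) auto
  then have "((\<lambda>\<theta>. (1 / (2 * pi * \<i>)) * (g (0 + r * cis \<theta>) / (0 + r * cis \<theta>)\<^sup>2 * r * \<i> * cis \<theta>)) has_integral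
      (1 / (2 * pi * \<i>)) * (2 * pi * \<i> * complex_coord c (frechet_derivative F (at x) b))) {0..2 * pi}"
    by (rule has_integral_mult_right)
  \<comment> \<open>With \<open>u = r * cis \<theta>\<close> and
    \<open>du = \<i> * u d\<theta>\<close>, the kernel
    \<open>du / (2 * pi * \<i> * u\<^sup>2)\<close> becomes
    \<open>cis (- \<theta>) / (2 * pi * r) d\<theta>\<close>.\<close>
  moreover have "(1 / (2 * pi * \<i>)) * (g (0 + r * cis \<theta>) / (0 + r * cis \<theta>)\<^sup>2 * r * \<i> * cis \<theta>)
     = complex_coord c ((1 / (2 * pi * r)) *\<^sub>R (cis (- \<theta>) *\<^sub>C F (x + (complex_of_real r * cis \<theta>) *\<^sub>C b)))" for \<theta>
    using r by (simp add: linear_cmul[OF bounded_linear.linear[OF bounded_linear_complex_coord]]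
        complex_coord_scaleC g_def power2_eq_square scaleR_conv_of_real divide_simps
        flip: cis_inverse)
  ultimately have "((\<lambda>\<theta>. complex_coord c ((1 / (2 * pi * r)) *\<^sub>R (cis (- \<theta>) *\<^sub>C F (x + (complex_of_real r * cis \<theta>) *\<^sub>C b))))
      has_integral complex_coord c (frechet_derivative F (at x) b)) {0..2 * pi}"
    by simp
  \<comment> \<open>The real part of \<open>complex_coord c\<close> is the inner product with
    \<open>c\<close>, so the scalar formula yields one component of the vector formula.\<close>
  from has_integral_linear[OF this bounded_linear_Re]
  show "((\<lambda>\<theta>. ((1 / (2 * pi * r)) *\<^sub>R (cis (- \<theta>) *\<^sub>C F (x + (complex_of_real r * cis \<theta>) *\<^sub>C b))) \<bullet> c) has_integral
      frechet_derivative F (at x) b \<bullet> c) (cbox 0 (2 * pi))"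
    by (simp add: o_def cbox_interval)
qed

text \<open>Differentiation under the integral requires one radius that serves all \<open>x\<close>
  near \<open>x0\<close>; halving a ball around \<open>x0\<close> leaves this room for the
  displacement along \<open>b\<close>. Convexity of \<open>V\<close> is what the Leibniz rule asks
  for.\<close>

lemma open_complex_line_radius:
  fixes b :: "'v::complex_euclidean"
  assumes "open U" "x0 \<in> U"
  obtains V r where "open V" "convex V" "x0 \<in> V" "V \<subseteq> U" "r > 0"
    "\<And>x s. x \<in> V \<Longrightarrow> s \<in> cball 0 r \<Longrightarrow> x + s *\<^sub>C b \<in> U"
proof -
  obtain e where e: "e > 0" "ball x0 e \<subseteq> U"
    using assms open_contains_ball by blast
  \<comment> \<open>The Euclidean norm need not be compatible with complex scalars; bilinearity
    gives the bound up to a constant.\<close>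
  obtain M where M: "M > 0" "\<And>s (v::'v). norm (s *\<^sub>C v) \<le> norm s * norm v * M"
    using scaleC.pos_bounded by metis
  \<comment> \<open>Chosen so that \<open>r * (norm b * M + 1) = e / 2\<close>; the summand 1 covers
    \<open>b = 0\<close>.\<close>
  define r where "r = e / (2 * (norm b * M + 1))"
  have nb: "norm b * M + 1 > 0"
    using M(1) by (simp add: add_nonneg_pos)
  show thesis
  proof
    show "r > 0" using e(1) nb by (simp add: r_def)
    show "x + s *\<^sub>C b \<in> U" if "x \<in> ball x0 (e / 2)" "s \<in> cball 0 r" for x s
    proof -
      have "norm (s *\<^sub>C b) \<le> norm s * (norm b * M)"
        using M(2)[of s b] by (simp add: mult.assoc)
      also have "\<dots> \<le> r * (norm b * M + 1)"
        using that(2) M(1) order_trans[OF norm_ge_zero[of s]] by (intro mult_mono) auto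
      also have "\<dots> = e / 2"
        using nb by (simp add: r_def field_simps)
      finally have "dist x0 (x + s *\<^sub>C b) < e"
        using that(1) norm_triangle_ineq4[of "x0 - x" "s *\<^sub>C b"] by (simp add: dist_norm algebra_simps)
      then show ?thesis using e(2) by auto
    qed
  qed (use e in auto)
qed

text \<open>The Cauchy integrand contains only the continuous map \<open>F\<close>, so the integral
  depends continuously on \<open>x\<close>. This is the continuity that the Leibniz rule requires in
  the next lemma.\<close>

lemma continuous_on_frechet_derivative:
  fixes F :: "'v::complex_euclidean \<Rightarrow> 'w::complex_euclidean"
  assumes U: "open U" and F: "holo_on U F"
  shows "continuous_on U (\<lambda>x. frechet_derivative F (at x) b)"
proof (rule continuous_at_imp_continuous_on, rule ballI)
  fix x0 assume "x0 \<in> U"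
  then obtain V r where V: "open V" "convex V" "x0 \<in> V" "V \<subseteq> U" and r: "r > 0"
    and inU: "\<And>x s. x \<in> V \<Longrightarrow> s \<in> cball 0 r \<Longrightarrow> x + s *\<^sub>C b \<in> U"
    using open_complex_line_radius[OF U] by metis
  have "continuous_on V (\<lambda>x. integral (cbox 0 (2 * pi)) (\<lambda>\<theta>. (1 / (2 * pi * r)) *\<^sub>R
      (cis (- \<theta>) *\<^sub>C F (x + (complex_of_real r * cis \<theta>) *\<^sub>C b))))"
    using inU r unfolding case_prod_beta
    by (intro integral_continuous_on_param)
      (auto intro!: continuous_intros continuous_on_compose2[OF holo_on_continuous_on[OF F]]
        simp: case_prod_beta norm_mult)
  moreover have "integral (cbox 0 (2 * pi)) (\<lambda>\<theta>. (1 / (2 * pi * r)) *\<^sub>R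
      (cis (- \<theta>) *\<^sub>C F (x + (complex_of_real r * cis \<theta>) *\<^sub>C b))) = frechet_derivative F (at x) b"
    if "x \<in> V" for x
    using frechet_derivative_Cauchy[OF F r inU[OF that]] by (rule integral_unique)
  ultimately have "continuous_on V (\<lambda>x. frechet_derivative F (at x) b)"
    by simp
  then show "isCont (\<lambda>x. frechet_derivative F (at x) b) x0"
    using V continuous_on_eq_continuous_at by blast
qed

text \<open>The Cauchy integral is differentiated under the integral sign: the
  \<open>x\<close>-derivative of the integrand is continuous by the preceding lemma, and its complex
  linearity passes through the integral. Iteration reaches derivatives of all orders.\<close>

lemma holo_on_frechet_derivative_const:
  fixes F :: "'v::complex_euclidean \<Rightarrow> 'w::complex_euclidean"
  assumes U: "open U" and F: "holo_on U F"
  shows "holo_on U (\<lambda>x. frechet_derivative F (at x) b)"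
  unfolding holo_on_def
proof
  fix x0 assume "x0 \<in> U"
  then obtain V r where V: "open V" "convex V" "x0 \<in> V" "V \<subseteq> U" and r: "r > 0"
    and inU: "\<And>x s. x \<in> V \<Longrightarrow> s \<in> cball 0 r \<Longrightarrow> x + s *\<^sub>C b \<in> U"
    using open_complex_line_radius[OF U] by metis
  define f where "f x \<theta> = (1 / (2 * pi * r)) *\<^sub>R
      (cis (- \<theta>) *\<^sub>C F (x + (complex_of_real r * cis \<theta>) *\<^sub>C b))" for x \<theta>
  define D where "D x \<theta> = (\<lambda>h. (1 / (2 * pi * r)) *\<^sub>R
      (cis (- \<theta>) *\<^sub>C frechet_derivative F (at (x + (complex_of_real r * cis \<theta>) *\<^sub>C b)) h))" for x \<theta>
  \<comment> \<open>The Leibniz rule integrates the derivative as an element of the normed space of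
    bounded linear maps, hence this packaging of \<open>D\<close>.\<close>
  define fx where "fx x \<theta> = Blinfun (D x \<theta>)" for x \<theta>
  have pt: "x + (complex_of_real r * cis \<theta>) *\<^sub>C b \<in> U" if "x \<in> V" for x \<theta>
    using inU[OF that] r by (simp add: norm_mult)
  have D: "(( \<lambda>x. f x \<theta>) has_derivative D x \<theta>) (at x)" if "x \<in> V" for x \<theta>
  proof -
    have "((\<lambda>x. F (x + (complex_of_real r * cis \<theta>) *\<^sub>C b)) has_derivative
        frechet_derivative F (at (x + (complex_of_real r * cis \<theta>) *\<^sub>C b))) (at x)"
      by (rule has_derivative_compose[where g = F and f' = "\<lambda>h. h"])
        (auto intro!: derivative_eq_intros holo_on_has_derivative[OF F pt[OF that]])
    then show ?thesis
      unfolding f_def D_def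
      by (intro bounded_linear.has_derivative[OF bounded_linear_scaleR_right]
          bounded_linear.has_derivative[OF scaleC.bounded_linear_right])
  qed
  have fx: "blinfun_apply (fx x \<theta>) = D x \<theta>" if "x \<in> V" for x \<theta>
    unfolding fx_def
    by (rule bounded_linear_Blinfun_apply) (use D[OF that] in \<open>rule has_derivative_bounded_linear\<close>)
  have cont: "continuous_on (V \<times> cbox 0 (2 * pi)) (\<lambda>(x, t). fx x t)"
  proof (rule continuous_on_blinfun_componentwise)
    fix i :: 'v assume "i \<in> Basis"
    have "continuous_on (V \<times> cbox 0 (2 * pi)) (\<lambda>y. D (fst y) (snd y) i)"
      unfolding D_def using pt
      by (auto intro!: continuous_intros continuous_on_compose2[OF continuous_on_frechet_derivative[OF U F]])
    then show "continuous_on (V \<times> cbox 0 (2 * pi)) (\<lambda>y. blinfun_apply (case y of (x, t) \<Rightarrow> fx x t) i)"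
      by (rule continuous_on_eq) (auto simp: fx)
  qed
  have int_f: "(f x has_integral frechet_derivative F (at x) b) (cbox 0 (2 * pi))" if "x \<in> V" for x
    unfolding f_def using frechet_derivative_Cauchy[OF F r inU[OF that]] .
  have "f x integrable_on cbox 0 (2 * pi)" if "x \<in> V" for x
    using int_f[OF that] by (rule has_integral_integrable)
  then have "((\<lambda>x. integral (cbox 0 (2 * pi)) (f x)) has_derivative integral (cbox 0 (2 * pi)) (fx x0))
      (at x0 within V)"
    by (intro leibniz_rule)
      (use V cont D fx in \<open>auto intro: has_derivative_at_withinI simp del: box_real\<close>)
  then have "((\<lambda>x. integral (cbox 0 (2 * pi)) (f x)) has_derivative integral (cbox 0 (2 * pi)) (fx x0))
      (at x0)"
    using V at_within_open by metis
  then have der: "((\<lambda>x. frechet_derivative F (at x) b) has_derivative integral (cbox 0 (2 * pi)) (fx x0))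
      (at x0)"
    by (rule has_derivative_transform_within_open[OF _ V(1,3)]) (use int_f integral_unique in blast)
  have "continuous_on (cbox 0 (2 * pi)) (fx x0)"
    by (rule continuous_on_compose2[OF cont, of _ "\<lambda>t. (x0, t)", simplified])
      (use V(3) in \<open>auto intro!: continuous_intros\<close>)
  then have int: "fx x0 integrable_on cbox 0 (2 * pi)"
    by (rule integrable_continuous)
  \<comment> \<open>Evaluation at a vector and multiplication by \<open>c\<close> are bounded
    linear, hence commute with the integral.\<close>
  have lin: "blinfun_apply (integral (cbox 0 (2 * pi)) (fx x0)) (c *\<^sub>C v) =
      c *\<^sub>C blinfun_apply (integral (cbox 0 (2 * pi)) (fx x0)) v" for c v
  proof -
    have intv: "(\<lambda>\<theta>. D x0 \<theta> v) integrable_on cbox 0 (2 * pi)"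
      using integrable_linear[OF int blinfun.bounded_linear_left[of v]] fx[OF V(3)] by (simp add: o_def)
    have "D x0 \<theta> (c *\<^sub>C v) = c *\<^sub>C D x0 \<theta> v" for \<theta>
      by (simp add: D_def holo_on_frechet_scaleC[OF F pt[OF V(3)]] scaleC_scaleC scaleC_scaleR)
        (simp add: mult.commute)
    then show ?thesis
      using integral_linear[OF intv scaleC.bounded_linear_right[of c]]
      by (simp add: blinfun_apply_integral[OF int] fx[OF V(3)] o_def del: box_real)
  qed
  show "\<exists>D. ((\<lambda>x. frechet_derivative F (at x) b) has_derivative D) (at x0) \<and>
      (\<forall>c v. D (c *\<^sub>C v) = c *\<^sub>C D v)"
    using der lin by blast
qed

lemma frechet_derivative_Basis_sum:
  assumes "holo_on U F" "x \<in> U"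
  shows "frechet_derivative F (at x) w = (\<Sum>b\<in>Basis. (w \<bullet> b) *\<^sub>R frechet_derivative F (at x) b)"
proof -
  have "linear (frechet_derivative F (at x))"
    using holo_on_has_derivative[OF assms] has_derivative_linear by blast
  from linear_sum[OF this, of "\<lambda>b. (w \<bullet> b) *\<^sub>R b" Basis] show ?thesis
    by (simp add: euclidean_representation linear_cmul[OF \<open>linear _\<close>])
qed

text \<open>Here base point and direction both vary with \<open>z\<close>. Expanding the direction
  in the real basis reduces to fixed directions, where the derivative is already known to be
  holomorphic.\<close>

lemma holo_on_frechet_derivative:
  fixes F :: "'v::complex_euclidean \<Rightarrow> 'w::complex_euclidean"
  assumes U: "open U" and F: "holo_on U F" and u: "holo_on S u" and w: "holo_on S w"
    and sub: "u ` S \<subseteq> U"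
  shows "holo_on S (\<lambda>z. frechet_derivative F (at (u z)) (w z))"
proof -
  define P where "P = (\<lambda>y::'v \<times> 'v. \<Sum>b\<in>Basis. (snd y \<bullet> b) *\<^sub>R frechet_derivative F (at (fst y)) b)"
  define E where "E = (\<lambda>b x. frechet_derivative (\<lambda>x. frechet_derivative F (at x) b) (at x))"
  have P: "P y = frechet_derivative F (at (fst y)) (snd y)" if "fst y \<in> U" for y
    unfolding P_def by (rule frechet_derivative_Basis_sum[OF F that, symmetric])
  have "holo_on (U \<times> UNIV) P"
  proof (rule holo_onI)
    fix y :: "'v \<times> 'v" assume "y \<in> U \<times> UNIV"
    then have y: "fst y \<in> U" by auto
    have E: "((\<lambda>y. frechet_derivative F (at (fst y)) b) has_derivative (\<lambda>h. E b (fst y) (fst h))) (at y)" for b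
      unfolding E_def
      by (rule has_derivative_compose[where f = fst and f' = fst])
        (auto intro!: derivative_eq_intros
          holo_on_has_derivative[OF holo_on_frechet_derivative_const[OF U F] y])
    have "(P has_derivative (\<lambda>h. \<Sum>b\<in>Basis. (snd y \<bullet> b) *\<^sub>R E b (fst y) (fst h) +
       (snd h \<bullet> b) *\<^sub>R frechet_derivative F (at (fst y)) b)) (at y)"
      unfolding P_def
      by (intro has_derivative_sum has_derivative_scaleR E) (auto intro!: derivative_eq_intros)
    \<comment> \<open>The real coordinates of the direction are not complex differentiable one by
      one; regrouping their part of the derivative into \<open>frechet_derivative F\<close> restores
      complex linearity.\<close>
    then show "(P has_derivative (\<lambda>h. (\<Sum>b\<in>Basis. (snd y \<bullet> b) *\<^sub>R E b (fst y) (fst h)) +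
       frechet_derivative F (at (fst y)) (snd h))) (at y)"
      unfolding sum.distrib frechet_derivative_Basis_sum[OF F y, of "snd _", symmetric] .
    fix c h
    have "E b (fst y) (c *\<^sub>C v) = c *\<^sub>C E b (fst y) v" for b v
      unfolding E_def
      by (rule holo_on_frechet_scaleC[OF holo_on_frechet_derivative_const[OF U F] y])
    then show "(\<Sum>b\<in>Basis. (snd y \<bullet> b) *\<^sub>R E b (fst y) (fst (c *\<^sub>C h))) +
       frechet_derivative F (at (fst y)) (snd (c *\<^sub>C h)) =
      c *\<^sub>C ((\<Sum>b\<in>Basis. (snd y \<bullet> b) *\<^sub>R E b (fst y) (fst h)) +
       frechet_derivative F (at (fst y)) (snd h))"
      by (simp add: scaleC_prod_def holo_on_frechet_scaleC[OF F y] scaleC_add_right scaleC.sum_right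
          scaleC_scaleR)
  qed
  moreover have "open (U \<times> (UNIV::'v set))" using U by (simp add: open_Times)
  ultimately have "holo_on (U \<times> UNIV) (\<lambda>y. frechet_derivative F (at (fst y)) (snd y))"
    by (rule holo_on_cong) (auto simp: P)
  from holo_on_compose[OF holo_on_Pair[OF u w] this] sub show ?thesis
    by auto
qed

section \<open>Smooth curves\<close>

abbreviation vderiv :: "(real \<Rightarrow> 'v::real_normed_vector) \<Rightarrow> real \<Rightarrow> 'v"
  where "vderiv f \<equiv> \<lambda>t. vector_derivative f (at t)"

text \<open>A graded form of \<open>smooth_fun\<close> with two-sided derivatives: recursion on the
  order lets closure properties be proved by induction. On open sets, holding for every
  \<open>n\<close> amounts to \<open>smooth_fun\<close>.\<close>

fun diff_times :: "nat \<Rightarrow> real set \<Rightarrow> (real \<Rightarrow> 'v::real_normed_vector) \<Rightarrow> bool" where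
  "diff_times 0 T f \<longleftrightarrow> True"
| "diff_times (Suc n) T f \<longleftrightarrow> (\<forall>t\<in>T. f differentiable (at t)) \<and> diff_times n T (vderiv f)"

lemma has_vector_derivative_transform_open:
  assumes "open T" "t \<in> T" "\<And>s. s \<in> T \<Longrightarrow> f s = g s" "(f has_vector_derivative D) (at t)"
  shows "(g has_vector_derivative D) (at t)"
  using has_derivative_transform_within_open[of f _ t UNIV T g] assms
  unfolding has_vector_derivative_def by blast

lemma diff_times_cong_imp:
  assumes "open T" "\<And>t. t \<in> T \<Longrightarrow> f t = g t" "diff_times n T f"
  shows "diff_times n T g"
  using assms(2,3)
proof (induction n arbitrary: f g)
  case (Suc n)
  have 1: "(g has_vector_derivative vderiv f t) (at t)" if "t \<in> T" for t
    using has_vector_derivative_transform_open[OF assms(1) that] Suc.prems that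
      vector_derivative_works by (metis diff_times.simps(2))
  have "diff_times n T (vderiv g)"
    using Suc.IH[of "vderiv f" "vderiv g"] Suc.prems(2) 1 vector_derivative_at
    by (metis diff_times.simps(2))
  with 1 show ?case
    by (auto intro: differentiableI_vector)
qed simp

lemma diff_timesI:
  assumes "open T" "\<And>t. t \<in> T \<Longrightarrow> (f has_vector_derivative f' t) (at t)" "diff_times n T f'"
  shows "diff_times (Suc n) T f"
proof -
  have "diff_times n T (vderiv f)"
    by (rule diff_times_cong_imp[OF assms(1) _ assms(3)]) (use assms(2) vector_derivative_at in metis)
  then show ?thesis
    using assms(2) by (auto intro: differentiableI_vector)
qed

lemma diff_times_has_vderiv:
  "diff_times (Suc n) T f \<Longrightarrow> t \<in> T \<Longrightarrow> (f has_vector_derivative vderiv f t) (at t)"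
  by (simp add: vector_derivative_works)

lemma diff_times_subset: "diff_times n T f \<Longrightarrow> S \<subseteq> T \<Longrightarrow> diff_times n S f"
  by (induction n arbitrary: f) auto

lemma diff_times_locally:
  "(\<And>t. t \<in> T \<Longrightarrow> \<exists>S. t \<in> S \<and> diff_times n S f) \<Longrightarrow> diff_times n T f"
proof (induction n arbitrary: f)
  case (Suc n)
  have "diff_times n T (vderiv f)"
    by (rule Suc.IH) (use Suc.prems in fastforce)
  with Suc.prems show ?case by fastforce
qed simp

lemma diff_times_Suc_imp: "diff_times (Suc n) T f \<Longrightarrow> diff_times n T f"
  by (induction n arbitrary: f) auto

lemma diff_times_const: "open T \<Longrightarrow> diff_times n T (\<lambda>_. c)"
  by (induction n arbitrary: c)
    (auto intro!: diff_timesI[where f' = "\<lambda>_. 0"] simp del: diff_times.simps(2))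

lemma diff_times_add:
  assumes "open T" "diff_times n T f" "diff_times n T g"
  shows "diff_times n T (\<lambda>t. f t + g t)"
  using assms(2,3)
proof (induction n arbitrary: f g)
  case (Suc n)
  show ?case
    by (rule diff_timesI[OF assms(1) has_vector_derivative_add[OF diff_times_has_vderiv diff_times_has_vderiv]])
      (use Suc in auto)
qed simp

lemma diff_times_sum:
  assumes "open T" "\<And>i. i \<in> I \<Longrightarrow> diff_times n T (f i)"
  shows "diff_times n T (\<lambda>t. \<Sum>i\<in>I. f i t)"
  using assms(2)
  by (induction I rule: infinite_finite_induct) (simp_all add: diff_times_const diff_times_add assms(1))

lemma diff_times_bilinear:
  assumes "open T" "bounded_bilinear b" "diff_times n T f" "diff_times n T g"
  shows "diff_times n T (\<lambda>t. b (f t) (g t))"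
  using assms(3,4)
proof (induction n arbitrary: f g)
  case (Suc n)
  show ?case
  proof (rule diff_timesI[OF assms(1)])
    show "((\<lambda>t. b (f t) (g t)) has_vector_derivative b (f t) (vderiv g t) + b (vderiv f t) (g t)) (at t)"
      if "t \<in> T" for t
      using bounded_bilinear.has_vector_derivative[OF assms(2) diff_times_has_vderiv diff_times_has_vderiv]
        Suc.prems that by blast
    show "diff_times n T (\<lambda>t. b (f t) (vderiv g t) + b (vderiv f t) (g t))"
      by (intro diff_times_add assms(1) Suc.IH)
        (use Suc.prems diff_times_Suc_imp[OF Suc.prems(1)] diff_times_Suc_imp[OF Suc.prems(2)] in auto)
  qed
qed simp

lemma diff_times_linear:
  assumes "open T" "bounded_linear b" "diff_times n T f"
  shows "diff_times n T (\<lambda>t. b (f t))"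
  using assms(3)
proof (induction n arbitrary: f)
  case (Suc n)
  show ?case
    by (rule diff_timesI[OF assms(1) bounded_linear.has_vector_derivative[OF assms(2) diff_times_has_vderiv]])
      (use Suc in auto)
qed simp

lemma diff_times_Pair:
  assumes "open T" "diff_times n T f" "diff_times n T g"
  shows "diff_times n T (\<lambda>t. (f t, g t))"
  using assms(2,3)
proof (induction n arbitrary: f g)
  case (Suc n)
  show ?case
    by (rule diff_timesI[OF assms(1) has_vector_derivative_Pair[OF diff_times_has_vderiv diff_times_has_vderiv]])
      (use Suc in auto)
qed simp

text \<open>By the chain rule the derivative is a sum of components of the derivative of
  \<open>u\<close> times directional derivatives of \<open>F\<close> along \<open>u\<close>. These
  directional derivatives are again holomorphic, so the induction keeps \<open>F\<close>
  arbitrary.\<close>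

lemma diff_times_holo:
  fixes F :: "'v::complex_euclidean \<Rightarrow> 'w::complex_euclidean"
  assumes "open T" "open U" "holo_on U F" "u ` T \<subseteq> U" "diff_times n T u"
  shows "diff_times n T (\<lambda>t. F (u t))"
  using assms(3,5)
proof (induction n arbitrary: F)
  case (Suc n)
  have D: "((\<lambda>t. F (u t)) has_vector_derivative
      (\<Sum>b\<in>Basis. (vderiv u t \<bullet> b) *\<^sub>R frechet_derivative F (at (u t)) b)) (at t)" if t: "t \<in> T" for t
  proof -
    have ut: "u t \<in> U" using t assms(4) by blast
    have "(u has_derivative (\<lambda>h. h *\<^sub>R vderiv u t)) (at t)"
      using diff_times_has_vderiv[OF Suc.prems(2) t] by (simp add: has_vector_derivative_def)
    from has_derivative_compose[OF this holo_on_has_derivative[OF Suc.prems(1) ut]]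
    have "((\<lambda>t. F (u t)) has_derivative (\<lambda>h. h *\<^sub>R frechet_derivative F (at (u t)) (vderiv u t))) (at t)"
      by (simp add: linear_cmul[OF has_derivative_linear[OF holo_on_has_derivative[OF Suc.prems(1) ut]]])
    then show ?thesis
      unfolding has_vector_derivative_def
        frechet_derivative_Basis_sum[OF Suc.prems(1) ut, of "vderiv u t", symmetric] .
  qed
  show ?case
  proof (rule diff_timesI[OF assms(1) D])
    have "diff_times n T (\<lambda>t. (vderiv u t \<bullet> b) *\<^sub>R frechet_derivative F (at (u t)) b)" for b
      by (intro diff_times_bilinear[OF assms(1) bounded_bilinear_scaleR]
          diff_times_linear[OF assms(1) bounded_linear_inner_left] Suc.IH
          holo_on_frechet_derivative_const[OF assms(2) Suc.prems(1)])
        (use Suc.prems(2) diff_times_Suc_imp in auto)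
    then show "diff_times n T (\<lambda>t. \<Sum>b\<in>Basis. (vderiv u t \<bullet> b) *\<^sub>R frechet_derivative F (at (u t)) b)"
      by (intro diff_times_sum assms(1))
  qed
qed simp

lemma smooth_fun_imp_diff_times:
  assumes "open T" "smooth_fun T f"
  shows "diff_times n T f"
proof -
  obtain D where D: "\<And>t. t \<in> T \<Longrightarrow> D 0 t = f t"
    "\<And>k t. t \<in> T \<Longrightarrow> (D k has_vector_derivative D (Suc k) t) (at t within T)"
    using assms(2) unfolding smooth_fun_def by blast
  have D2: "(D k has_vector_derivative D (Suc k) t) (at t)" if "t \<in> T" for k t
    using D(2)[OF that, of k] at_within_open[OF that assms(1)] by simp
  have "diff_times n T (D k)" for k
    by (induction n arbitrary: k) (auto intro: diff_timesI[OF assms(1) D2] simp del: diff_times.simps(2))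
  from diff_times_cong_imp[OF assms(1) _ this[of 0]] D(1) show ?thesis by blast
qed

lemma diff_times_imp_smooth_fun:
  assumes "open T" "\<And>n. diff_times n T f"
  shows "smooth_fun T f"
  unfolding smooth_fun_def
proof (intro exI conjI ballI allI)
  have all: "diff_times m T ((vderiv ^^ n) f)" for n m
    by (induction n arbitrary: m) (use assms(2) in \<open>auto, metis diff_times.simps(2)\<close>)
  fix n t assume t: "t \<in> T"
  show "((vderiv ^^ n) f has_vector_derivative (vderiv ^^ Suc n) f t) (at t within T)"
    using diff_times_has_vderiv[OF all[of "Suc 0" n] t] by (simp add: has_vector_derivative_at_within)
qed simp

section \<open>Holomorphic maps into manifolds\<close>

lemma complex_atlas_cover:
  assumes "complex_atlas A"
  obtains \<phi> where "\<phi> \<in> A" "x \<in> fst \<phi>"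
  using assms unfolding complex_atlas_def by (metis UNIV_I UN_iff)

context
  fixes A :: "('a::t2_space, 'v::complex_euclidean) chart set" and \<phi> :: "('a, 'v) chart"
  assumes A: "complex_atlas A" and \<phi>: "\<phi> \<in> A"
begin

lemma chart_open: "open (fst \<phi>)"
  and chart_open_image: "open (snd \<phi> ` fst \<phi>)"
  and chart_homeomorphism: "homeomorphism (fst \<phi>) (snd \<phi> ` fst \<phi>) (snd \<phi>) (chart_inv \<phi>)"
  using A \<phi> unfolding complex_atlas_def by blast+

lemma chart_inv_chart: "x \<in> fst \<phi> \<Longrightarrow> chart_inv \<phi> (snd \<phi> x) = x"
  and chart_chart_inv: "v \<in> snd \<phi> ` fst \<phi> \<Longrightarrow> snd \<phi> (chart_inv \<phi> v) = v"
  and chart_inv_in: "v \<in> snd \<phi> ` fst \<phi> \<Longrightarrow> chart_inv \<phi> v \<in> fst \<phi>"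
  using chart_homeomorphism unfolding homeomorphism_def by auto

lemma chart_continuous_on: "continuous_on (fst \<phi>) (snd \<phi>)"
  and chart_inv_continuous_on: "continuous_on (snd \<phi> ` fst \<phi>) (chart_inv \<phi>)"
  using chart_homeomorphism unfolding homeomorphism_def by auto

lemma chart_inj_on: "inj_on (snd \<phi>) (fst \<phi>)"
  using chart_inv_chart by (metis inj_onI)

lemma chart_isCont: "x \<in> fst \<phi> \<Longrightarrow> isCont (snd \<phi>) x"
  using chart_continuous_on chart_open continuous_on_eq_continuous_at by blast

lemma chart_image_open:
  assumes "open U" "U \<subseteq> fst \<phi>"
  shows "open (snd \<phi> ` U)"
proof -
  have "snd \<phi> ` U = snd \<phi> ` fst \<phi> \<inter> chart_inv \<phi> -` U"
    using assms(2) chart_inv_chart by force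
  then show ?thesis
    using continuous_open_preimage[OF chart_inv_continuous_on chart_open_image assms(1)] by simp
qed

lemma chart_transition_holo:
  "\<psi> \<in> A \<Longrightarrow> holo_on (snd \<phi> ` (fst \<phi> \<inter> fst \<psi>)) (snd \<psi> \<circ> chart_inv \<phi>)"
  using A \<phi> unfolding complex_atlas_def by blast

end

text \<open>What \<open>holo_map\<close> becomes when the source is read through a chart. All
  calculations with \<open>K\<close>-valued maps on vector spaces, including maps of two variables,
  are carried out in this form.\<close>

definition mholo :: "('k::t2_space, 'v::complex_euclidean) chart set \<Rightarrow> 'w::complex_euclidean set \<Rightarrow>
    ('w \<Rightarrow> 'k) \<Rightarrow> bool"
  where "mholo B U f \<longleftrightarrow> continuous_on U f \<and>
    (\<forall>\<psi>\<in>B. holo_on (U \<inter> f -` fst \<psi>) (\<lambda>x. snd \<psi> (f x)))"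

lemma mholo_continuous_on: "mholo B U f \<Longrightarrow> continuous_on U f"
  by (simp add: mholo_def)

lemma mholo_holo_on: "mholo B U f \<Longrightarrow> \<psi> \<in> B \<Longrightarrow> holo_on (U \<inter> f -` fst \<psi>) (\<lambda>x. snd \<psi> (f x))"
  by (simp add: mholo_def)

lemma mholo_const: "mholo B U (\<lambda>_. x)"
  by (simp add: mholo_def holo_on_const)

lemma mholo_compose:
  assumes "mholo B W f" "holo_on V u" "u ` V \<subseteq> W"
  shows "mholo B V (\<lambda>x. f (u x))"
  unfolding mholo_def
proof (intro conjI ballI)
  show "continuous_on V (\<lambda>x. f (u x))"
    using continuous_on_compose2 mholo_continuous_on[OF assms(1)] holo_on_continuous_on[OF assms(2)]
      assms(3) by blast
  fix \<psi> assume "\<psi> \<in> B"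
  show "holo_on (V \<inter> (\<lambda>x. f (u x)) -` fst \<psi>) (\<lambda>x. snd \<psi> (f (u x)))"
    by (rule holo_on_compose[OF _ mholo_holo_on[OF assms(1) \<open>\<psi> \<in> B\<close>]])
      (use assms(2,3) in \<open>auto intro: holo_on_subset\<close>)
qed

lemma mholo_chart_inv:
  assumes "complex_atlas B" "\<phi> \<in> B"
  shows "mholo B (snd \<phi> ` fst \<phi>) (chart_inv \<phi>)"
  unfolding mholo_def
proof (intro conjI ballI)
  show "continuous_on (snd \<phi> ` fst \<phi>) (chart_inv \<phi>)"
    by (rule chart_inv_continuous_on[OF assms])
  fix \<psi> assume "\<psi> \<in> B"
  have "snd \<phi> ` fst \<phi> \<inter> chart_inv \<phi> -` fst \<psi> \<subseteq> snd \<phi> ` (fst \<phi> \<inter> fst \<psi>)"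
  proof
    fix v assume v: "v \<in> snd \<phi> ` fst \<phi> \<inter> chart_inv \<phi> -` fst \<psi>"
    then have "v = snd \<phi> (chart_inv \<phi> v)" "chart_inv \<phi> v \<in> fst \<phi> \<inter> fst \<psi>"
      using chart_chart_inv[OF assms] chart_inv_in[OF assms] by auto
    then show "v \<in> snd \<phi> ` (fst \<phi> \<inter> fst \<psi>)" by (rule image_eqI)
  qed
  then show "holo_on (snd \<phi> ` fst \<phi> \<inter> chart_inv \<phi> -` fst \<psi>) (\<lambda>x. snd \<psi> (chart_inv \<phi> x))"
    using chart_transition_holo[OF assms \<open>\<psi> \<in> B\<close>] by (auto intro: holo_on_subset simp: o_def)
qed

text \<open>The hypothesis on \<open>A\<close> asks just for what the argument uses of an atlas, so
  that the lemma also applies to \<open>prod_atlas\<close> and hence to the group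
  multiplication.\<close>

lemma mholo_holo_map:
  assumes A: "\<And>x. \<exists>\<phi>\<in>A. x \<in> fst \<phi> \<and> open (fst \<phi>) \<and> inj_on (snd \<phi>) (fst \<phi>)"
    and B: "complex_atlas B" and W: "open W"
    and F: "holo_map A B S F" and u: "mholo A W u" and sub: "u ` W \<subseteq> S"
  shows "mholo B W (\<lambda>x. F (u x))"
  unfolding mholo_def
proof (intro conjI ballI)
  show cont: "continuous_on W (\<lambda>x. F (u x))"
    using continuous_on_compose2[of S F W u] F u sub unfolding holo_map_def mholo_def by blast
  fix \<psi> assume \<psi>: "\<psi> \<in> B"
  show "holo_on (W \<inter> (\<lambda>x. F (u x)) -` fst \<psi>) (\<lambda>x. snd \<psi> (F (u x)))"
  proof (rule holo_on_locally)
    fix x assume x: "x \<in> W \<inter> (\<lambda>x. F (u x)) -` fst \<psi>"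
    obtain \<phi> where \<phi>: "\<phi> \<in> A" "u x \<in> fst \<phi>" "open (fst \<phi>)" "inj_on (snd \<phi>) (fst \<phi>)"
      using A by blast
    \<comment> \<open>On \<open>T\<close> both charts apply, and the map factors through the chart
      expression of \<open>F\<close>.\<close>
    define T where "T = (W \<inter> u -` fst \<phi>) \<inter> (W \<inter> (\<lambda>x. F (u x)) -` fst \<psi>)"
    have open_T: "open T"
      unfolding T_def
      by (intro open_Int continuous_open_preimage[OF mholo_continuous_on[OF u] W \<phi>(3)]
          continuous_open_preimage[OF cont W chart_open[OF B \<psi>]])
    have "holo_on T (\<lambda>y. (snd \<psi> \<circ> F \<circ> chart_inv \<phi>) (snd \<phi> (u y)))"
    proof (rule holo_on_compose[where f = "\<lambda>y. snd \<phi> (u y)"])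
      show "holo_on T (\<lambda>y. snd \<phi> (u y))"
        using mholo_holo_on[OF u \<phi>(1)] by (rule holo_on_subset) (auto simp: T_def)
      show "holo_on (snd \<phi> ` (S \<inter> fst \<phi> \<inter> F -` fst \<psi>)) (snd \<psi> \<circ> F \<circ> chart_inv \<phi>)"
        using F \<phi>(1) \<psi> unfolding holo_map_def by blast
    qed (use sub in \<open>auto simp: T_def\<close>)
    from this open_T have "holo_on T (\<lambda>x. snd \<psi> (F (u x)))"
      by (rule holo_on_cong) (auto simp: T_def chart_inv_def inv_into_f_f[OF \<phi>(4)])
    moreover have "x \<in> T" using x \<phi> by (auto simp: T_def)
    ultimately show "\<exists>T. x \<in> T \<and> holo_on T (\<lambda>x. snd \<psi> (F (u x)))" by blast
  qed
qed

lemma complex_atlas_charts: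
  assumes "complex_atlas A"
  shows "\<exists>\<phi>\<in>A. x \<in> fst \<phi> \<and> open (fst \<phi>) \<and> inj_on (snd \<phi>) (fst \<phi>)"
  using complex_atlas_cover[OF assms, of x] chart_open[OF assms] chart_inj_on[OF assms] by metis

lemma prod_atlas_charts:
  assumes "complex_atlas A" "complex_atlas B"
  shows "\<exists>\<phi>\<in>prod_atlas A B. x \<in> fst \<phi> \<and> open (fst \<phi>) \<and> inj_on (snd \<phi>) (fst \<phi>)"
proof -
  obtain \<phi> \<psi> where "\<phi> \<in> A" "fst x \<in> fst \<phi>" "\<psi> \<in> B" "snd x \<in> fst \<psi>"
    using complex_atlas_cover[OF assms(1), of "fst x"] complex_atlas_cover[OF assms(2), of "snd x"] by metis
  moreover from this have "(fst \<phi> \<times> fst \<psi>, map_prod (snd \<phi>) (snd \<psi>)) \<in> prod_atlas A B"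
    unfolding prod_atlas_def by blast
  ultimately show ?thesis
    using chart_open[OF assms(1)] chart_open[OF assms(2)] chart_inj_on[OF assms(1)] chart_inj_on[OF assms(2)]
    by (intro bexI[of _ "(fst \<phi> \<times> fst \<psi>, map_prod (snd \<phi>) (snd \<psi>))"])
      (simp_all add: open_Times mem_Times_iff map_prod_inj_on)
qed

lemma mholo_Pair:
  assumes "mholo A W f" "mholo B W g"
  shows "mholo (prod_atlas A B) W (\<lambda>x. (f x, g x))"
  unfolding mholo_def
proof (intro conjI ballI)
  show "continuous_on W (\<lambda>x. (f x, g x))"
    using assms by (intro continuous_intros mholo_continuous_on)
  fix C assume "C \<in> prod_atlas A B"
  then obtain \<phi> \<psi> where "\<phi> \<in> A" "\<psi> \<in> B" and [simp]: "C = (fst \<phi> \<times> fst \<psi>, map_prod (snd \<phi>) (snd \<psi>))"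
    unfolding prod_atlas_def by blast
  then have "holo_on (W \<inter> (\<lambda>x. (f x, g x)) -` fst C) (\<lambda>x. (snd \<phi> (f x), snd \<psi> (g x)))"
    by (intro holo_on_Pair holo_on_subset[OF mholo_holo_on[OF assms(1)]]
        holo_on_subset[OF mholo_holo_on[OF assms(2)]]) auto
  then show "holo_on (W \<inter> (\<lambda>x. (f x, g x)) -` fst C) (\<lambda>x. snd C (f x, g x))"
    by simp
qed

lemma mholo_imp_holo_map:
  assumes "complex_atlas A" "open S" "continuous_on S f"
    and "\<And>\<phi>. \<phi> \<in> A \<Longrightarrow> mholo B (snd \<phi> ` (S \<inter> fst \<phi>)) (\<lambda>z. f (chart_inv \<phi> z))"
  shows "holo_map A B S f"
  unfolding holo_map_def
proof (intro conjI ballI)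
  fix \<phi> \<psi> assume "\<phi> \<in> A" "\<psi> \<in> B"
  then show "holo_on (snd \<phi> ` (S \<inter> fst \<phi> \<inter> f -` fst \<psi>)) (snd \<psi> \<circ> f \<circ> chart_inv \<phi>)"
    using mholo_holo_on[OF assms(4)[OF \<open>\<phi> \<in> A\<close>] \<open>\<psi> \<in> B\<close>]
    by (auto elim!: holo_on_subset simp: o_def chart_inv_chart[OF assms(1) \<open>\<phi> \<in> A\<close>])
qed (rule assms(3))

lemma holo_map_imp_mholo:
  assumes A: "complex_atlas A" and f: "holo_map A B S f" and \<phi>: "\<phi> \<in> A"
  shows "mholo B (snd \<phi> ` (S \<inter> fst \<phi>)) (\<lambda>z. f (chart_inv \<phi> z))"
  unfolding mholo_def
proof (intro conjI ballI)
  show "continuous_on (snd \<phi> ` (S \<inter> fst \<phi>)) (\<lambda>z. f (chart_inv \<phi> z))"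
  proof (rule continuous_on_compose2[of S f])
    show "continuous_on S f" using f by (simp add: holo_map_def)
    show "continuous_on (snd \<phi> ` (S \<inter> fst \<phi>)) (chart_inv \<phi>)"
      by (rule continuous_on_subset[OF chart_inv_continuous_on[OF A \<phi>]]) auto
  qed (auto simp: chart_inv_chart[OF A \<phi>])
  fix \<psi> assume "\<psi> \<in> B"
  have "snd \<phi> ` (S \<inter> fst \<phi>) \<inter> (\<lambda>z. f (chart_inv \<phi> z)) -` fst \<psi> \<subseteq> snd \<phi> ` (S \<inter> fst \<phi> \<inter> f -` fst \<psi>)"
  proof
    fix v assume v: "v \<in> snd \<phi> ` (S \<inter> fst \<phi>) \<inter> (\<lambda>z. f (chart_inv \<phi> z)) -` fst \<psi>"
    then obtain x where "v = snd \<phi> x" "x \<in> S \<inter> fst \<phi>" by blast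
    with v have "v = snd \<phi> x" "x \<in> S \<inter> fst \<phi> \<inter> f -` fst \<psi>"
      using chart_inv_chart[OF A \<phi>, of x] by simp_all
    then show "v \<in> snd \<phi> ` (S \<inter> fst \<phi> \<inter> f -` fst \<psi>)" by (rule image_eqI)
  qed
  then show "holo_on (snd \<phi> ` (S \<inter> fst \<phi>) \<inter> (\<lambda>z. f (chart_inv \<phi> z)) -` fst \<psi>)
      (\<lambda>z. snd \<psi> (f (chart_inv \<phi> z)))"
    using f \<phi> \<open>\<psi> \<in> B\<close> holo_on_subset unfolding holo_map_def comp_def by blast
qed

lemma has_derivative_chart_compose:
  assumes "(f has_derivative f') (at x within S)" "holo_on W g" "f x \<in> W"
  shows "((\<lambda>x. g (f x)) has_derivative (\<lambda>h. frechet_derivative g (at (f x)) (f' h))) (at x within S)"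
  by (rule has_derivative_compose[OF assms(1) holo_on_has_derivative[OF assms(2,3)]])

section \<open>Logarithmic derivatives\<close>

locale complex_lie = group K for K :: "'k::t2_space monoid" (structure) +
  fixes B :: "('k, 'v::complex_euclidean) chart set" and \<kappa> :: "('k, 'v) chart"
  assumes lie_group: "complex_lie_group K B"
    and kappa_chart: "\<kappa> \<in> B" and one_in_kappa: "\<one> \<in> fst \<kappa>"
begin

lemma carrier_UNIV [simp]: "carrier K = UNIV"
  and atlas: "complex_atlas B"
  using lie_group by (auto simp: complex_lie_group_def)

lemma mult_cancel [simp]:
  "inv x \<otimes> (x \<otimes> y) = y" "x \<otimes> (inv x \<otimes> y) = y"
  by (simp_all flip: m_assoc)

abbreviation e0 :: 'v where "e0 \<equiv> snd \<kappa> \<one>"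

abbreviation k_inv :: "'v \<Rightarrow> 'k" where "k_inv \<equiv> chart_inv \<kappa>"

lemma k_inv_e0 [simp]: "k_inv e0 = \<one>"
  by (rule chart_inv_chart[OF atlas kappa_chart one_in_kappa])

lemma e0_in: "e0 \<in> snd \<kappa> ` fst \<kappa>"
  using one_in_kappa by blast

section \<open>Continuity and holomorphy of the group operations\<close>

lemma mult_continuous: "continuous_on UNIV (\<lambda>p. fst p \<otimes> snd p)"
  using lie_group by (simp add: complex_lie_group_def holo_map_def case_prod_beta)

lemma inv_continuous: "continuous_on UNIV (\<lambda>x. inv x)"
  using lie_group by (simp add: complex_lie_group_def holo_map_def)

lemma tendsto_mult_K:
  assumes "(f \<longlongrightarrow> a) F" "(g \<longlongrightarrow> b) F"
  shows "((\<lambda>s. f s \<otimes> g s) \<longlongrightarrow> a \<otimes> b) F"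
  using isCont_tendsto_compose[OF continuous_on_interior[OF mult_continuous] tendsto_Pair[OF assms]]
  by simp

lemma tendsto_inv_K:
  assumes "(f \<longlongrightarrow> a) F"
  shows "((\<lambda>s. inv f s) \<longlongrightarrow> inv a) F"
  using isCont_tendsto_compose[OF continuous_on_interior[OF inv_continuous] assms] by simp

lemma continuous_on_mult_K:
  "continuous_on S f \<Longrightarrow> continuous_on S g \<Longrightarrow> continuous_on S (\<lambda>s. f s \<otimes> g s)"
  unfolding continuous_on_def by (blast intro: tendsto_mult_K)

lemma continuous_on_inv_K: "continuous_on S f \<Longrightarrow> continuous_on S (\<lambda>s. inv f s)"
  unfolding continuous_on_def by (blast intro: tendsto_inv_K)

lemma mholo_mult:
  assumes "open W" "mholo B W f" "mholo B W g"
  shows "mholo B W (\<lambda>x. f x \<otimes> g x)"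
proof -
  have "holo_map (prod_atlas B B) B UNIV (\<lambda>(x, y). x \<otimes> y)"
    using lie_group by (simp add: complex_lie_group_def)
  from mholo_holo_map[OF prod_atlas_charts[OF atlas atlas] atlas assms(1) this
      mholo_Pair[OF assms(2,3)] subset_UNIV]
  show ?thesis by simp
qed

lemma mholo_inv:
  assumes "open W" "mholo B W f"
  shows "mholo B W (\<lambda>x. inv f x)"
proof -
  have "holo_map B B UNIV (\<lambda>x. inv x)"
    using lie_group by (simp add: complex_lie_group_def)
  from mholo_holo_map[OF complex_atlas_charts[OF atlas] atlas assms(1) this assms(2) subset_UNIV]
  show ?thesis .
qed

lemma mholo_k_inv: "mholo B (snd \<kappa> ` fst \<kappa>) k_inv"
  by (rule mholo_chart_inv[OF atlas kappa_chart])

lemma open_kappa_image: "open (snd \<kappa> ` fst \<kappa>)"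
  by (rule chart_open_image[OF atlas kappa_chart])

text \<open>Turns a \<open>K\<close>-valued map into a vector-valued holomorphic one near a point,
  so that it can be differentiated. The calculations below apply it to auxiliary maps
  \<open>N\<close> of translated factors.\<close>

lemma mholo_chart_holo:
  assumes "open W" "mholo B W f" "\<psi> \<in> B" "x \<in> W" "f x \<in> fst \<psi>"
  obtains U where "open U" "x \<in> U" "U \<subseteq> W" "f ` U \<subseteq> fst \<psi>" "holo_on U (\<lambda>x. snd \<psi> (f x))"
proof
  show "open (W \<inter> f -` fst \<psi>)"
    by (rule continuous_open_preimage[OF mholo_continuous_on[OF assms(2)] assms(1) chart_open[OF atlas assms(3)]])
  show "holo_on (W \<inter> f -` fst \<psi>) (\<lambda>x. snd \<psi> (f x))"
    by (rule mholo_holo_on[OF assms(2,3)])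
qed (use assms in auto)

section \<open>The adjoint representation\<close>

lemma mholo_conj: "mholo B (snd \<kappa> ` fst \<kappa>) (\<lambda>v. x \<otimes> k_inv v \<otimes> inv x)"
  by (intro mholo_mult mholo_const mholo_k_inv open_kappa_image)

lemma conj_chart_holo:
  obtains U where "open U" "e0 \<in> U" "U \<subseteq> snd \<kappa> ` fst \<kappa>"
    "(\<lambda>v. x \<otimes> k_inv v \<otimes> inv x) ` U \<subseteq> fst \<kappa>"
    "holo_on U (\<lambda>v. snd \<kappa> (x \<otimes> k_inv v \<otimes> inv x))"
  by (rule mholo_chart_holo[OF open_kappa_image mholo_conj kappa_chart e0_in, of x])
    (auto simp: one_in_kappa)

lemma Ad_has_derivative:
  "((\<lambda>v. snd \<kappa> (x \<otimes> k_inv v \<otimes> inv x)) has_derivative Ad K \<kappa> x) (at e0)"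
  unfolding Ad_def using conj_chart_holo[of x] holo_on_has_derivative by metis

lemma Ad_linear: "linear (Ad K \<kappa> x)"
  using Ad_has_derivative has_derivative_linear by blast

lemma Ad_scaleC: "Ad K \<kappa> x (c *\<^sub>C v) = c *\<^sub>C Ad K \<kappa> x v"
  unfolding Ad_def using conj_chart_holo[of x] holo_on_frechet_scaleC by metis

lemmas Ad_add = linear_add[OF Ad_linear]
  and Ad_diff = linear_diff[OF Ad_linear]
  and Ad_0 [simp] = linear_0[OF Ad_linear]
  and Ad_scaleR = linear_cmul[OF Ad_linear]

lemma Ad_one [simp]: "Ad K \<kappa> \<one> v = v"
proof -
  have "((\<lambda>v. snd \<kappa> (\<one> \<otimes> k_inv v \<otimes> inv \<one>)) has_derivative (\<lambda>v. v)) (at e0)"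
    by (rule has_derivative_transform_within_open[OF has_derivative_ident open_kappa_image e0_in])
      (auto simp: chart_inv_chart[OF atlas kappa_chart])
  from has_derivative_unique[OF this Ad_has_derivative] show ?thesis by metis
qed

text \<open>Conjugation by a product is a composition of two conjugations. Near the identity the
  inner one stays in the domain of \<open>\<kappa>\<close>, so the chain rule applies in that
  chart.\<close>

lemma Ad_mult: "Ad K \<kappa> (x \<otimes> y) v = Ad K \<kappa> x (Ad K \<kappa> y v)"
proof -
  obtain U where U: "open U" "e0 \<in> U" "U \<subseteq> snd \<kappa> ` fst \<kappa>"
    "(\<lambda>v. y \<otimes> k_inv v \<otimes> inv y) ` U \<subseteq> fst \<kappa>"
    using conj_chart_holo[of y] by metis
  have "((\<lambda>v. snd \<kappa> (x \<otimes> k_inv (snd \<kappa> (y \<otimes> k_inv v \<otimes> inv y)) \<otimes> inv x)) has_derivative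
      (\<lambda>v. Ad K \<kappa> x (Ad K \<kappa> y v))) (at e0)"
    by (rule has_derivative_compose[OF Ad_has_derivative, where g = "\<lambda>v. snd \<kappa> (x \<otimes> k_inv v \<otimes> inv x)"])
      (simp add: Ad_has_derivative)
  then have "((\<lambda>v. snd \<kappa> (x \<otimes> y \<otimes> k_inv v \<otimes> inv (x \<otimes> y))) has_derivative
      (\<lambda>v. Ad K \<kappa> x (Ad K \<kappa> y v))) (at e0)"
    by (rule has_derivative_transform_within_open[OF _ U(1,2)])
      (use U(4) in \<open>auto simp: chart_inv_chart[OF atlas kappa_chart] image_subset_iff m_assoc inv_mult_group\<close>)
  from has_derivative_unique[OF this Ad_has_derivative] show ?thesis by metis
qed

text \<open>\<open>D\<close> is the value of \<open>c\<^sup>-\<^sup>1 dc\<close> at \<open>t\<close>, read off in the chart \<open>\<kappa>\<close>.\<close>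

definition has_ld :: "('x::real_normed_vector \<Rightarrow> 'k) \<Rightarrow> ('x \<Rightarrow> 'v) \<Rightarrow> 'x \<Rightarrow> 'x set \<Rightarrow> bool"
  where "has_ld c D t T \<longleftrightarrow> t \<in> T \<and> continuous (at t within T) c \<and>
    ((\<lambda>s. snd \<kappa> (inv (c t) \<otimes> c s)) has_derivative D) (at t within T)"

lemma has_ld_in: "has_ld c D t T \<Longrightarrow> t \<in> T"
  and has_ld_continuous: "has_ld c D t T \<Longrightarrow> continuous (at t within T) c"
  and has_ld_derivative:
    "has_ld c D t T \<Longrightarrow> ((\<lambda>s. snd \<kappa> (inv (c t) \<otimes> c s)) has_derivative D) (at t within T)"
  by (auto simp: has_ld_def)

lemma eventually_translate_in_kappa:
  assumes "continuous (at t within T) c"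
  shows "\<forall>\<^sub>F s in at t within T. inv (c t) \<otimes> c s \<in> fst \<kappa>"
proof -
  have "((\<lambda>s. inv (c t) \<otimes> c s) \<longlongrightarrow> inv (c t) \<otimes> c t) (at t within T)"
    using assms by (intro tendsto_mult_K tendsto_const) (simp add: continuous_within)
  then show ?thesis
    using topological_tendstoD[OF _ chart_open[OF atlas kappa_chart]] one_in_kappa by fastforce
qed

lemma eventually_k_inv_translate:
  assumes "continuous (at t within T) c"
  shows "\<forall>\<^sub>F s in at t within T. k_inv (snd \<kappa> (inv (c t) \<otimes> c s)) = inv (c t) \<otimes> c s"
  using eventually_translate_in_kappa[OF assms]
  by eventually_elim (rule chart_inv_chart[OF atlas kappa_chart])

section \<open>Rules for logarithmic derivatives\<close>

lemma has_ld_unique: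
  assumes "has_ld c D t UNIV" "has_ld c E t UNIV"
  shows "D = E"
  using assms has_derivative_unique unfolding has_ld_def by blast

lemma has_ld_cong:
  assumes "has_ld c D t T" "\<And>s. s \<in> T \<Longrightarrow> c s = d s"
  shows "has_ld d D t T"
proof -
  have "t \<in> T" using assms(1) has_ld_in by blast
  moreover have "continuous (at t within T) d"
  proof -
    have "\<forall>\<^sub>F s in at t within T. c s = d s"
      by (simp add: eventually_at_filter assms(2))
    then have "(d \<longlongrightarrow> c t) (at t within T)"
      using has_ld_continuous[OF assms(1)] Lim_transform_eventually unfolding continuous_within by blast
    then show ?thesis
      using \<open>t \<in> T\<close> by (simp add: continuous_within assms(2))
  qed
  moreover have "((\<lambda>s. snd \<kappa> (inv (d t) \<otimes> d s)) has_derivative D) (at t within T)"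
    by (rule has_derivative_transform[OF \<open>t \<in> T\<close> _ has_ld_derivative[OF assms(1)]])
      (simp add: assms(2) \<open>t \<in> T\<close>)
  ultimately show ?thesis by (simp add: has_ld_def)
qed

text \<open>With \<open>x = inv (d t)\<close>, the translate of the product is \<open>x \<otimes>
  (inv (c t) \<otimes> c s) \<otimes> inv x \<otimes> (inv (d t) \<otimes> d s)\<close>, a fixed
  holomorphic function \<open>N\<close> of the two translated factors. The partial derivatives of
  \<open>N\<close> at \<open>(e0, e0)\<close> are \<open>Ad K \<kappa> x\<close> and the
  identity.\<close>

lemma has_ld_mult:
  assumes c: "has_ld c C t T" and d: "has_ld d D t T"
  shows "has_ld (\<lambda>s. c s \<otimes> d s) (\<lambda>h. Ad K \<kappa> (inv (d t)) (C h) + D h) t T"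
proof -
  define x where "x = inv (d t)"
  define N where "N p = x \<otimes> k_inv (fst p) \<otimes> inv x \<otimes> k_inv (snd p)" for p
  define W where "W = (snd \<kappa> ` fst \<kappa>) \<times> (snd \<kappa> ` fst \<kappa>)"
  have "open W" unfolding W_def by (intro open_Times open_kappa_image)
  moreover have "mholo B W N"
    unfolding N_def
    by (intro mholo_mult mholo_const mholo_compose[OF mholo_k_inv holo_on_fst]
        mholo_compose[OF mholo_k_inv holo_on_snd] \<open>open W\<close>) (auto simp: W_def)
  moreover have "(e0, e0) \<in> W" using e0_in by (simp add: W_def)
  moreover have "N (e0, e0) \<in> fst \<kappa>" by (simp add: N_def one_in_kappa)
  ultimately obtain U where U: "open U" "(e0, e0) \<in> U" "U \<subseteq> W" "holo_on U (\<lambda>p. snd \<kappa> (N p))"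
    using mholo_chart_holo[OF _ _ kappa_chart, of W N "(e0, e0)"] by metis
  define N' where "N' = frechet_derivative (\<lambda>p. snd \<kappa> (N p)) (at (e0, e0))"
  have N': "((\<lambda>p. snd \<kappa> (N p)) has_derivative N') (at (e0, e0))"
    unfolding N'_def by (rule holo_on_has_derivative[OF U(4,2)])
  have "((\<lambda>u. snd \<kappa> (N (u, e0))) has_derivative (\<lambda>h. N' (h, 0))) (at e0)"
    by (rule has_derivative_compose[where g = "\<lambda>p. snd \<kappa> (N p)" and f = "\<lambda>u. (u, e0)", OF _ N'])
      (auto intro!: derivative_eq_intros)
  then have N1: "N' (h, 0) = Ad K \<kappa> x h" for h
    using has_derivative_unique[OF Ad_has_derivative[of x]] by (simp add: N_def fun_eq_iff)
  have "((\<lambda>u. snd \<kappa> (N (e0, u))) has_derivative (\<lambda>h. N' (0, h))) (at e0)"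
    by (rule has_derivative_compose[where g = "\<lambda>p. snd \<kappa> (N p)" and f = "\<lambda>u. (e0, u)", OF _ N'])
      (auto intro!: derivative_eq_intros)
  moreover have "((\<lambda>u. snd \<kappa> (N (e0, u))) has_derivative (\<lambda>h. h)) (at e0)"
    by (rule has_derivative_transform_within_open[OF has_derivative_ident open_kappa_image e0_in])
      (auto simp: N_def chart_inv_chart[OF atlas kappa_chart])
  ultimately have N2: "N' (0, h) = h" for h
    using has_derivative_unique by metis
  have "N' (u, v) = N' (u, 0) + N' (0, v)" for u v
    using linear_add[OF has_derivative_linear[OF N'], of "(u, 0)" "(0, v)"] by simp
  then have N'_eq: "N' (u, v) = Ad K \<kappa> x u + v" for u v by (simp add: N1 N2)
  have "((\<lambda>s. snd \<kappa> (N (snd \<kappa> (inv (c t) \<otimes> c s), snd \<kappa> (inv (d t) \<otimes> d s)))) has_derivative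
      (\<lambda>h. N' (C h, D h))) (at t within T)"
    by (rule has_derivative_compose[where g = "\<lambda>p. snd \<kappa> (N p)", OF has_derivative_Pair
          [OF has_ld_derivative[OF c] has_ld_derivative[OF d]]]) (simp add: N')
  then have "((\<lambda>s. snd \<kappa> (inv (c t \<otimes> d t) \<otimes> (c s \<otimes> d s))) has_derivative
      (\<lambda>h. N' (C h, D h))) (at t within T)"
  proof (rule has_derivative_transform_eventually)
    show "\<forall>\<^sub>F s in at t within T. snd \<kappa> (N (snd \<kappa> (inv (c t) \<otimes> c s), snd \<kappa> (inv (d t) \<otimes> d s)))
        = snd \<kappa> (inv (c t \<otimes> d t) \<otimes> (c s \<otimes> d s))"
      using eventually_k_inv_translate[OF has_ld_continuous[OF c]]
        eventually_k_inv_translate[OF has_ld_continuous[OF d]]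
      by eventually_elim (simp add: N_def x_def m_assoc inv_mult_group)
  qed (use has_ld_in[OF c] in \<open>simp_all add: N_def x_def m_assoc inv_mult_group\<close>)
  moreover have "continuous (at t within T) (\<lambda>s. c s \<otimes> d s)"
    using has_ld_continuous[OF c] has_ld_continuous[OF d] by (simp add: continuous_within tendsto_mult_K)
  ultimately show ?thesis
    using has_ld_in[OF c] by (simp add: has_ld_def N'_eq x_def)
qed

lemma has_ld_const: "t \<in> T \<Longrightarrow> has_ld (\<lambda>_. x) (\<lambda>_. 0) t T"
  by (simp add: has_ld_def)

text \<open>Near \<open>t\<close> the curve is \<open>c t\<close> times its translate to the
  identity; \<open>L\<close> is the differential of left translation by \<open>c t\<close>, read in
  \<open>\<kappa>\<close> and \<open>\<psi>\<close>. Its linearity carries a vanishing logarithmic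
  derivative over to the chart \<open>\<psi>\<close>.\<close>

lemma has_ld_chart:
  assumes c: "has_ld c D t T" and \<psi>: "\<psi> \<in> B" "c t \<in> fst \<psi>"
  obtains L where "linear L" "((\<lambda>s. snd \<psi> (c s)) has_derivative (\<lambda>h. L (D h))) (at t within T)"
proof -
  define N where "N v = c t \<otimes> k_inv v" for v
  have "mholo B (snd \<kappa> ` fst \<kappa>) N"
    unfolding N_def by (intro mholo_mult mholo_const mholo_k_inv open_kappa_image)
  moreover have "N e0 \<in> fst \<psi>" using \<psi> by (simp add: N_def)
  ultimately obtain U where U: "e0 \<in> U" "holo_on U (\<lambda>v. snd \<psi> (N v))"
    using mholo_chart_holo[OF open_kappa_image _ \<psi>(1) e0_in] by metis
  have N': "((\<lambda>v. snd \<psi> (N v)) has_derivative frechet_derivative (\<lambda>v. snd \<psi> (N v)) (at e0)) (at e0)"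
    by (rule holo_on_has_derivative[OF U(2,1)])
  have "((\<lambda>s. snd \<psi> (N (snd \<kappa> (inv (c t) \<otimes> c s)))) has_derivative
      (\<lambda>h. frechet_derivative (\<lambda>v. snd \<psi> (N v)) (at e0) (D h))) (at t within T)"
    by (rule has_derivative_compose[where g = "\<lambda>v. snd \<psi> (N v)", OF has_ld_derivative[OF c]])
      (simp add: N')
  then have "((\<lambda>s. snd \<psi> (c s)) has_derivative
      (\<lambda>h. frechet_derivative (\<lambda>v. snd \<psi> (N v)) (at e0) (D h))) (at t within T)"
  proof (rule has_derivative_transform_eventually)
    show "\<forall>\<^sub>F s in at t within T. snd \<psi> (N (snd \<kappa> (inv (c t) \<otimes> c s))) = snd \<psi> (c s)"
      using eventually_k_inv_translate[OF has_ld_continuous[OF c]]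
      by eventually_elim (simp add: N_def)
  qed (use has_ld_in[OF c] in \<open>simp_all add: N_def\<close>)
  with has_derivative_linear[OF N'] show thesis by (rule that)
qed

text \<open>The converse passage: left translation by \<open>inv (c t)\<close> is holomorphic in the
  charts, so differentiability in any one chart suffices.\<close>

lemma chart_has_ld:
  assumes \<psi>: "\<psi> \<in> B" "c t \<in> fst \<psi>" and t: "t \<in> T" and cont: "continuous (at t within T) c"
    and c: "((\<lambda>s. snd \<psi> (c s)) has_derivative E) (at t within T)"
  obtains D where "has_ld c D t T"
proof -
  define N where "N v = inv (c t) \<otimes> chart_inv \<psi> v" for v
  have "mholo B (snd \<psi> ` fst \<psi>) N"
    unfolding N_def
    by (intro mholo_mult mholo_const mholo_chart_inv chart_open_image[OF atlas] atlas \<psi>)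
  moreover have "N (snd \<psi> (c t)) \<in> fst \<kappa>"
    using \<psi> by (simp add: N_def chart_inv_chart[OF atlas \<psi>(1)] one_in_kappa)
  ultimately obtain U where U: "snd \<psi> (c t) \<in> U" "holo_on U (\<lambda>v. snd \<kappa> (N v))"
    using mholo_chart_holo[OF chart_open_image[OF atlas \<psi>(1)] _ kappa_chart] \<psi>(2) by (metis imageI)
  have "((\<lambda>s. snd \<kappa> (N (snd \<psi> (c s)))) has_derivative
      (\<lambda>h. frechet_derivative (\<lambda>v. snd \<kappa> (N v)) (at (snd \<psi> (c t))) (E h))) (at t within T)"
    by (rule has_derivative_chart_compose[OF c U(2,1)])
  then have "((\<lambda>s. snd \<kappa> (inv (c t) \<otimes> c s)) has_derivative
      (\<lambda>h. frechet_derivative (\<lambda>v. snd \<kappa> (N v)) (at (snd \<psi> (c t))) (E h))) (at t within T)"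
  proof (rule has_derivative_transform_eventually)
    have "\<forall>\<^sub>F s in at t within T. c s \<in> fst \<psi>"
      by (rule topological_tendstoD[OF cont[unfolded continuous_within] chart_open[OF atlas \<psi>(1)] \<psi>(2)])
    then show "\<forall>\<^sub>F s in at t within T. snd \<kappa> (N (snd \<psi> (c s))) = snd \<kappa> (inv (c t) \<otimes> c s)"
      by eventually_elim (simp add: N_def chart_inv_chart[OF atlas \<psi>(1)])
  qed (use t \<psi> in \<open>simp_all add: N_def chart_inv_chart[OF atlas \<psi>(1)]\<close>)
  with t cont show thesis by (intro that) (simp add: has_ld_def)
qed

text \<open>The derivative of inversion is found from the product rule:
  \<open>i \<otimes> inv i\<close> is constant, where \<open>i v = c t \<otimes> k_inv v\<close> has
  the identity as logarithmic derivative at \<open>e0\<close>. The translate of \<open>c\<close> is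
  then substituted into \<open>N\<close>.\<close>

lemma has_ld_inv:
  assumes c: "has_ld c C t T"
  shows "has_ld (\<lambda>s. inv (c s)) (\<lambda>h. - Ad K \<kappa> (c t) (C h)) t T"
proof -
  define N where "N v = c t \<otimes> inv (k_inv v) \<otimes> inv (c t)" for v
  have "mholo B (snd \<kappa> ` fst \<kappa>) N"
    unfolding N_def by (intro mholo_mult mholo_inv mholo_const mholo_k_inv open_kappa_image)
  moreover have "N e0 \<in> fst \<kappa>" by (simp add: N_def one_in_kappa)
  ultimately obtain U where U: "open U" "e0 \<in> U" "U \<subseteq> snd \<kappa> ` fst \<kappa>" "holo_on U (\<lambda>v. snd \<kappa> (N v))"
    using mholo_chart_holo[OF open_kappa_image _ kappa_chart e0_in] by metis
  define N' where "N' = frechet_derivative (\<lambda>v. snd \<kappa> (N v)) (at e0)"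
  have N': "((\<lambda>v. snd \<kappa> (N v)) has_derivative N') (at e0)"
    unfolding N'_def by (rule holo_on_has_derivative[OF U(4,2)])
  define i where "i v = c t \<otimes> k_inv v" for v
  have i: "has_ld i (\<lambda>h. h) e0 U"
  proof -
    have "((\<lambda>s. snd \<kappa> (inv (i e0) \<otimes> i s)) has_derivative (\<lambda>h. h)) (at e0)"
      by (rule has_derivative_transform_within_open[OF has_derivative_ident U(1,2)])
        (use U(3) in \<open>auto simp: i_def chart_chart_inv[OF atlas kappa_chart]\<close>)
    moreover have "continuous_on (snd \<kappa> ` fst \<kappa>) i"
      unfolding i_def
      by (intro continuous_on_mult_K mholo_continuous_on[OF mholo_k_inv] continuous_on_const)
    ultimately show ?thesis
      unfolding has_ld_def using U(2,3) e0_in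
      by (meson continuous_on_eq_continuous_within continuous_within_subset has_derivative_at_withinI)
  qed
  have inv_i: "has_ld (\<lambda>v. inv (i v)) N' e0 U"
  proof -
    have "continuous_on (snd \<kappa> ` fst \<kappa>) (\<lambda>v. inv (i v))"
      unfolding i_def
      by (intro continuous_on_inv_K continuous_on_mult_K mholo_continuous_on[OF mholo_k_inv] continuous_on_const)
    moreover have "(\<lambda>s. snd \<kappa> (inv (inv (i e0)) \<otimes> inv (i s))) = (\<lambda>v. snd \<kappa> (N v))"
      by (simp add: i_def N_def m_assoc inv_mult_group)
    ultimately show ?thesis
      unfolding has_ld_def using U(2,3) e0_in N'
      by (metis continuous_on_eq_continuous_within continuous_within_subset has_derivative_at_withinI)
  qed
  have "has_ld (\<lambda>v. \<one>) (\<lambda>h. Ad K \<kappa> (inv (inv (i e0))) h + N' h) e0 U"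
    using has_ld_mult[OF i inv_i] by simp
  from has_derivative_unique[OF has_ld_derivative[OF this, unfolded at_within_open[OF U(2,1)]]
      has_ld_derivative[OF has_ld_const[OF U(2), of \<one>], unfolded at_within_open[OF U(2,1)]]]
  have "Ad K \<kappa> (c t) h + N' h = 0" for h
    by (simp add: i_def fun_eq_iff)
  then have N'_eq: "N' h = - Ad K \<kappa> (c t) h" for h
    by (simp add: add_eq_0_iff2 flip: minus_unique)
  have "((\<lambda>s. snd \<kappa> (N (snd \<kappa> (inv (c t) \<otimes> c s)))) has_derivative (\<lambda>h. N' (C h))) (at t within T)"
    by (rule has_derivative_compose[where g = "\<lambda>v. snd \<kappa> (N v)", OF has_ld_derivative[OF c]])
      (simp add: N')
  then have "((\<lambda>s. snd \<kappa> (inv (inv (c t)) \<otimes> inv (c s))) has_derivative (\<lambda>h. N' (C h))) (at t within T)"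
  proof (rule has_derivative_transform_eventually)
    show "\<forall>\<^sub>F s in at t within T. snd \<kappa> (N (snd \<kappa> (inv (c t) \<otimes> c s))) = snd \<kappa> (inv (inv (c t)) \<otimes> inv (c s))"
      using eventually_k_inv_translate[OF has_ld_continuous[OF c]]
      by eventually_elim (simp add: N_def m_assoc inv_mult_group)
  qed (use has_ld_in[OF c] in \<open>simp_all add: N_def\<close>)
  moreover have "continuous (at t within T) (\<lambda>s. inv (c s))"
    using has_ld_continuous[OF c] by (simp add: continuous_within tendsto_inv_K)
  ultimately show ?thesis
    using has_ld_in[OF c] by (simp add: has_ld_def N'_eq)
qed

lemma has_ld_compose:
  assumes c: "has_ld c C (u t) S" and u: "(u has_derivative u') (at t within T)"
    and t: "t \<in> T" and sub: "u ` T \<subseteq> S"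
  shows "has_ld (\<lambda>s. c (u s)) (\<lambda>h. C (u' h)) t T"
proof -
  have "((\<lambda>s. snd \<kappa> (inv (c (u t)) \<otimes> c (u s))) has_derivative (\<lambda>h. C (u' h))) (at t within T)"
    using has_derivative_in_compose[OF u, of "\<lambda>s. snd \<kappa> (inv (c (u t)) \<otimes> c s)"]
      has_derivative_subset[OF has_ld_derivative[OF c]] sub image_mono by metis
  moreover have "continuous (at t within T) (\<lambda>s. c (u s))"
    using continuous_within_compose2[OF has_derivative_continuous[OF u], of c]
      continuous_within_subset[OF has_ld_continuous[OF c]] sub by blast
  ultimately show ?thesis using t by (simp add: has_ld_def)
qed

text \<open>In a chart the derivative vanishes off a finite set, so the continuous chart expression
  is constant on a small interval, and a locally constant function on a connected set is constant.
  The finite set \<open>F\<close> admits corners of piecewise smooth paths.\<close>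

lemma has_ld_0_imp_const:
  fixes c :: "real \<Rightarrow> 'k"
  assumes cont: "continuous_on {a..b} c" and F: "finite F"
    and ld: "\<And>t. t \<in> {a..b} - F \<Longrightarrow> has_ld c (\<lambda>_. 0) t {a..b}"
    and x: "x \<in> {a..b}" and y: "y \<in> {a..b}"
  shows "c x = c y"
proof (rule connected_local_const[OF connected_Icc x y], intro ballI)
  fix t assume t: "t \<in> {a..b}"
  obtain \<psi> where \<psi>: "\<psi> \<in> B" "c t \<in> fst \<psi>"
    using complex_atlas_cover[OF atlas] by metis
  have "\<forall>\<^sub>F s in at t within {a..b}. c s \<in> fst \<psi>"
    by (rule topological_tendstoD[OF _ chart_open[OF atlas \<psi>(1)] \<psi>(2)])
      (use cont t in \<open>simp add: continuous_on_def\<close>)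
  then obtain d where d: "d > 0" "\<And>s. s \<in> {a..b} \<Longrightarrow> dist s t < d \<Longrightarrow> c s \<in> fst \<psi>"
    unfolding eventually_at using \<psi>(2) by metis
  \<comment> \<open>Half the radius keeps the closed interval inside one chart domain; clipping to
    \<open>{a..b}\<close> handles the end points.\<close>
  define a' b' where "a' = max a (t - d / 2)" and "b' = min b (t + d / 2)"
  have sub: "{a'..b'} \<subseteq> {a..b}"
    by (auto simp: a'_def b'_def)
  have in_\<psi>: "c s \<in> fst \<psi>" if "s \<in> {a'..b'}" for s
    using that d(2)[of s] \<open>d > 0\<close> by (auto simp: a'_def b'_def dist_real_def)
  have const: "snd \<psi> (c s) = snd \<psi> (c a')" if s: "s \<in> {a'..b'}" for s
  proof (rule has_derivative_zero_unique_strong_interval[OF F _ refl _ s])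
    show "continuous_on {a'..b'} (\<lambda>s. snd \<psi> (c s))"
      by (rule continuous_on_compose2[OF chart_continuous_on[OF atlas \<psi>(1)] continuous_on_subset[OF cont]])
        (use in_\<psi> in \<open>auto simp: a'_def b'_def\<close>)
    fix s assume s: "s \<in> {a'..b'} - F"
    have s': "s \<in> {a..b} - F" "c s \<in> fst \<psi>" using s sub in_\<psi> by blast+
    show "((\<lambda>s. snd \<psi> (c s)) has_derivative (\<lambda>h. 0)) (at s within {a'..b'})"
    proof (rule has_ld_chart[OF ld[OF s'(1)] \<psi>(1) s'(2)])
      fix L :: "'v \<Rightarrow> 'v"
      assume L: "linear L" "((\<lambda>s. snd \<psi> (c s)) has_derivative (\<lambda>h. L 0)) (at s within {a..b})"
      show ?thesis
        using has_derivative_subset[OF L(2) sub] by (simp add: linear_0[OF L(1)])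
    qed
  qed
  have t': "t \<in> {a'..b'}" using t \<open>d > 0\<close> by (auto simp: a'_def b'_def)
  have "c t = c s" if "s \<in> {a'..b'}" for s
    using const[OF that] const[OF t'] in_\<psi>[OF that] in_\<psi>[OF t'] chart_inj_on[OF atlas \<psi>(1)]
    by (metis inj_onD)
  then show "\<forall>\<^sub>F s in at t within {a..b}. c t = c s"
    unfolding eventually_at
  proof (intro exI[of _ "d / 2"] conjI ballI impI)
    fix s assume "s \<in> {a..b}" "s \<noteq> t \<and> dist s t < d / 2"
    moreover from this have "\<bar>s - t\<bar> < d / 2" by (simp add: dist_real_def)
    then have "t - d / 2 \<le> s" "s \<le> t + d / 2" by linarith+
    ultimately have "s \<in> {a'..b'}" by (simp add: a'_def b'_def)
    then show "c t = c s" by fact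
  qed (use \<open>d > 0\<close> in simp)
qed

end

section \<open>Conjugacy classes\<close>

lemma (in group) conj_class_eq:
  assumes "x \<in> carrier G" "y \<in> conj_class G x"
  shows "conj_class G y = conj_class G x"
proof -
  obtain u where u: "u \<in> carrier G" "y = inv u \<otimes> x \<otimes> u"
    using assms(2) unfolding conj_class_def by blast
  have sub: "conj_class G b \<subseteq> conj_class G a"
    if "a \<in> carrier G" "v \<in> carrier G" "b = inv v \<otimes> a \<otimes> v" for a b v
  proof
    fix z assume "z \<in> conj_class G b"
    then obtain w where "w \<in> carrier G" "z = inv w \<otimes> b \<otimes> w" unfolding conj_class_def by blast
    then have "z = inv (v \<otimes> w) \<otimes> a \<otimes> (v \<otimes> w)" "v \<otimes> w \<in> carrier G"
      using that by (simp_all add: m_assoc inv_mult_group)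
    then show "z \<in> conj_class G a" unfolding conj_class_def by blast
  qed
  have x_eq: "x = inv (inv u) \<otimes> y \<otimes> inv u"
  proof -
    have "u \<otimes> (inv u \<otimes> x) = x" using assms(1) u(1) by (simp flip: m_assoc)
    then show ?thesis using assms(1) u by (simp add: m_assoc)
  qed
  have "y \<in> carrier G" using u assms(1) by simp
  then have "conj_class G x \<subseteq> conj_class G y" by (rule sub[OF _ inv_closed[OF u(1)] x_eq])
  moreover have "conj_class G y \<subseteq> conj_class G x" by (rule sub[OF assms(1) u])
  ultimately show ?thesis by (rule subset_antisym[rotated])
qed

lemma (in group) centralizer_subgroup:
  assumes "m \<in> carrier G"
  shows "subgroup (centralizer G m) G"
proof (rule subgroupI)
  show "centralizer G m \<noteq> {}"
    using assms by (auto simp: centralizer_def intro!: exI[of _ \<one>])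
  fix a assume a: "a \<in> centralizer G m"
  then show "inv a \<in> centralizer G m"
    using assms by (auto simp: centralizer_def) (metis inv_closed inv_solve_left inv_solve_right m_assoc m_closed)
  fix b assume b: "b \<in> centralizer G m"
  have "b \<otimes> m = m \<otimes> b" and c: "a \<in> carrier G" "b \<in> carrier G"
    using a b by (auto simp: centralizer_def)
  then have "a \<otimes> b \<otimes> m = (a \<otimes> m) \<otimes> b"
    using assms by (simp add: m_assoc)
  also have "a \<otimes> m = m \<otimes> a"
    using a by (simp add: centralizer_def)
  also have "m \<otimes> a \<otimes> b = m \<otimes> (a \<otimes> b)"
    using a b assms by (simp add: centralizer_def m_assoc)
  finally show "a \<otimes> b \<in> centralizer G m"
    using a b assms by (simp add: centralizer_def)
qed (auto simp: centralizer_def)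

text \<open>Both sides say that \<open>x \<otimes> inv y\<close> commutes with \<open>m\<close>.
  Right cosets of the centralizer fit the conjugation
  \<open>inv x \<otimes> m \<otimes> x\<close>.\<close>

lemma (in group) conj_eq_iff_centralizer_coset:
  assumes "m \<in> carrier G" "x \<in> carrier G" "y \<in> carrier G"
  shows "inv x \<otimes> m \<otimes> x = inv y \<otimes> m \<otimes> y \<longleftrightarrow> centralizer G m #> x = centralizer G m #> y"
proof -
  have "inv x \<otimes> m \<otimes> x = inv y \<otimes> m \<otimes> y \<longleftrightarrow> m \<otimes> x = x \<otimes> (inv y \<otimes> m \<otimes> y)"
    using assms by (metis inv_closed inv_solve_left m_assoc m_closed)
  also have "\<dots> \<longleftrightarrow> m \<otimes> x = x \<otimes> inv y \<otimes> m \<otimes> y"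
    using assms by (simp add: m_assoc)
  also have "\<dots> \<longleftrightarrow> m \<otimes> x \<otimes> inv y = x \<otimes> inv y \<otimes> m"
    using assms by (metis inv_closed inv_solve_right m_closed)
  also have "\<dots> \<longleftrightarrow> x \<otimes> inv y \<in> centralizer G m"
    using assms by (auto simp: centralizer_def m_assoc)
  also have "\<dots> \<longleftrightarrow> x \<in> centralizer G m #> y"
    using subgroup.rcos_module[OF centralizer_subgroup[OF assms(1)] is_group assms(3,2)] by simp
  also have "\<dots> \<longleftrightarrow> centralizer G m #> x = centralizer G m #> y"
    using repr_independence[OF _ assms(3) centralizer_subgroup[OF assms(1)]]
      rcos_self[OF assms(2) centralizer_subgroup[OF assms(1)]] by metis
  finally show ?thesis .
qed

text \<open>Orbit and stabilizer of the conjugation action; this provides the identification of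
  \<open>K / K_C\<close> with the class \<open>C\<close>.\<close>

lemma (in group) orbit_stabilizer_conj:
  assumes m: "m \<in> carrier G"
  shows "\<exists>b. bij_betw b (rcosets (centralizer G m)) (conj_class G m) \<and>
    (\<forall>x\<in>carrier G. b (centralizer G m #> x) = inv x \<otimes> m \<otimes> x)"
proof -
  define b where "b X = (let x = SOME x. x \<in> carrier G \<and> X = centralizer G m #> x in inv x \<otimes> m \<otimes> x)" for X
  have b: "b (centralizer G m #> x) = inv x \<otimes> m \<otimes> x" if x: "x \<in> carrier G" for x
  proof -
    define y where "y = (SOME y. y \<in> carrier G \<and> centralizer G m #> x = centralizer G m #> y)"
    have "y \<in> carrier G \<and> centralizer G m #> x = centralizer G m #> y"
      unfolding y_def by (rule someI[of _ x]) (use x in simp)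
    then show ?thesis
      using conj_eq_iff_centralizer_coset[OF m x] unfolding b_def Let_def y_def[symmetric] by metis
  qed
  have "bij_betw b (rcosets (centralizer G m)) (conj_class G m)"
  proof (rule bij_betw_imageI)
    show "inj_on b (rcosets (centralizer G m))"
      by (rule inj_onI) (auto simp: RCOSETS_def b conj_eq_iff_centralizer_coset[OF m])
    show "b ` (rcosets (centralizer G m)) = conj_class G m"
      by (force simp: RCOSETS_def b conj_class_def)
  qed
  with b show ?thesis by blast
qed

lemma circ_0 [simp]: "circ 0 = 1" and circ_1 [simp]: "circ 1 = 1"
  by (simp_all add: circ_def)

section \<open>Piecewise smooth paths\<close>

lemma norm_circ [simp]: "norm (circ t) = 1"
  by (simp add: circ_def)

lemma circ_in_sphere: "circ t \<in> sphere 0 1"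
  by simp

text \<open>An affine substitution multiplies the \<open>n\<close>-th derivative by
  \<open>m ^ n\<close>. The case \<open>m = 1\<close> serves subintervals, \<open>m = 2\<close> the
  halves of a joined path, and \<open>m = - 1\<close> reversal.\<close>

lemma smooth_curve_affine:
  assumes "smooth_curve A T \<gamma>" "\<And>s. s \<in> T' \<Longrightarrow> m * s + q \<in> T"
    and "\<And>s. s \<in> T' \<Longrightarrow> \<gamma>' s = \<gamma> (m * s + q)"
  shows "smooth_curve A T' \<gamma>'"
  unfolding smooth_curve_def
proof (intro conjI ballI)
  have "continuous_on T' (\<lambda>s. \<gamma> (m * s + q))"
    by (rule continuous_on_compose2[of T \<gamma>])
      (use assms in \<open>auto simp: smooth_curve_def intro!: continuous_intros\<close>)
  then show "continuous_on T' \<gamma>'"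
    by (rule continuous_on_eq) (simp add: assms(3))
  fix \<phi> assume "\<phi> \<in> A"
  define U where "U = T \<inter> \<gamma> -` fst \<phi>"
  define U' where "U' = T' \<inter> \<gamma>' -` fst \<phi>"
  have "smooth_fun U (snd \<phi> \<circ> \<gamma>)"
    using assms(1) \<open>\<phi> \<in> A\<close> unfolding smooth_curve_def U_def by blast
  then obtain D where D: "\<And>t. t \<in> U \<Longrightarrow> D (0::nat) t = snd \<phi> (\<gamma> t)"
    "\<And>n t. t \<in> U \<Longrightarrow> (D n has_vector_derivative D (Suc n) t) (at t within U)"
    unfolding smooth_fun_def by auto
  have sub: "m * s + q \<in> U" if "s \<in> U'" for s
    using that assms(2,3) by (auto simp: U_def U'_def)
  show "smooth_fun (T' \<inter> \<gamma>' -` fst \<phi>) (snd \<phi> \<circ> \<gamma>')"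
    unfolding smooth_fun_def U'_def[symmetric]
  proof (intro exI conjI ballI allI)
    fix s assume s: "s \<in> U'"
    then show "m ^ 0 *\<^sub>R D 0 (m * s + q) = (snd \<phi> \<circ> \<gamma>') s"
      using D(1)[OF sub[OF s]] assms(3)[of s] by (simp add: U'_def)
    fix n
    have "((\<lambda>s. m * s + q) has_vector_derivative m) (at s within U')"
      by (auto intro!: derivative_eq_intros simp flip: has_real_derivative_iff_has_vector_derivative)
    moreover have "(D n has_vector_derivative D (Suc n) (m * s + q)) (at (m * s + q) within (\<lambda>s. m * s + q) ` U')"
      by (rule has_vector_derivative_within_subset[OF D(2)[OF sub[OF s]]]) (use sub in blast)
    ultimately have "((D n \<circ> (\<lambda>s. m * s + q)) has_vector_derivative m *\<^sub>R D (Suc n) (m * s + q)) (at s within U')"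
      by (rule vector_diff_chain_within)
    from bounded_linear.has_vector_derivative[OF bounded_linear_scaleR_right this, of "m ^ n"]
    show "((\<lambda>s. m ^ n *\<^sub>R D n (m * s + q)) has_vector_derivative m ^ Suc n *\<^sub>R D (Suc n) (m * s + q)) (at s within U')"
      by (simp add: o_def mult.commute)
  qed
qed

text \<open>Enlarging \<open>{a..b}\<close> to the neighbouring breakpoints \<open>a0\<close> and
  \<open>b0\<close> gives a piece from the definition. Later constructions then check only that no
  breakpoint lies strictly between \<open>a\<close> and \<open>b\<close>.\<close>

lemma piecewise_smooth_piece:
  assumes F: "finite F" "F \<subseteq> {0..1}" "0 \<in> F" "1 \<in> F"
    and sm: "\<forall>a\<in>F. \<forall>b\<in>F. a < b \<and> F \<inter> {a<..<b} = {} \<longrightarrow> smooth_curve A {a..b} \<gamma>"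
    and ab: "0 \<le> a" "a < b" "b \<le> (1::real)" "F \<inter> {a<..<b} = {}"
  shows "smooth_curve A {a..b} \<gamma>"
proof -
  define a0 where "a0 = Max {x \<in> F. x \<le> a}"
  define b0 where "b0 = Min {x \<in> F. b \<le> x}"
  have "a0 \<in> {x \<in> F. x \<le> a}"
    unfolding a0_def using F ab by (intro Max_in) auto
  then have a0: "a0 \<in> F" "a0 \<le> a" by auto
  have a0_max: "x \<le> a0" if "x \<in> F" "x \<le> a" for x
    unfolding a0_def using F(1) that by (intro Max_ge) auto
  have "b0 \<in> {x \<in> F. b \<le> x}"
    unfolding b0_def using F ab by (intro Min_in) auto
  then have b0: "b0 \<in> F" "b \<le> b0" by auto
  have b0_min: "b0 \<le> x" if "x \<in> F" "b \<le> x" for x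
    unfolding b0_def using F(1) that by (intro Min_le) auto
  have "F \<inter> {a0<..<b0} = {}"
  proof -
    have False if "x \<in> F" "a0 < x" "x < b0" for x
      using that a0_max[of x] b0_min[of x] ab(4) by (cases "x \<le> a"; cases "b \<le> x") auto
    then show ?thesis by auto
  qed
  then have "smooth_curve A {a0..b0} \<gamma>"
    using sm a0 b0 ab by force
  then show ?thesis
    by (rule smooth_curve_affine[where m = 1 and q = 0]) (use a0 b0 in auto)
qed

lemma piecewise_smooth_join:
  assumes p: "piecewise_smooth_path A S p" and q: "piecewise_smooth_path A S q"
    and pq: "pathfinish p = pathstart q"
  shows "piecewise_smooth_path A S (p +++ q)"
proof -
  obtain P where P: "finite P" "P \<subseteq> {0..1}" "0 \<in> P" "1 \<in> P"
    "\<forall>a\<in>P. \<forall>b\<in>P. a < b \<and> P \<inter> {a<..<b} = {} \<longrightarrow> smooth_curve A {a..b} p"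
    using p unfolding piecewise_smooth_path_def by blast
  obtain Q where Q: "finite Q" "Q \<subseteq> {0..1}" "0 \<in> Q" "1 \<in> Q"
    "\<forall>a\<in>Q. \<forall>b\<in>Q. a < b \<and> Q \<inter> {a<..<b} = {} \<longrightarrow> smooth_curve A {a..b} q"
    using q unfolding piecewise_smooth_path_def by blast
  \<comment> \<open>The join runs \<open>p\<close> on the first half of the unit interval and
    \<open>q\<close> on the second, so the breakpoints are rescaled alike; 1/2 comes from
    \<open>1 \<in> P\<close>.\<close>
  define F where "F = (\<lambda>x. x / 2) ` P \<union> (\<lambda>x. (x + 1) / 2) ` Q"
  have "smooth_curve A {a..b} (p +++ q)" if ab: "a \<in> F" "b \<in> F" "a < b" "F \<inter> {a<..<b} = {}" for a b
  proof -
    have "a \<in> {0..1}" "b \<in> {0..1}" using ab P(2) Q(2) by (auto simp: F_def)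
    have "1 / 2 \<in> F" unfolding F_def using P(4) by blast
    then consider "b \<le> 1 / 2" | "1 / 2 \<le> a" using ab(4) by force
    then show ?thesis
    proof cases
      case 1
      have "P \<inter> {2 * a<..<2 * b} = {}"
      proof -
        have False if "x \<in> P" "2 * a < x" "x < 2 * b" for x
          using that ab(4) unfolding F_def by (auto dest!: equalityD1 subsetD[of _ _ "x / 2"])
        then show ?thesis by auto
      qed
      then have "smooth_curve A {2 * a..2 * b} p"
        by (intro piecewise_smooth_piece[OF P]) (use 1 \<open>a \<in> {0..1}\<close> ab in auto)
      then show ?thesis
        by (rule smooth_curve_affine[where m = 2 and q = 0]) (use 1 in \<open>auto simp: joinpaths_def\<close>)
    next
      case 2
      have "Q \<inter> {2 * a - 1<..<2 * b - 1} = {}"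
      proof -
        have False if "x \<in> Q" "2 * a - 1 < x" "x < 2 * b - 1" for x
          using that ab(4) unfolding F_def by (auto dest!: equalityD1 subsetD[of _ _ "(x + 1) / 2"])
        then show ?thesis by auto
      qed
      then have sm: "smooth_curve A {2 * a - 1..2 * b - 1} q"
        by (intro piecewise_smooth_piece[OF Q]) (use 2 \<open>b \<in> {0..1}\<close> ab in auto)
      \<comment> \<open>At the midpoint the join still takes the value of \<open>p\<close>, which
        agrees with \<open>q\<close> by \<open>pq\<close>.\<close>
      have eq: "(p +++ q) s = q (2 * s + (- 1))" if "s \<in> {a..b}" for s
      proof (cases "s = 1 / 2")
        case True
        show ?thesis
          unfolding True using pq by (simp add: joinpaths_def pathfinish_def pathstart_def)
      next
        case False
        then show ?thesis using that 2 by (simp add: joinpaths_def)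
      qed
      show ?thesis
        by (rule smooth_curve_affine[OF sm _ eq]) auto
    qed
  qed
  moreover have "finite F" "F \<subseteq> {0..1}" "0 \<in> F" "1 \<in> F"
    using P Q by (auto simp: F_def image_iff intro: bexI[of _ 0] bexI[of _ 1])
  moreover have "path (p +++ q)" "path_image (p +++ q) \<subseteq> S"
    using p q pq subset_path_image_join unfolding piecewise_smooth_path_def by auto
  ultimately show ?thesis
    unfolding piecewise_smooth_path_def by blast
qed

lemma piecewise_smooth_reversepath:
  assumes p: "piecewise_smooth_path A S p"
  shows "piecewise_smooth_path A S (reversepath p)"
proof -
  obtain P where P: "finite P" "P \<subseteq> {0..1}" "0 \<in> P" "1 \<in> P"
    "\<forall>a\<in>P. \<forall>b\<in>P. a < b \<and> P \<inter> {a<..<b} = {} \<longrightarrow> smooth_curve A {a..b} p"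
    using p unfolding piecewise_smooth_path_def by blast
  define F where "F = (\<lambda>x. 1 - x) ` P"
  have "smooth_curve A {a..b} (reversepath p)" if ab: "a \<in> F" "b \<in> F" "a < b" "F \<inter> {a<..<b} = {}" for a b
  proof -
    have "a \<in> {0..1}" "b \<in> {0..1}" using ab P(2) by (auto simp: F_def)
    have "P \<inter> {1 - b<..<1 - a} = {}"
    proof -
      have False if "x \<in> P" "1 - b < x" "x < 1 - a" for x
        using that ab(4) unfolding F_def by (auto dest!: equalityD1 subsetD[of _ _ "1 - x"])
      then show ?thesis by auto
    qed
    then have "smooth_curve A {1 - b..1 - a} p"
      by (intro piecewise_smooth_piece[OF P]) (use \<open>a \<in> {0..1}\<close> \<open>b \<in> {0..1}\<close> ab in auto)
    then show ?thesis
      by (rule smooth_curve_affine[where m = "- 1" and q = 1]) (auto simp: reversepath_def)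
  qed
  moreover have "finite F" "F \<subseteq> {0..1}" "0 \<in> F" "1 \<in> F"
    using P by (auto simp: F_def image_iff intro: bexI[of _ 0] bexI[of _ 1])
  ultimately show ?thesis
    using p unfolding piecewise_smooth_path_def by (auto intro!: exI[of _ F])
qed

lemma smooth_curve_imp_piecewise:
  assumes "smooth_curve A UNIV \<gamma>" "\<And>t. \<gamma> t \<in> S"
  shows "piecewise_smooth_path A S \<gamma>"
  unfolding piecewise_smooth_path_def
proof (intro conjI exI[of _ "{0, 1}"] ballI impI)
  show "path \<gamma>"
    using assms(1) unfolding path_def smooth_curve_def by (meson continuous_on_subset subset_UNIV)
  show "smooth_curve A {a..b} \<gamma>" for a b
    by (rule smooth_curve_affine[OF assms(1), where m = 1 and q = 0]) auto
qed (use assms(2) in \<open>auto simp: path_image_def\<close>)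

lemma smooth_curve_differentiable:
  assumes A: "complex_atlas A" and sm: "smooth_curve A T \<gamma>" and t: "t \<in> interior T"
    and \<phi>: "\<phi> \<in> A" "\<gamma> t \<in> fst \<phi>"
  shows "(snd \<phi> \<circ> \<gamma>) differentiable (at t)"
proof -
  define U where "U = T \<inter> \<gamma> -` fst \<phi>"
  define U0 where "U0 = interior T \<inter> \<gamma> -` fst \<phi>"
  have "continuous_on (interior T) \<gamma>"
    using sm interior_subset continuous_on_subset unfolding smooth_curve_def by blast
  then have "open U0"
    unfolding U0_def by (intro continuous_open_preimage chart_open[OF A \<phi>(1)]) auto
  moreover have U0: "U0 \<subseteq> U" "t \<in> U0"
    using interior_subset t \<phi> by (auto simp: U_def U0_def)
  \<comment> \<open>At interior parameters the derivative within \<open>U\<close> is two-sided, as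
    \<open>pullback\<close> requires.\<close>
  ultimately have at_U: "at t within U = at t"
    using at_within_open_subset by blast
  have "smooth_fun U (snd \<phi> \<circ> \<gamma>)"
    using sm \<phi> by (simp add: smooth_curve_def U_def)
  then obtain D where D: "\<And>t. t \<in> U \<Longrightarrow> D (0::nat) t = (snd \<phi> \<circ> \<gamma>) t"
    "\<And>n t. t \<in> U \<Longrightarrow> (D n has_vector_derivative D (Suc n) t) (at t within U)"
    unfolding smooth_fun_def by auto
  have "(D 0 has_vector_derivative D (Suc 0) t) (at t)"
    using D(2)[of t 0] U0 at_U by auto
  then have "((snd \<phi> \<circ> \<gamma>) has_vector_derivative D (Suc 0) t) (at t)"
    by (rule has_vector_derivative_transform_open[OF \<open>open U0\<close> U0(2), rotated]) (use D(1) U0 in blast)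
  then show ?thesis by (rule differentiableI_vector)
qed

text \<open>The two-sided derivatives in \<open>pullback\<close> exist away from the breakpoints.
  Since 0 and 1 are breakpoints, the remaining parameters lie in the open interval.\<close>

lemma piecewise_smooth_differentiable:
  assumes A: "complex_atlas A" and p: "piecewise_smooth_path A S \<gamma>"
  shows "\<exists>F. finite F \<and> (\<forall>t\<in>{0..1} - F. t \<in> {0<..<1} \<and>
    (\<forall>\<phi>\<in>A. \<gamma> t \<in> fst \<phi> \<longrightarrow> (snd \<phi> \<circ> \<gamma>) differentiable (at t)))"
proof -
  obtain P where P: "finite P" "P \<subseteq> {0..1}" "0 \<in> P" "1 \<in> P"
    "\<forall>a\<in>P. \<forall>b\<in>P. a < b \<and> P \<inter> {a<..<b} = {} \<longrightarrow> smooth_curve A {a..b} \<gamma>"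
    using p unfolding piecewise_smooth_path_def by blast
  have "(snd \<phi> \<circ> \<gamma>) differentiable (at t)" if t: "t \<in> {0..1} - P" and \<phi>: "\<phi> \<in> A" "\<gamma> t \<in> fst \<phi>" for t \<phi>
  proof -
    have "open ({0<..<1} - P)" using P(1) by (simp add: finite_imp_closed open_Diff)
    moreover have t01: "t \<in> {0<..<1} - P" using t P(3,4) by (auto simp: less_le)
    ultimately obtain e where e: "e > 0" "cball t e \<subseteq> {0<..<1} - P"
      using open_contains_cball by blast
    have sub: "{t - e..t + e} \<subseteq> {0<..<1} - P"
      using e by (simp add: cball_eq_atLeastAtMost)
    moreover have "t - e \<in> {t - e..t + e}" "t + e \<in> {t - e..t + e}" using e(1) by auto
    ultimately have "t - e \<in> {0<..<1}" "t + e \<in> {0<..<1}" by blast+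
    moreover have "{t - e<..<t + e} \<subseteq> {t - e..t + e}" by auto
    with sub have "P \<inter> {t - e<..<t + e} = {}" by blast
    ultimately have "smooth_curve A {t - e..t + e} \<gamma>"
      by (intro piecewise_smooth_piece[OF P]) (use e(1) in auto)
    moreover have "t \<in> interior {t - e..t + e}"
      using e(1) by (simp add: interior_atLeastAtMost_real)
    ultimately show ?thesis
      using smooth_curve_differentiable A \<phi> by blast
  qed
  with P(1,3,4) show ?thesis by (intro exI[of _ P]) (auto simp: less_le)
qed

text \<open>The chart chosen in \<open>pullback\<close> depends only on the point of the surface, so
  it is the same on both sides, and the chain rule produces the factor \<open>m\<close>.\<close>

lemma pullback_affine:
  assumes A: "complex_atlas A" and U: "open U" "t \<in> U"
    and eq: "\<And>s. s \<in> U \<Longrightarrow> \<gamma>' s = \<gamma> (m * s + q)"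
    and diff: "\<And>\<phi>. \<phi> \<in> A \<Longrightarrow> \<gamma> (m * t + q) \<in> fst \<phi> \<Longrightarrow> (snd \<phi> \<circ> \<gamma>) differentiable (at (m * t + q))"
  shows "pullback A \<gamma>' \<xi> t = m *\<^sub>R pullback A \<gamma> \<xi> (m * t + q)"
proof -
  define \<phi> where "\<phi> = (SOME \<phi>. \<phi> \<in> A \<and> \<gamma> (m * t + q) \<in> fst \<phi>)"
  have \<phi>: "\<phi> \<in> A" "\<gamma> (m * t + q) \<in> fst \<phi>"
    unfolding \<phi>_def using someI_ex[of "\<lambda>\<phi>. \<phi> \<in> A \<and> \<gamma> (m * t + q) \<in> fst \<phi>"] complex_atlas_cover[OF A] by metis+
  define d where "d = vector_derivative (snd \<phi> \<circ> \<gamma>) (at (m * t + q))"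
  have "((\<lambda>s. m * s + q) has_vector_derivative m) (at t)"
    by (auto intro!: derivative_eq_intros simp flip: has_real_derivative_iff_has_vector_derivative)
  from vector_diff_chain_at[OF this] diff[OF \<phi>]
  have "((snd \<phi> \<circ> \<gamma> \<circ> (\<lambda>s. m * s + q)) has_vector_derivative m *\<^sub>R d) (at t)"
    by (simp add: d_def vector_derivative_works)
  then have "((snd \<phi> \<circ> \<gamma>') has_vector_derivative m *\<^sub>R d) (at t)"
    by (rule has_vector_derivative_transform_open[OF U, rotated]) (simp add: eq)
  then have "vector_derivative (snd \<phi> \<circ> \<gamma>') (at t) = m *\<^sub>R d" by (rule vector_derivative_at)
  then show ?thesis
    by (simp add: pullback_def Let_def eq[OF U(2)] scaleR_scaleC d_def flip: \<phi>_def)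
qed

section \<open>Monodromy\<close>

context complex_lie
begin

lemma has_evol_iff:
  "has_evol K \<kappa> \<eta> x \<longleftrightarrow> (\<exists>c F. continuous_on {0..1} c \<and> c 0 = \<one> \<and> c 1 = x \<and> finite F \<and>
    (\<forall>t\<in>{0..1} - F. has_ld c (\<lambda>h. h *\<^sub>R \<eta> t) t {0..1}))"
  unfolding has_evol_def has_ld_def has_vector_derivative_def
  by (auto simp: continuous_on_eq_continuous_within)

lemma has_evolE:
  assumes "has_evol K \<kappa> \<eta> x"
  obtains c F where "continuous_on {0..1} c" "c 0 = \<one>" "c 1 = x" "finite F"
    "\<And>t. t \<in> {0..1} - F \<Longrightarrow> has_ld c (\<lambda>h. h *\<^sub>R \<eta> t) t {0..1}"
  using assms unfolding has_evol_iff by metis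

lemma has_evolI:
  assumes "continuous_on {0..1} c" "c 0 = \<one>" "c 1 = x" "finite F"
    "\<And>t. t \<in> {0..1} - F \<Longrightarrow> has_ld c (\<lambda>h. h *\<^sub>R \<eta> t) t {0..1}"
  shows "has_evol K \<kappa> \<eta> x"
  using assms unfolding has_evol_iff by blast

text \<open>For solutions \<open>c\<close> and \<open>d\<close>, the logarithmic derivative of
  \<open>c \<otimes> inv d\<close> is \<open>Ad K \<kappa> (d t) (\<eta> t) - Ad K \<kappa> (d t)
  (\<eta> t) = 0\<close>, so this curve is constant.\<close>

lemma has_evol_unique:
  assumes "has_evol K \<kappa> \<eta> x" "has_evol K \<kappa> \<eta> y"
  shows "x = y"
proof -
  obtain c F where c: "continuous_on {0..1} c" "c 0 = \<one>" "c 1 = x" "finite F"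
    "\<And>t. t \<in> {0..1} - F \<Longrightarrow> has_ld c (\<lambda>h. h *\<^sub>R \<eta> t) t {0..1}"
    using has_evolE[OF assms(1)] by metis
  obtain d E where d: "continuous_on {0..1} d" "d 0 = \<one>" "d 1 = y" "finite E"
    "\<And>t. t \<in> {0..1} - E \<Longrightarrow> has_ld d (\<lambda>h. h *\<^sub>R \<eta> t) t {0..1}"
    using has_evolE[OF assms(2)] by metis
  have "c 1 \<otimes> inv (d 1) = c 0 \<otimes> inv (d 0)"
  proof (rule has_ld_0_imp_const[where F = "F \<union> E" and a = 0 and b = 1])
    show "continuous_on {0..1} (\<lambda>t. c t \<otimes> inv (d t))"
      by (intro continuous_on_mult_K continuous_on_inv_K c d)
    fix t assume "t \<in> {0..1} - (F \<union> E)"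
    then have "t \<in> {0..1} - F" "t \<in> {0..1} - E" by auto
    from has_ld_mult[OF c(5)[OF this(1)] has_ld_inv[OF d(5)[OF this(2)]]]
    show "has_ld (\<lambda>t. c t \<otimes> inv (d t)) (\<lambda>_. 0) t {0..1}" by simp
  qed (use c d in auto)
  then have "x \<otimes> inv y = \<one>" using c d by simp
  then show ?thesis
    by (metis UNIV_I carrier_UNIV inv_equality inv_inv)
qed

lemma evol_eqI: "has_evol K \<kappa> \<eta> x \<Longrightarrow> evol K \<kappa> \<eta> = x"
  unfolding evol_def using has_evol_unique by blast

lemma has_evol_cong:
  assumes "has_evol K \<kappa> \<eta> x" "finite E" "\<And>t. t \<in> {0..1} - E \<Longrightarrow> \<eta> t = \<eta>' t"
  shows "has_evol K \<kappa> \<eta>' x"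
proof -
  obtain c F where c: "continuous_on {0..1} c" "c 0 = \<one>" "c 1 = x" "finite F"
    "\<And>t. t \<in> {0..1} - F \<Longrightarrow> has_ld c (\<lambda>h. h *\<^sub>R \<eta> t) t {0..1}"
    using has_evolE[OF assms(1)] by metis
  show ?thesis
  proof (rule has_evolI[OF c(1-3), of "F \<union> E"])
    fix t assume "t \<in> {0..1} - (F \<union> E)"
    then have "t \<in> {0..1} - F" "t \<in> {0..1} - E" by auto
    then show "has_ld c (\<lambda>h. h *\<^sub>R \<eta>' t) t {0..1}"
      using c(5)[of t] assms(3)[of t] by simp
  qed (use c assms in auto)
qed

text \<open>A constant left factor \<open>x\<close> leaves the logarithmic derivative unchanged; it
  moves the start of a restricted or reversed solution back to the identity.\<close>

lemma has_ld_affine: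
  assumes c: "has_ld c (\<lambda>h. h *\<^sub>R \<eta>) (m * t + q) {0..1}" and t: "t \<in> {0..1}"
    and sub: "(\<lambda>s. m * s + q) ` {0..1} \<subseteq> {0..1::real}"
  shows "has_ld (\<lambda>s. x \<otimes> c (m * s + q)) (\<lambda>h. h *\<^sub>R m *\<^sub>R \<eta>) t {0..1}"
proof -
  have "((\<lambda>s. m * s + q) has_derivative (\<lambda>h. m * h)) (at t within {0..1})"
    by (auto intro!: derivative_eq_intros)
  from has_ld_compose[where u = "\<lambda>s. m * s + q", OF c this t sub]
  have "has_ld (\<lambda>s. c (m * s + q)) (\<lambda>h. (m * h) *\<^sub>R \<eta>) t {0..1}" .
  from has_ld_mult[OF has_ld_const[OF t, of x] this] show ?thesis
    by (simp add: mult.commute)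
qed

text \<open>The second half of a solution, multiplied on the left by \<open>inv (c (1 / 2))\<close>,
  starts at the identity again. Since \<open>\<eta>\<close> stands on the right in the equation, the
  contributions multiply in the order of travel.\<close>

lemma has_evol_split:
  assumes "has_evol K \<kappa> \<eta> x"
  obtains u v where "x = u \<otimes> v" "has_evol K \<kappa> (\<lambda>t. (1 / 2) *\<^sub>R \<eta> (t / 2)) u"
    "has_evol K \<kappa> (\<lambda>t. (1 / 2) *\<^sub>R \<eta> ((t + 1) / 2)) v"
proof -
  obtain c F where c: "continuous_on {0..1} c" "c 0 = \<one>" "c 1 = x" "finite F"
    "\<And>t. t \<in> {0..1} - F \<Longrightarrow> has_ld c (\<lambda>h. h *\<^sub>R \<eta> t) t {0..1}"
    using has_evolE[OF assms(1)] by metis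
  have cont: "continuous_on {0..1} (\<lambda>s. y \<otimes> c ((1 / 2) * s + q))" if "q \<in> {0..1/2}" for y q
    by (intro continuous_on_mult_K continuous_on_const continuous_on_compose2[OF c(1)] continuous_intros)
      (use that in auto)
  show thesis
  proof
    show "x = c (1 / 2) \<otimes> (inv (c (1 / 2)) \<otimes> x)" by simp
    show "has_evol K \<kappa> (\<lambda>t. (1 / 2) *\<^sub>R \<eta> (t / 2)) (c (1 / 2))"
    proof (rule has_evolI[where c = "\<lambda>s. \<one> \<otimes> c ((1 / 2) * s + 0)" and F = "(\<lambda>t. 2 * t) ` F"])
      fix t :: real assume t: "t \<in> {0..1} - (\<lambda>t. 2 * t) ` F"
      then have "(1 / 2) * t + 0 \<in> {0..1} - F" by (auto simp: image_iff)
      from has_ld_affine[OF c(5)[OF this], of \<one>] t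
      show "has_ld (\<lambda>s. \<one> \<otimes> c ((1 / 2) * s + 0)) (\<lambda>h. h *\<^sub>R (1 / 2) *\<^sub>R \<eta> (t / 2)) t {0..1}"
        by force
    qed (use c cont[of 0 \<one>] in auto)
    show "has_evol K \<kappa> (\<lambda>t. (1 / 2) *\<^sub>R \<eta> ((t + 1) / 2)) (inv (c (1 / 2)) \<otimes> x)"
    proof (rule has_evolI[where c = "\<lambda>s. inv (c (1 / 2)) \<otimes> c ((1 / 2) * s + 1 / 2)" and F = "(\<lambda>t. 2 * t - 1) ` F"])
      fix t :: real assume t: "t \<in> {0..1} - (\<lambda>t. 2 * t - 1) ` F"
      have eq: "(1 / 2) * t + 1 / 2 = (t + 1) / 2" by simp
      have "(1 / 2) * t + 1 / 2 \<in> {0..1} - F"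
        using t by (auto simp: image_iff dest: bspec[of _ _ "(1 / 2) * t + 1 / 2"])
      from has_ld_affine[OF c(5)[OF this], of "inv (c (1 / 2))"] t
      show "has_ld (\<lambda>s. inv (c (1 / 2)) \<otimes> c ((1 / 2) * s + 1 / 2))
          (\<lambda>h. h *\<^sub>R (1 / 2) *\<^sub>R \<eta> ((t + 1) / 2)) t {0..1}"
        unfolding eq by force
    qed (use c cont[of "1 / 2" "inv (c (1 / 2))"] in auto)
  qed
qed

text \<open>The reversed solution, multiplied on the left by \<open>inv x\<close>, starts at the
  identity and ends at \<open>inv x\<close>.\<close>

lemma has_evol_reverse:
  assumes "has_evol K \<kappa> \<eta> x"
  shows "has_evol K \<kappa> (\<lambda>t. - \<eta> (1 - t)) (inv x)"
proof -
  obtain c F where c: "continuous_on {0..1} c" "c 0 = \<one>" "c 1 = x" "finite F"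
    "\<And>t. t \<in> {0..1} - F \<Longrightarrow> has_ld c (\<lambda>h. h *\<^sub>R \<eta> t) t {0..1}"
    using has_evolE[OF assms(1)] by metis
  show ?thesis
  proof (rule has_evolI[where c = "\<lambda>s. inv x \<otimes> c (- 1 * s + 1)" and F = "(\<lambda>t. 1 - t) ` F"])
    show "continuous_on {0..1} (\<lambda>s. inv x \<otimes> c (- 1 * s + 1))"
      by (intro continuous_on_mult_K continuous_on_const continuous_on_compose2[OF c(1)] continuous_intros) auto
    fix t :: real assume t: "t \<in> {0..1} - (\<lambda>t. 1 - t) ` F"
    then have "- 1 * t + 1 \<in> {0..1} - F"
      by (auto simp: image_iff dest: bspec[of _ _ "1 - t"])
    from has_ld_affine[OF c(5)[OF this], of "inv x"] t
    show "has_ld (\<lambda>s. inv x \<otimes> c (- 1 * s + 1)) (\<lambda>h. h *\<^sub>R - \<eta> (1 - t)) t {0..1}"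
      by force
  qed (use c in auto)
qed

text \<open>Solutions are passed from the join to its parts, because a member of the period map
  supplies them for based loops.\<close>

lemma has_evol_join:
  assumes A: "complex_atlas A" and p: "piecewise_smooth_path A S p" and q: "piecewise_smooth_path A S q"
    and ev: "has_evol K \<kappa> (pullback A (p +++ q) \<xi>) x"
  obtains u v where "x = u \<otimes> v" "has_evol K \<kappa> (pullback A p \<xi>) u" "has_evol K \<kappa> (pullback A q \<xi>) v"
proof -
  obtain u v where uv: "x = u \<otimes> v"
    "has_evol K \<kappa> (\<lambda>t. (1 / 2) *\<^sub>R pullback A (p +++ q) \<xi> (t / 2)) u"
    "has_evol K \<kappa> (\<lambda>t. (1 / 2) *\<^sub>R pullback A (p +++ q) \<xi> ((t + 1) / 2)) v"
    using has_evol_split[OF ev] by metis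
  obtain P where P: "finite P" "\<forall>t\<in>{0..1} - P. t \<in> {0<..<1} \<and>
    (\<forall>\<phi>\<in>A. p t \<in> fst \<phi> \<longrightarrow> (snd \<phi> \<circ> p) differentiable (at t))"
    using piecewise_smooth_differentiable[OF A p] by blast
  obtain Q where Q: "finite Q" "\<forall>t\<in>{0..1} - Q. t \<in> {0<..<1} \<and>
    (\<forall>\<phi>\<in>A. q t \<in> fst \<phi> \<longrightarrow> (snd \<phi> \<circ> q) differentiable (at t))"
    using piecewise_smooth_differentiable[OF A q] by blast
  show thesis
  proof (rule that[OF uv(1)])
    show "has_evol K \<kappa> (pullback A p \<xi>) u"
    proof (rule has_evol_cong[OF uv(2) P(1)])
      fix t assume t: "t \<in> {0..1} - P"
      \<comment> \<open>On \<open>{..<1/2}\<close> the join is \<open>p\<close> at double speed; the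
        resulting factor 2 cancels the 1/2 of the split.\<close>
      then have "pullback A (p +++ q) \<xi> (t / 2) = 2 *\<^sub>R pullback A p \<xi> (2 * (t / 2) + 0)"
        by (intro pullback_affine[OF A, of "{..<1/2}"]) (use P t in \<open>auto simp: joinpaths_def\<close>)
      then show "(1 / 2) *\<^sub>R pullback A (p +++ q) \<xi> (t / 2) = pullback A p \<xi> t" by simp
    qed
    show "has_evol K \<kappa> (pullback A q \<xi>) v"
    proof (rule has_evol_cong[OF uv(3) Q(1)])
      fix t assume t: "t \<in> {0..1} - Q"
      have eq: "2 * ((t + 1) / 2) + (- 1) = t" by (simp add: field_simps)
      have "pullback A (p +++ q) \<xi> ((t + 1) / 2) = 2 *\<^sub>R pullback A q \<xi> t"
        by (rule pullback_affine[OF A, of "{1/2<..}" "(t + 1) / 2" "p +++ q" q 2 "- 1", unfolded eq])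
          (use Q t in \<open>auto simp: joinpaths_def\<close>)
      then show "(1 / 2) *\<^sub>R pullback A (p +++ q) \<xi> ((t + 1) / 2) = pullback A q \<xi> t" by simp
    qed
  qed
qed

lemma has_evol_reversepath:
  assumes A: "complex_atlas A" and p: "piecewise_smooth_path A S p"
    and ev: "has_evol K \<kappa> (pullback A p \<xi>) x"
  shows "has_evol K \<kappa> (pullback A (reversepath p) \<xi>) (inv x)"
proof -
  obtain P where P: "finite P" "\<forall>t\<in>{0..1} - P. t \<in> {0<..<1} \<and>
    (\<forall>\<phi>\<in>A. p t \<in> fst \<phi> \<longrightarrow> (snd \<phi> \<circ> p) differentiable (at t))"
    using piecewise_smooth_differentiable[OF A p] by blast
  show ?thesis
  proof (rule has_evol_cong[OF has_evol_reverse[OF ev]])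
    show "finite ((\<lambda>t. 1 - t) ` P)" using P by simp
    fix t assume t: "t \<in> {0..1} - (\<lambda>t. 1 - t) ` P"
    then have "1 - t \<in> {0..1} - P"
      by (auto simp: image_iff dest: bspec[of _ _ "1 - t"])
    then have "pullback A (reversepath p) \<xi> t = (- 1) *\<^sub>R pullback A p \<xi> ((- 1) * t + 1)"
      by (intro pullback_affine[OF A, of UNIV]) (use P in \<open>auto simp: reversepath_def\<close>)
    then show "- pullback A p \<xi> (1 - t) = pullback A (reversepath p) \<xi> t" by simp
  qed
qed

text \<open>The transports along \<open>\<tau>\<close> and back are inverse to each other, by uniqueness of solutions.\<close>

lemma has_evol_lasso:
  assumes A: "complex_atlas A" and \<tau>: "piecewise_smooth_path A S \<tau>" "pathfinish \<tau> = \<alpha> 1"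
    and \<alpha>: "smooth_curve A UNIV (\<alpha> \<circ> circ)" "\<alpha> ` sphere 0 1 \<subseteq> S"
    and ev: "has_evol K \<kappa> (pullback A (lasso \<tau> \<alpha>) \<xi>) x"
  obtains u where "has_evol K \<kappa> (pullback A (\<alpha> \<circ> circ) \<xi>) (inv u \<otimes> x \<otimes> u)"
proof -
  have \<sigma>: "piecewise_smooth_path A S (\<alpha> \<circ> circ)"
    by (rule smooth_curve_imp_piecewise[OF \<alpha>(1)]) (use \<alpha>(2) circ_in_sphere in \<open>unfold o_def, blast\<close>)
  have \<tau>': "piecewise_smooth_path A S (reversepath \<tau>)"
    by (rule piecewise_smooth_reversepath[OF \<tau>(1)])
  have "piecewise_smooth_path A S ((\<alpha> \<circ> circ) +++ reversepath \<tau>)"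
    by (rule piecewise_smooth_join[OF \<sigma> \<tau>']) (use \<tau>(2) in \<open>simp add: pathfinish_def pathstart_def reversepath_def\<close>)
  from has_evol_join[OF A \<tau>(1) this ev[unfolded lasso_def]] obtain u y where
    u: "x = u \<otimes> y" "has_evol K \<kappa> (pullback A \<tau> \<xi>) u"
    and y: "has_evol K \<kappa> (pullback A ((\<alpha> \<circ> circ) +++ reversepath \<tau>) \<xi>) y"
    by metis
  from has_evol_join[OF A \<sigma> \<tau>' y] obtain v w where
    v: "y = v \<otimes> w" "has_evol K \<kappa> (pullback A (\<alpha> \<circ> circ) \<xi>) v"
    "has_evol K \<kappa> (pullback A (reversepath \<tau>) \<xi>) w"
    by metis
  have "w = inv u"
    by (rule has_evol_unique[OF v(3) has_evol_reversepath[OF A \<tau>(1) u(2)]])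
  then have "v = inv u \<otimes> x \<otimes> u"
    using u(1) v(1) by (simp add: m_assoc)
  with v(2) that show thesis by blast
qed

lemma piecewise_smooth_lasso:
  assumes \<tau>: "piecewise_smooth_path A S \<tau>" "pathfinish \<tau> = \<alpha> 1"
    and \<alpha>: "smooth_curve A UNIV (\<alpha> \<circ> circ)" "\<alpha> ` sphere 0 1 \<subseteq> S"
  shows "piecewise_smooth_path A S (lasso \<tau> \<alpha>)"
proof -
  have "(\<alpha> \<circ> circ) t \<in> S" for t
    using \<alpha>(2) circ_in_sphere unfolding o_def by blast
  then show ?thesis
    unfolding lasso_def
    by (intro piecewise_smooth_join piecewise_smooth_reversepath \<tau> smooth_curve_imp_piecewise[OF \<alpha>(1)])
      (use \<tau>(2) in \<open>simp_all add: pathfinish_def pathstart_def reversepath_def joinpaths_def\<close>)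
qed

text \<open>Two conjugations combine: \<open>y\<close> from the definition of the period map and
  \<open>u\<close> from transport along the tail. The existence of a solution is recorded as well,
  since \<open>monodromy\<close> is a definite description.\<close>

lemma monodromy_in_conj_class:
  assumes A: "complex_atlas A" and \<tau>: "piecewise_smooth_path A S \<tau>" "pathstart \<tau> = x0" "pathfinish \<tau> = \<alpha> 1"
    and \<alpha>: "smooth_curve A UNIV (\<alpha> \<circ> circ)" "\<alpha> ` sphere 0 1 \<subseteq> S"
    and \<rho>: "\<rho> \<in> period_map K \<kappa> A S x0 \<xi>"
  shows "has_evol K \<kappa> (pullback A (\<alpha> \<circ> circ) \<xi>) (monodromy K \<kappa> A \<xi> \<alpha>)"
    and "monodromy K \<kappa> A \<xi> \<alpha> \<in> conj_class K (\<rho> (hclass S (lasso \<tau> \<alpha>)))"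
proof -
  have "pathstart (lasso \<tau> \<alpha>) = x0" "pathfinish (lasso \<tau> \<alpha>) = x0"
    using \<tau>(2) by (simp_all add: lasso_def)
  then obtain y where "has_evol K \<kappa> (pullback A (lasso \<tau> \<alpha>) \<xi>) (inv y \<otimes> \<rho> (hclass S (lasso \<tau> \<alpha>)) \<otimes> y)"
    using \<rho> piecewise_smooth_lasso[OF \<tau>(1,3) \<alpha>] unfolding period_map_def by blast
  from has_evol_lasso[OF A \<tau>(1,3) \<alpha> this] obtain u where
    u: "has_evol K \<kappa> (pullback A (\<alpha> \<circ> circ) \<xi>) (inv u \<otimes> (inv y \<otimes> \<rho> (hclass S (lasso \<tau> \<alpha>)) \<otimes> y) \<otimes> u)"
    by metis
  have m: "monodromy K \<kappa> A \<xi> \<alpha> = inv u \<otimes> (inv y \<otimes> \<rho> (hclass S (lasso \<tau> \<alpha>)) \<otimes> y) \<otimes> u"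
    unfolding monodromy_def by (rule evol_eqI[OF u])
  with u show "has_evol K \<kappa> (pullback A (\<alpha> \<circ> circ) \<xi>) (monodromy K \<kappa> A \<xi> \<alpha>)" by simp
  have "monodromy K \<kappa> A \<xi> \<alpha> = inv (y \<otimes> u) \<otimes> \<rho> (hclass S (lasso \<tau> \<alpha>)) \<otimes> (y \<otimes> u)"
    by (simp add: m m_assoc inv_mult_group)
  then show "monodromy K \<kappa> A \<xi> \<alpha> \<in> conj_class K (\<rho> (hclass S (lasso \<tau> \<alpha>)))"
    unfolding conj_class_def by auto
qed

end

section \<open>Loop groups\<close>

lemma mholo_cong:
  assumes "mholo B W f" "open W" "\<And>x. x \<in> W \<Longrightarrow> g x = f x" "complex_atlas B"
  shows "mholo B W g"
  unfolding mholo_def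
proof (intro conjI ballI)
  show "continuous_on W g"
    using mholo_continuous_on[OF assms(1)] assms(3) by (metis continuous_on_cong)
  fix \<psi> assume \<psi>: "\<psi> \<in> B"
  have "open (W \<inter> f -` fst \<psi>)"
    by (rule continuous_open_preimage[OF mholo_continuous_on[OF assms(1)] assms(2) chart_open[OF assms(4) \<psi>]])
  moreover have "W \<inter> g -` fst \<psi> = W \<inter> f -` fst \<psi>" using assms(3) by auto
  ultimately show "holo_on (W \<inter> g -` fst \<psi>) (\<lambda>x. snd \<psi> (g x))"
    using holo_on_cong[OF mholo_holo_on[OF assms(1) \<psi>]] assms(3) by simp
qed

lemma smooth_curve_diff_times:
  assumes "complex_atlas A" "smooth_curve A UNIV c" "\<phi> \<in> A"
  shows "open (c -` fst \<phi>)" "diff_times n (c -` fst \<phi>) (\<lambda>t. snd \<phi> (c t))"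
proof -
  show "open (c -` fst \<phi>)"
    using assms(2) chart_open[OF assms(1,3)] by (simp add: smooth_curve_def open_vimage)
  with assms(2,3) show "diff_times n (c -` fst \<phi>) (\<lambda>t. snd \<phi> (c t))"
    using smooth_fun_imp_diff_times[of "c -` fst \<phi>" "snd \<phi> \<circ> c"] by (simp add: smooth_curve_def o_def)
qed

lemma diff_times_continuous_on:
  assumes "diff_times (Suc 0) T u"
  shows "continuous_on T u"
  by (rule continuous_at_imp_continuous_on) (use assms differentiable_imp_continuous_within in auto)

text \<open>A criterion local in \<open>t\<close>: near each \<open>t\<close> the curve factors
  through a vector space as \<open>F t \<circ> u t\<close>, with charts that may vary with
  \<open>t\<close>. It serves products of smooth loops and holomorphic maps along smooth
  curves.\<close>

lemma smooth_curveI: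
  fixes u :: "real \<Rightarrow> real \<Rightarrow> 'w::complex_euclidean"
  assumes B: "complex_atlas B"
    and T: "\<And>t. open (T t)" "\<And>t. t \<in> T t" and W: "\<And>t. open (W t)"
    and F: "\<And>t. mholo B (W t) (F t)" and u: "\<And>t n. diff_times n (T t) (u t)" "\<And>t. u t ` T t \<subseteq> W t"
    and c: "\<And>t s. s \<in> T t \<Longrightarrow> c s = F t (u t s)"
  shows "smooth_curve B UNIV c"
proof -
  have "continuous_on (T t) c" for t
  proof -
    have "continuous_on (T t) (\<lambda>s. F t (u t s))"
      by (rule continuous_on_compose2[OF mholo_continuous_on[OF F] diff_times_continuous_on[OF u(1)] u(2)])
    then show ?thesis by (rule continuous_on_eq) (simp add: c)
  qed
  then have cont: "continuous_on UNIV c"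
    using T by (meson continuous_at_imp_continuous_on continuous_on_eq_continuous_at)
  show ?thesis
    unfolding smooth_curve_def
  proof (intro conjI ballI cont)
    fix \<psi> assume \<psi>: "\<psi> \<in> B"
    have open_c: "open (c -` fst \<psi>)"
      using cont chart_open[OF B \<psi>] by (simp add: open_vimage)
    have "diff_times n (c -` fst \<psi>) (snd \<psi> \<circ> c)" for n
    proof (rule diff_times_locally)
      fix t assume t: "t \<in> c -` fst \<psi>"
      define U where "U = W t \<inter> F t -` fst \<psi>"
      define R where "R = T t \<inter> c -` fst \<psi>"
      have "open U"
        unfolding U_def
        by (rule continuous_open_preimage[OF mholo_continuous_on[OF F] W chart_open[OF B \<psi>]])
      have "open R" unfolding R_def using T open_c by blast
      have "diff_times n R (\<lambda>s. snd \<psi> (F t (u t s)))"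
      proof (rule diff_times_holo[OF \<open>open R\<close> \<open>open U\<close>, where F = "\<lambda>v. snd \<psi> (F t v)"])
        show "holo_on U (\<lambda>v. snd \<psi> (F t v))"
          unfolding U_def by (rule mholo_holo_on[OF F \<psi>])
        show "u t ` R \<subseteq> U"
          using u(2)[of t] c[of _ t] by (auto simp: U_def R_def)
        show "diff_times n R (u t)"
          by (rule diff_times_subset[OF u(1)]) (simp add: R_def)
      qed
      then have "diff_times n R (snd \<psi> \<circ> c)"
        by (rule diff_times_cong_imp[OF \<open>open R\<close>, rotated]) (use c[of _ t] in \<open>auto simp: R_def\<close>)
      moreover have "t \<in> R" using t T by (simp add: R_def)
      ultimately show "\<exists>S. t \<in> S \<and> diff_times n S (snd \<psi> \<circ> c)" by blast
    qed
    then show "smooth_fun (UNIV \<inter> c -` fst \<psi>) (snd \<psi> \<circ> c)"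
      unfolding Int_UNIV_left by (rule diff_times_imp_smooth_fun[OF open_c])
  qed
qed

text \<open>The choice hidden inside \<open>pullback\<close>, named so that statements at a point of
  a curve can refer to the same chart.\<close>

definition chart_at :: "('a, 'v) chart set \<Rightarrow> 'a \<Rightarrow> ('a, 'v) chart"
  where "chart_at A x = (SOME \<phi>. \<phi> \<in> A \<and> x \<in> fst \<phi>)"

lemma chart_at:
  assumes "complex_atlas A"
  shows "chart_at A x \<in> A" "x \<in> fst (chart_at A x)"
  unfolding chart_at_def
  using someI_ex[of "\<lambda>\<phi>. \<phi> \<in> A \<and> x \<in> fst \<phi>"] complex_atlas_cover[OF assms] by metis+

lemma pullback_chart_at:
  "pullback A \<gamma> \<xi> t = vector_derivative (snd (chart_at A (\<gamma> t)) \<circ> \<gamma>) (at t) *\<^sub>C \<xi> (chart_at A (\<gamma> t)) (\<gamma> t)"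
  by (simp add: pullback_def chart_at_def Let_def)

context complex_lie
begin

lemma smooth_curve_mult:
  assumes c: "smooth_curve B UNIV c" and d: "smooth_curve B UNIV d"
  shows "smooth_curve B UNIV (\<lambda>t. c t \<otimes> d t)"
proof -
  define p where "p t = chart_at B (c t)" for t
  define q where "q t = chart_at B (d t)" for t
  have p: "p t \<in> B" "c t \<in> fst (p t)" and q: "q t \<in> B" "d t \<in> fst (q t)" for t
    unfolding p_def q_def using chart_at[OF atlas] by auto
  define W where "W t = (snd (p t) ` fst (p t)) \<times> (snd (q t) ` fst (q t))" for t
  have W: "open (W t)" for t
    unfolding W_def by (intro open_Times chart_open_image[OF atlas] p q)
  show ?thesis
  proof (rule smooth_curveI[OF atlas, where T = "\<lambda>t. c -` fst (p t) \<inter> d -` fst (q t)" and W = W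
        and u = "\<lambda>t s. (snd (p t) (c s), snd (q t) (d s))"
        and F = "\<lambda>t v. chart_inv (p t) (fst v) \<otimes> chart_inv (q t) (snd v)"])
    fix t
    show T: "open (c -` fst (p t) \<inter> d -` fst (q t))"
      by (intro open_Int smooth_curve_diff_times(1)[OF atlas] c d p q)
    show "mholo B (W t) (\<lambda>v. chart_inv (p t) (fst v) \<otimes> chart_inv (q t) (snd v))"
      by (intro mholo_mult W mholo_compose[OF mholo_chart_inv[OF atlas p(1)] holo_on_fst]
          mholo_compose[OF mholo_chart_inv[OF atlas q(1)] holo_on_snd]) (auto simp: W_def)
    show "diff_times n (c -` fst (p t) \<inter> d -` fst (q t)) (\<lambda>s. (snd (p t) (c s), snd (q t) (d s)))" for n
      by (intro diff_times_Pair T diff_times_subset[OF smooth_curve_diff_times(2)[OF atlas c p(1)]]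
          diff_times_subset[OF smooth_curve_diff_times(2)[OF atlas d q(1)]]) auto
    show "t \<in> c -` fst (p t) \<inter> d -` fst (q t)" using p q by simp
    show "(\<lambda>s. (snd (p t) (c s), snd (q t) (d s))) ` (c -` fst (p t) \<inter> d -` fst (q t)) \<subseteq> W t"
      by (auto simp: W_def)
    show "c s \<otimes> d s = chart_inv (p t) (fst (snd (p t) (c s), snd (q t) (d s))) \<otimes>
        chart_inv (q t) (snd (snd (p t) (c s), snd (q t) (d s)))"
      if "s \<in> c -` fst (p t) \<inter> d -` fst (q t)" for s
      using that chart_inv_chart[OF atlas p(1)] chart_inv_chart[OF atlas q(1)] by simp
  qed (rule W)
qed

lemma has_ld_open:
  assumes "has_ld c D t UNIV" "open W" "t \<in> W" "\<And>s. s \<in> W \<Longrightarrow> c s = d s"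
  shows "has_ld d D t UNIV"
proof -
  have "has_ld c D t W"
    using assms(1,3) by (simp add: has_ld_def at_within_open[OF assms(3,2)])
  then have "has_ld d D t W" using assms(4) by (rule has_ld_cong)
  then show ?thesis by (simp add: has_ld_def at_within_open[OF assms(3,2)])
qed

lemma smooth_curve_has_ld:
  assumes c: "smooth_curve B UNIV c"
  obtains v where "has_ld c (\<lambda>h. h *\<^sub>R v) t UNIV"
proof -
  obtain \<psi> where \<psi>: "\<psi> \<in> B" "c t \<in> fst \<psi>"
    using complex_atlas_cover[OF atlas] by metis
  have "isCont c t"
    using c by (simp add: smooth_curve_def continuous_on_eq_continuous_at)
  moreover have "diff_times (Suc 0) (c -` fst \<psi>) (\<lambda>t. snd \<psi> (c t))"
    by (rule smooth_curve_diff_times(2)[OF atlas c \<psi>(1)])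
  then obtain E where "((\<lambda>s. snd \<psi> (c s)) has_derivative E) (at t)"
    using \<psi>(2) by (auto simp: differentiable_def)
  ultimately obtain D where D: "has_ld c D t UNIV"
    using chart_has_ld[of \<psi> c t UNIV E] \<psi> by blast
  then have "D h = h *\<^sub>R D 1" for h
    using linear_cmul[OF has_derivative_linear[OF has_ld_derivative[OF D]], of h 1] by simp
  then have "D = (\<lambda>h. h *\<^sub>R D 1)" by blast
  with D that show thesis by metis
qed

lemma has_ld_vector_derivative:
  "has_ld c (\<lambda>h. h *\<^sub>R v) t UNIV \<Longrightarrow> vector_derivative (\<lambda>s. snd \<kappa> (inv (c t) \<otimes> c s)) (at t) = v"
  by (rule vector_derivative_at) (simp add: has_ld_def has_vector_derivative_def)

section \<open>Loops and stabilizers of forms on the circle\<close>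

lemma in_loop_group_iff:
  "h \<in> carrier (loop_group B K) \<longleftrightarrow>
    h \<in> extensional (sphere 0 1) \<and> smooth_curve B UNIV (\<lambda>s. h (circ s))"
  by (simp add: loop_group_def pointwise_group_def o_def)

lemma loop_group_mult: "f \<otimes>\<^bsub>loop_group B K\<^esub> g = (\<lambda>x\<in>sphere 0 1. f x \<otimes> g x)"
  by (simp add: loop_group_def pointwise_group_def)

text \<open>A smooth loop has exactly one logarithmic derivative at each \<open>t\<close>, so the
  quantified implication is equivalent to the equation for the value of
  \<open>vector_derivative\<close>, in a form that fits the rules for \<open>has_ld\<close>.\<close>

lemma loop_stab_iff:
  "h \<in> loop_stab K B \<kappa> \<eta> \<longleftrightarrow> h \<in> carrier (loop_group B K) \<and>
    (\<forall>t v. has_ld (\<lambda>s. h (circ s)) (\<lambda>r. r *\<^sub>R v) t UNIV \<longrightarrow> v + Ad K \<kappa> (inv h (circ t)) (\<eta> t) = \<eta> t)"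
proof -
  have "vector_derivative (\<lambda>s. snd \<kappa> (inv h (circ t) \<otimes> h (circ s))) (at t) + Ad K \<kappa> (inv h (circ t)) (\<eta> t) = \<eta> t
      \<longleftrightarrow> (\<forall>v. has_ld (\<lambda>s. h (circ s)) (\<lambda>r. r *\<^sub>R v) t UNIV \<longrightarrow> v + Ad K \<kappa> (inv h (circ t)) (\<eta> t) = \<eta> t)"
    if "h \<in> carrier (loop_group B K)" for t
  proof -
    have "smooth_curve B UNIV (\<lambda>s. h (circ s))" using that by (simp add: in_loop_group_iff)
    from smooth_curve_has_ld[OF this] obtain v where v: "has_ld (\<lambda>s. h (circ s)) (\<lambda>r. r *\<^sub>R v) t UNIV"
      by metis
    have "w = v" if "has_ld (\<lambda>s. h (circ s)) (\<lambda>r. r *\<^sub>R w) t UNIV" for w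
      using has_ld_vector_derivative[OF that] has_ld_vector_derivative[OF v] by simp
    with v show ?thesis unfolding has_ld_vector_derivative[OF v] by blast
  qed
  then show ?thesis unfolding loop_stab_def by auto
qed

text \<open>By the product rule and \<open>Ad_mult\<close>, acting with \<open>f\<close> and then
  with \<open>g\<close> is acting with the product, and stabilizers of a right action are closed
  under products.\<close>

lemma loop_stab_mult:
  assumes f: "f \<in> loop_stab K B \<kappa> \<eta>" and g: "g \<in> loop_stab K B \<kappa> \<eta>"
  shows "(\<lambda>x\<in>sphere 0 1. f x \<otimes> g x) \<in> loop_stab K B \<kappa> \<eta>"
proof -
  have sm: "smooth_curve B UNIV (\<lambda>s. f (circ s))" "smooth_curve B UNIV (\<lambda>s. g (circ s))"
    using f g by (auto simp: loop_stab_iff in_loop_group_iff)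
  have circ: "circ s \<in> sphere 0 1" for s by (rule circ_in_sphere)
  have eq: "(\<lambda>x\<in>sphere 0 1. f x \<otimes> g x) (circ s) = f (circ s) \<otimes> g (circ s)" for s
    using circ by (rule restrict_apply')
  show ?thesis
    unfolding loop_stab_iff in_loop_group_iff eq
  proof (intro conjI allI impI)
    show "smooth_curve B UNIV (\<lambda>s. f (circ s) \<otimes> g (circ s))"
      by (rule smooth_curve_mult[OF sm])
    fix t w assume w: "has_ld (\<lambda>s. f (circ s) \<otimes> g (circ s)) (\<lambda>r. r *\<^sub>R w) t UNIV"
    obtain u where u: "has_ld (\<lambda>s. f (circ s)) (\<lambda>r. r *\<^sub>R u) t UNIV"
      using smooth_curve_has_ld[OF sm(1)] by metis
    obtain v where v: "has_ld (\<lambda>s. g (circ s)) (\<lambda>r. r *\<^sub>R v) t UNIV"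
      using smooth_curve_has_ld[OF sm(2)] by metis
    have "w = Ad K \<kappa> (inv g (circ t)) u + v"
      using has_ld_unique[OF w has_ld_mult[OF u v]] by (auto dest: fun_cong[of _ _ 1])
    moreover have "u + Ad K \<kappa> (inv f (circ t)) (\<eta> t) = \<eta> t"
      using f u unfolding loop_stab_iff by blast
    moreover have "v + Ad K \<kappa> (inv g (circ t)) (\<eta> t) = \<eta> t"
      using g v unfolding loop_stab_iff by blast
    moreover have "Ad K \<kappa> (inv (f (circ t) \<otimes> g (circ t))) (\<eta> t) =
        Ad K \<kappa> (inv g (circ t)) (Ad K \<kappa> (inv f (circ t)) (\<eta> t))"
      by (simp add: inv_mult_group Ad_mult)
    ultimately show "w + Ad K \<kappa> (inv (f (circ t) \<otimes> g (circ t))) (\<eta> t) = \<eta> t"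
      using Ad_add[of "inv g (circ t)" u] by (metis (no_types, lifting) add.assoc add.commute)
  qed simp
qed

text \<open>If \<open>h\<close> stabilizes \<open>\<eta>\<close> and \<open>c\<close> solves \<open>c' = c \<cdot> \<eta>\<close>, then so does \<open>h(1)\<^sup>-\<^sup>1 c h\<close>.\<close>

lemma loop_stab_centralizer:
  assumes h: "h \<in> loop_stab K B \<kappa> \<eta>" and m: "has_evol K \<kappa> \<eta> m"
  shows "h 1 \<in> centralizer K m"
proof -
  have sm: "smooth_curve B UNIV (\<lambda>s. h (circ s))"
    using h by (auto simp: loop_stab_iff in_loop_group_iff)
  obtain c F where c: "continuous_on {0..1} c" "c 0 = \<one>" "c 1 = m" "finite F"
    "\<And>t. t \<in> {0..1} - F \<Longrightarrow> has_ld c (\<lambda>r. r *\<^sub>R \<eta> t) t {0..1}"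
    using has_evolE[OF m] by metis
  \<comment> \<open>Since \<open>circ 0 = circ 1 = 1\<close>, the translated curve starts at the
    identity and ends at the conjugate of \<open>m\<close> by \<open>h 1\<close>.\<close>
  have "has_evol K \<kappa> \<eta> (inv (h 1) \<otimes> (m \<otimes> h 1))"
  proof (rule has_evolI[where c = "\<lambda>s. inv (h 1) \<otimes> (c s \<otimes> h (circ s))" and F = F])
    show "continuous_on {0..1} (\<lambda>s. inv (h 1) \<otimes> (c s \<otimes> h (circ s)))"
      using sm by (intro continuous_on_mult_K continuous_on_const c(1))
        (auto simp: smooth_curve_def intro: continuous_on_subset)
    fix t assume t: "t \<in> {0..1} - F"
    obtain v where v: "has_ld (\<lambda>s. h (circ s)) (\<lambda>r. r *\<^sub>R v) t UNIV"
      using smooth_curve_has_ld[OF sm] by metis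
    then have "has_ld (\<lambda>s. h (circ s)) (\<lambda>r. r *\<^sub>R v) t {0..1}"
      using t by (auto simp: has_ld_def intro: continuous_at_imp_continuous_at_within has_derivative_at_withinI)
    from has_ld_mult[OF has_ld_const has_ld_mult[OF c(5)[OF t] this], of "inv (h 1)"] t
    have "has_ld (\<lambda>s. inv (h 1) \<otimes> (c s \<otimes> h (circ s)))
        (\<lambda>r. r *\<^sub>R (Ad K \<kappa> (inv h (circ t)) (\<eta> t) + v)) t {0..1}"
      by (simp add: Ad_scaleR scaleR_add_right)
    moreover have "Ad K \<kappa> (inv h (circ t)) (\<eta> t) + v = \<eta> t"
      using h v unfolding loop_stab_iff by (metis add.commute)
    ultimately show "has_ld (\<lambda>s. inv (h 1) \<otimes> (c s \<otimes> h (circ s))) (\<lambda>r. r *\<^sub>R \<eta> t) t {0..1}"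
      by simp
  qed (use c in simp_all)
  from has_evol_unique[OF m this] have "h 1 \<otimes> m = m \<otimes> h 1"
    using mult_cancel(2)[of "h 1" "m \<otimes> h 1"] by simp
  then show ?thesis by (simp add: centralizer_def)
qed

lemma centralizer_loops_eq:
  assumes "has_evol K \<kappa> (pullback A (\<alpha> \<circ> circ) \<xi>) (monodromy K \<kappa> A \<xi> \<alpha>)"
  shows "centralizer_loops K B \<kappa> A \<xi> \<alpha> = loop_stab K B \<kappa> (pullback A (\<alpha> \<circ> circ) \<xi>)"
  unfolding centralizer_loops_def using loop_stab_centralizer[OF _ assms] by blast

end

section \<open>The gauge action\<close>

locale gauge = complex_lie K B \<kappa>
  for K :: "'k::t2_space monoid" (structure)
    and B :: "('k, 'v::complex_euclidean) chart set" and \<kappa> :: "('k, 'v) chart" +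
  fixes A :: "('a::t2_space, complex) chart set" and S :: "'a set"
  assumes surface_atlas: "complex_atlas A" and open_S: "open S"
begin

abbreviation dom :: "('a, complex) chart \<Rightarrow> complex set"
  where "dom \<phi> \<equiv> snd \<phi> ` (S \<inter> fst \<phi>)"

lemma open_dom: "\<phi> \<in> A \<Longrightarrow> open (dom \<phi>)"
  by (rule chart_image_open[OF surface_atlas]) (auto intro: open_Int open_S chart_open[OF surface_atlas])

lemma chart_inv_dom: "\<phi> \<in> A \<Longrightarrow> z \<in> dom \<phi> \<Longrightarrow> chart_inv \<phi> z \<in> S \<inter> fst \<phi>"
  using chart_inv_chart[OF surface_atlas, of \<phi>] by auto

lemma holo_mholo: "holo_map A B S f \<Longrightarrow> \<phi> \<in> A \<Longrightarrow> mholo B (dom \<phi>) (\<lambda>z. f (chart_inv \<phi> z))"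
  by (rule holo_map_imp_mholo[OF surface_atlas])

text \<open>Group elements are extensional, so pointwise operations are cut off outside
  \<open>S\<close>; holomorphy is tested on \<open>S\<close> and survives this.\<close>

lemma holo_map_restrict:
  assumes "continuous_on S f" "\<And>\<phi>. \<phi> \<in> A \<Longrightarrow> mholo B (dom \<phi>) (\<lambda>z. f (chart_inv \<phi> z))"
  shows "holo_map A B S (restrict f S)"
proof (rule mholo_imp_holo_map[OF surface_atlas open_S])
  show "continuous_on S (restrict f S)"
    using assms(1) by (simp cong: continuous_on_cong)
  fix \<phi> assume \<phi>: "\<phi> \<in> A"
  show "mholo B (dom \<phi>) (\<lambda>z. restrict f S (chart_inv \<phi> z))"
    by (rule mholo_cong[OF assms(2)[OF \<phi>] open_dom[OF \<phi>] _ atlas])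
      (use chart_inv_dom[OF \<phi>] in simp)
qed

lemma holo_map_continuous: "holo_map A B S f \<Longrightarrow> continuous_on S f"
  by (simp add: holo_map_def)

lemma holo_map_mult:
  assumes "holo_map A B S f" "holo_map A B S g"
  shows "holo_map A B S (\<lambda>x\<in>S. f x \<otimes> g x)"
  by (intro holo_map_restrict continuous_on_mult_K holo_map_continuous mholo_mult open_dom holo_mholo assms)

lemma holo_map_inv:
  assumes "holo_map A B S f"
  shows "holo_map A B S (\<lambda>x\<in>S. inv f x)"
  by (intro holo_map_restrict continuous_on_inv_K holo_map_continuous mholo_inv open_dom holo_mholo assms)

lemma holo_map_one: "holo_map A B S (\<lambda>x\<in>S. \<one>)"
  by (intro holo_map_restrict continuous_on_const mholo_const)

section \<open>The group of holomorphic maps and its action on forms\<close>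

abbreviation G :: "('a \<Rightarrow> 'k) monoid" where "G \<equiv> holo_group A S B K"

lemma in_G_iff: "f \<in> carrier G \<longleftrightarrow> f \<in> extensional S \<and> holo_map A B S f"
  and G_mult: "f \<otimes>\<^bsub>G\<^esub> g = (\<lambda>x\<in>S. f x \<otimes> g x)"
  and G_one: "\<one>\<^bsub>G\<^esub> = (\<lambda>x\<in>S. \<one>)"
  by (simp_all add: holo_group_def pointwise_group_def)

lemma group_G: "group G"
proof (rule groupI)
  fix f assume f: "f \<in> carrier G"
  show "\<one>\<^bsub>G\<^esub> \<otimes>\<^bsub>G\<^esub> f = f"
    using f by (auto simp: in_G_iff G_mult G_one extensional_def fun_eq_iff)
  show "\<exists>g\<in>carrier G. g \<otimes>\<^bsub>G\<^esub> f = \<one>\<^bsub>G\<^esub>"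
    by (rule bexI[of _ "\<lambda>x\<in>S. inv f x"]) (use f in \<open>auto simp: in_G_iff G_mult G_one holo_map_inv fun_eq_iff\<close>)
qed (auto simp: in_G_iff G_mult G_one holo_map_mult holo_map_one m_assoc fun_eq_iff)

lemma G_inv: "f \<in> carrier G \<Longrightarrow> inv\<^bsub>G\<^esub> f = (\<lambda>x\<in>S. inv f x)"
  by (rule group.inv_equality[OF group_G]) (auto simp: in_G_iff G_mult G_one holo_map_inv fun_eq_iff)

text \<open>The derivative of the translated map is complex linear in one complex variable, hence
  determined by its value at 1, the coefficient of the form. Rules for \<open>has_ld\<close> thereby
  become rules for forms.\<close>

lemma log_deriv_has_ld:
  assumes f: "holo_map A B S f" and \<phi>: "\<phi> \<in> A" "q \<in> S" "q \<in> fst \<phi>"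
  shows "has_ld (\<lambda>w. f (chart_inv \<phi> w)) (\<lambda>h. h *\<^sub>C log_deriv K \<kappa> A S f \<phi> q) (snd \<phi> q) UNIV"
proof -
  define N where "N w = inv f q \<otimes> f (chart_inv \<phi> w)" for w
  have q: "snd \<phi> q \<in> dom \<phi>" using \<phi> by blast
  have inv_q: "chart_inv \<phi> (snd \<phi> q) = q" by (rule chart_inv_chart[OF surface_atlas \<phi>(1,3)])
  have "mholo B (dom \<phi>) N"
    unfolding N_def by (intro mholo_mult mholo_const open_dom holo_mholo f \<phi>)
  moreover have "N (snd \<phi> q) \<in> fst \<kappa>" by (simp add: N_def inv_q one_in_kappa)
  ultimately obtain U where U: "snd \<phi> q \<in> U" "holo_on U (\<lambda>w. snd \<kappa> (N w))"
    using mholo_chart_holo[OF open_dom[OF \<phi>(1)] _ kappa_chart q] by metis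
  define D where "D = frechet_derivative (\<lambda>w. snd \<kappa> (N w)) (at (snd \<phi> q))"
  have "D h = h *\<^sub>C D 1" for h
    unfolding D_def using holo_on_frechet_scaleC[OF U(2,1), of h 1] by (simp add: scaleC_complex_def)
  moreover have "D 1 = log_deriv K \<kappa> A S f \<phi> q"
    using \<phi> by (simp add: D_def N_def log_deriv_def)
  ultimately have "D = (\<lambda>h. h *\<^sub>C log_deriv K \<kappa> A S f \<phi> q)" by metis
  then have "((\<lambda>w. snd \<kappa> (N w)) has_derivative (\<lambda>h. h *\<^sub>C log_deriv K \<kappa> A S f \<phi> q)) (at (snd \<phi> q))"
    using holo_on_has_derivative[OF U(2,1)] by (simp add: D_def)
  moreover have "isCont (\<lambda>w. f (chart_inv \<phi> w)) (snd \<phi> q)"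
    using mholo_continuous_on[OF holo_mholo[OF f \<phi>(1)]] q open_dom[OF \<phi>(1)]
    using continuous_on_eq_continuous_at by blast
  ultimately show ?thesis
    by (simp add: has_ld_def N_def inv_q)
qed

lemma log_deriv_eqI:
  assumes "has_ld c (\<lambda>h. h *\<^sub>C v) (snd \<phi> q) UNIV" and \<phi>: "\<phi> \<in> A" "q \<in> S" "q \<in> fst \<phi>"
    and f: "holo_map A B S f" and eq: "\<And>w. w \<in> dom \<phi> \<Longrightarrow> c w = f (chart_inv \<phi> w)"
  shows "log_deriv K \<kappa> A S f \<phi> q = v"
proof -
  have "has_ld (\<lambda>w. f (chart_inv \<phi> w)) (\<lambda>h. h *\<^sub>C v) (snd \<phi> q) UNIV"
    by (rule has_ld_open[OF assms(1) open_dom[OF \<phi>(1)] _ eq]) (use \<phi> in auto)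
  from fun_cong[OF has_ld_unique[OF this log_deriv_has_ld[OF f \<phi>]], of 1] show ?thesis by simp
qed

lemma log_deriv_mult:
  assumes f: "holo_map A B S f" and g: "holo_map A B S g" and \<phi>: "\<phi> \<in> A" "q \<in> S" "q \<in> fst \<phi>"
  shows "log_deriv K \<kappa> A S (\<lambda>x\<in>S. f x \<otimes> g x) \<phi> q =
    Ad K \<kappa> (inv g q) (log_deriv K \<kappa> A S f \<phi> q) + log_deriv K \<kappa> A S g \<phi> q"
proof (rule log_deriv_eqI[OF _ \<phi> holo_map_mult[OF f g]])
  show "has_ld (\<lambda>w. f (chart_inv \<phi> w) \<otimes> g (chart_inv \<phi> w)) (\<lambda>h. h *\<^sub>C
      (Ad K \<kappa> (inv g q) (log_deriv K \<kappa> A S f \<phi> q) + log_deriv K \<kappa> A S g \<phi> q)) (snd \<phi> q) UNIV"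
    using has_ld_mult[OF log_deriv_has_ld[OF f \<phi>] log_deriv_has_ld[OF g \<phi>]]
    by (simp add: Ad_scaleC scaleC_add_right chart_inv_chart[OF surface_atlas \<phi>(1,3)])
qed (use chart_inv_dom[OF \<phi>(1)] in simp)

lemma log_deriv_inv:
  assumes f: "holo_map A B S f" and \<phi>: "\<phi> \<in> A" "q \<in> S" "q \<in> fst \<phi>"
  shows "log_deriv K \<kappa> A S (\<lambda>x\<in>S. inv f x) \<phi> q = - Ad K \<kappa> (f q) (log_deriv K \<kappa> A S f \<phi> q)"
proof (rule log_deriv_eqI[OF _ \<phi> holo_map_inv[OF f]])
  show "has_ld (\<lambda>w. inv f (chart_inv \<phi> w)) (\<lambda>h. h *\<^sub>C
      (- Ad K \<kappa> (f q) (log_deriv K \<kappa> A S f \<phi> q))) (snd \<phi> q) UNIV"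
    using has_ld_inv[OF log_deriv_has_ld[OF f \<phi>]]
    by (simp add: Ad_scaleC scaleC.minus_right chart_inv_chart[OF surface_atlas \<phi>(1,3)])
qed (use chart_inv_dom[OF \<phi>(1)] in simp)

lemma log_deriv_one:
  assumes \<phi>: "\<phi> \<in> A" "q \<in> S" "q \<in> fst \<phi>"
  shows "log_deriv K \<kappa> A S (\<lambda>x\<in>S. \<one>) \<phi> q = 0"
  by (rule log_deriv_eqI[OF _ \<phi> holo_map_one, of "\<lambda>_. \<one>"])
    (use chart_inv_dom[OF \<phi>(1)] has_ld_const[of "snd \<phi> q" UNIV \<one>] in simp_all)

text \<open>The coefficient of the form obtained by acting with \<open>f\<close> on
  \<open>\<xi>\<close> and subtracting \<open>\<xi>\<close>. A difference of two such coefficients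
  transforms linearly between charts, so its zeros are meaningful on the surface.\<close>

definition gauge_diff :: "('a, 'v) form \<Rightarrow> ('a \<Rightarrow> 'k) \<Rightarrow> ('a, 'v) form"
  where "gauge_diff \<xi> f \<phi> q = log_deriv K \<kappa> A S f \<phi> q + Ad K \<kappa> (inv f q) (\<xi> \<phi> q) - \<xi> \<phi> q"

text \<open>Off \<open>S\<close> and outside charts all coefficients are 0 by convention, so
  equality of forms comes down to points of \<open>S\<close>; the action fixes the component
  \<open>lam\<close>.\<close>

lemma Stab_iff:
  assumes "\<xi> \<in> holo_forms A S"
  shows "f \<in> Stab K B \<kappa> A S \<xi> lam \<longleftrightarrow>
    f \<in> carrier G \<and> (\<forall>\<phi>\<in>A. \<forall>q\<in>S \<inter> fst \<phi>. gauge_diff \<xi> f \<phi> q = 0)"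
proof -
  have "\<xi> \<phi> q = 0" if "\<phi> \<notin> A \<or> q \<notin> fst \<phi> \<inter> S" for \<phi> q
    using assms[unfolded holo_forms_def mem_Collect_eq, THEN conjunct1] that by blast
  then show ?thesis
    unfolding Stab_def gauge_act_def gauge_diff_def
    by (auto simp: fun_eq_iff log_deriv_def)
qed

lemma Stab_subgroup:
  assumes \<xi>: "\<xi> \<in> holo_forms A S"
  shows "subgroup (Stab K B \<kappa> A S \<xi> lam) G"
proof (rule group.subgroupI[OF group_G])
  show "Stab K B \<kappa> A S \<xi> lam \<subseteq> carrier G" by (auto simp: Stab_def)
  have "\<one>\<^bsub>G\<^esub> \<in> Stab K B \<kappa> A S \<xi> lam"
    unfolding Stab_iff[OF \<xi>]
    by (auto simp: in_G_iff holo_map_one gauge_diff_def G_one log_deriv_one)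
  then show "Stab K B \<kappa> A S \<xi> lam \<noteq> {}" by blast
  fix f assume f: "f \<in> Stab K B \<kappa> A S \<xi> lam"
  then have fG: "f \<in> carrier G" "holo_map A B S f" by (auto simp: Stab_def in_G_iff)
  \<comment> \<open>The stabilizer equation solved for the logarithmic derivative; substituting it
    into the rules for inverses and products gives both closure properties.\<close>
  have f0: "log_deriv K \<kappa> A S f \<phi> q = \<xi> \<phi> q - Ad K \<kappa> (inv f q) (\<xi> \<phi> q)"
    if "\<phi> \<in> A" "q \<in> S" "q \<in> fst \<phi>" for \<phi> q
    using f that unfolding Stab_iff[OF \<xi>] gauge_diff_def by (auto simp: algebra_simps)
  show "inv\<^bsub>G\<^esub> f \<in> Stab K B \<kappa> A S \<xi> lam"
    unfolding Stab_iff[OF \<xi>]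
  proof (intro conjI ballI)
    show "inv\<^bsub>G\<^esub> f \<in> carrier G" by (rule group.inv_closed[OF group_G fG(1)])
    fix \<phi> q assume \<phi>: "\<phi> \<in> A" "q \<in> S \<inter> fst \<phi>"
    then show "gauge_diff \<xi> (inv\<^bsub>G\<^esub> f) \<phi> q = 0"
      by (simp add: gauge_diff_def G_inv[OF fG(1)] log_deriv_inv[OF fG(2)] f0 Ad_diff flip: Ad_mult)
  qed
  fix g assume g: "g \<in> Stab K B \<kappa> A S \<xi> lam"
  then have gG: "g \<in> carrier G" "holo_map A B S g" by (auto simp: Stab_def in_G_iff)
  have g0: "log_deriv K \<kappa> A S g \<phi> q = \<xi> \<phi> q - Ad K \<kappa> (inv g q) (\<xi> \<phi> q)"
    if "\<phi> \<in> A" "q \<in> S" "q \<in> fst \<phi>" for \<phi> q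
    using g that unfolding Stab_iff[OF \<xi>] gauge_diff_def by (auto simp: algebra_simps)
  show "f \<otimes>\<^bsub>G\<^esub> g \<in> Stab K B \<kappa> A S \<xi> lam"
    unfolding Stab_iff[OF \<xi>]
  proof (intro conjI ballI)
    show "f \<otimes>\<^bsub>G\<^esub> g \<in> carrier G"
      using group.is_monoid[OF group_G] fG(1) gG(1) by (rule monoid.m_closed)
    fix \<phi> q assume \<phi>: "\<phi> \<in> A" "q \<in> S \<inter> fst \<phi>"
    then show "gauge_diff \<xi> (f \<otimes>\<^bsub>G\<^esub> g) \<phi> q = 0"
      by (simp add: gauge_diff_def G_mult log_deriv_mult[OF fG(2) gG(2)] f0 g0 Ad_diff inv_mult_group Ad_mult)
  qed
qed

lemma smooth_curve_holo:
  assumes f: "holo_map A B S f" and \<gamma>: "smooth_curve A UNIV \<gamma>" "\<And>t. \<gamma> t \<in> S"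
  shows "smooth_curve B UNIV (\<lambda>t. f (\<gamma> t))"
proof (rule smooth_curveI[OF atlas, where T = "\<lambda>t. \<gamma> -` fst (chart_at A (\<gamma> t))" and W = "\<lambda>t. dom (chart_at A (\<gamma> t))"
      and u = "\<lambda>t s. snd (chart_at A (\<gamma> t)) (\<gamma> s)" and F = "\<lambda>t z. f (chart_inv (chart_at A (\<gamma> t)) z)"])
  fix t
  note c = chart_at[OF surface_atlas, of "\<gamma> t"]
  show "open (\<gamma> -` fst (chart_at A (\<gamma> t)))"
    by (rule smooth_curve_diff_times(1)[OF surface_atlas \<gamma>(1) c(1)])
  show "t \<in> \<gamma> -` fst (chart_at A (\<gamma> t))" using c(2) by simp
  show "open (dom (chart_at A (\<gamma> t)))" by (rule open_dom[OF c(1)])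
  show "mholo B (dom (chart_at A (\<gamma> t))) (\<lambda>z. f (chart_inv (chart_at A (\<gamma> t)) z))"
    by (rule holo_mholo[OF f c(1)])
  show "diff_times n (\<gamma> -` fst (chart_at A (\<gamma> t))) (\<lambda>s. snd (chart_at A (\<gamma> t)) (\<gamma> s))" for n
    by (rule smooth_curve_diff_times(2)[OF surface_atlas \<gamma>(1) c(1)])
  show "(\<lambda>s. snd (chart_at A (\<gamma> t)) (\<gamma> s)) ` (\<gamma> -` fst (chart_at A (\<gamma> t))) \<subseteq> dom (chart_at A (\<gamma> t))"
    using \<gamma>(2) by blast
  show "f (\<gamma> s) = f (chart_inv (chart_at A (\<gamma> t)) (snd (chart_at A (\<gamma> t)) (\<gamma> s)))"
    if "s \<in> \<gamma> -` fst (chart_at A (\<gamma> t))" for s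
    using chart_inv_chart[OF surface_atlas c(1)] that by simp
qed

lemma has_ld_along_curve:
  assumes f: "holo_map A B S f" and \<gamma>: "smooth_curve A UNIV \<gamma>" "\<And>t. \<gamma> t \<in> S"
  shows "has_ld (\<lambda>s. f (\<gamma> s)) (\<lambda>r. r *\<^sub>R vector_derivative (snd (chart_at A (\<gamma> t)) \<circ> \<gamma>) (at t) *\<^sub>C
    log_deriv K \<kappa> A S f (chart_at A (\<gamma> t)) (\<gamma> t)) t UNIV"
proof -
  define \<phi> where "\<phi> = chart_at A (\<gamma> t)"
  have \<phi>: "\<phi> \<in> A" "\<gamma> t \<in> fst \<phi>" unfolding \<phi>_def using chart_at[OF surface_atlas] by auto
  define d where "d = vector_derivative (snd \<phi> \<circ> \<gamma>) (at t)"
  have "diff_times (Suc 0) (\<gamma> -` fst \<phi>) (\<lambda>s. snd \<phi> (\<gamma> s))"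
    by (rule smooth_curve_diff_times(2)[OF surface_atlas \<gamma>(1) \<phi>(1)])
  from diff_times_has_vderiv[OF this, of t]
  have "((\<lambda>s. snd \<phi> (\<gamma> s)) has_derivative (\<lambda>r. r *\<^sub>R d)) (at t)"
    using \<phi>(2) by (simp add: has_vector_derivative_def d_def o_def)
  from has_ld_compose[where u = "\<lambda>s. snd \<phi> (\<gamma> s)", OF log_deriv_has_ld[OF f \<phi>(1) \<gamma>(2) \<phi>(2)] this]
  have "has_ld (\<lambda>s. f (chart_inv \<phi> (snd \<phi> (\<gamma> s))))
      (\<lambda>r. (r *\<^sub>R d) *\<^sub>C log_deriv K \<kappa> A S f \<phi> (\<gamma> t)) t UNIV"
    by simp
  then have "has_ld (\<lambda>s. f (\<gamma> s)) (\<lambda>r. (r *\<^sub>R d) *\<^sub>C log_deriv K \<kappa> A S f \<phi> (\<gamma> t)) t UNIV"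
    by (rule has_ld_open[OF _ smooth_curve_diff_times(1)[OF surface_atlas \<gamma>(1) \<phi>(1)]])
      (use \<phi>(2) chart_inv_chart[OF surface_atlas \<phi>(1)] in \<open>simp_all only: vimage_eq\<close>)
  then show ?thesis
    by (simp add: \<phi>_def d_def scaleR_scaleC)
qed

lemma restrict_circle_in_loop_group:
  assumes f: "f \<in> carrier G" and \<alpha>: "smooth_curve A UNIV (\<alpha> \<circ> circ)" "\<alpha> ` sphere 0 1 \<subseteq> S"
  shows "(\<lambda>x\<in>sphere 0 1. f (\<alpha> x)) \<in> carrier (loop_group B K)"
proof -
  have "\<alpha> (circ t) \<in> S" for t using \<alpha>(2) circ_in_sphere by blast
  then show ?thesis
    using smooth_curve_holo[of f "\<alpha> \<circ> circ"] f \<alpha>(1) by (simp add: in_loop_group_iff in_G_iff norm_circ)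
qed

text \<open>Pullback commutes with the gauge action, so the stabilizer equation for the restricted
  loop says that the pullback of the form \<open>gauge_diff \<xi> f\<close> vanishes.\<close>

lemma restrict_circle_in_loop_stab_iff:
  assumes f: "f \<in> carrier G" and \<alpha>: "smooth_curve A UNIV (\<alpha> \<circ> circ)" "\<alpha> ` sphere 0 1 \<subseteq> S"
  shows "(\<lambda>x\<in>sphere 0 1. f (\<alpha> x)) \<in> loop_stab K B \<kappa> (pullback A (\<alpha> \<circ> circ) \<xi>) \<longleftrightarrow>
    (\<forall>t. vector_derivative (snd (chart_at A (\<alpha> (circ t))) \<circ> (\<alpha> \<circ> circ)) (at t) *\<^sub>C
      gauge_diff \<xi> f (chart_at A (\<alpha> (circ t))) (\<alpha> (circ t)) = 0)"
proof -
  have S: "(\<alpha> \<circ> circ) t \<in> S" for t using \<alpha>(2) circ_in_sphere unfolding o_def by blast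
  have eq: "(\<lambda>x\<in>sphere 0 1. f (\<alpha> x)) (circ s) = f (\<alpha> (circ s))" for s
    using circ_in_sphere by (rule restrict_apply')
  have fh: "holo_map A B S f" using f by (simp add: in_G_iff)
  define d where "d t = vector_derivative (snd (chart_at A (\<alpha> (circ t))) \<circ> (\<alpha> \<circ> circ)) (at t)" for t
  define l where "l t = log_deriv K \<kappa> A S f (chart_at A (\<alpha> (circ t))) (\<alpha> (circ t))" for t
  have ld: "has_ld (\<lambda>s. f (\<alpha> (circ s))) (\<lambda>r. r *\<^sub>R d t *\<^sub>C l t) t UNIV" for t
    using has_ld_along_curve[OF fh \<alpha>(1) S, of t] by (simp add: d_def l_def o_def)
  have "v = d t *\<^sub>C l t" if "has_ld (\<lambda>s. f (\<alpha> (circ s))) (\<lambda>r. r *\<^sub>R v) t UNIV" for t v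
    using fun_cong[OF has_ld_unique[OF that ld], of 1] by simp
  with ld have "has_ld (\<lambda>s. f (\<alpha> (circ s))) (\<lambda>r. r *\<^sub>R v) t UNIV \<longleftrightarrow> v = d t *\<^sub>C l t" for t v
    by blast
  then show ?thesis
    unfolding loop_stab_iff eq
    using restrict_circle_in_loop_group[OF f \<alpha>]
    by (simp add: pullback_chart_at Ad_scaleC gauge_diff_def scaleC_add_right scaleC.diff_right flip: d_def l_def)
qed

end

section \<open>The identity theorem\<close>

text \<open>The scalar identity theorem is applied to each function
  \<open>complex_coord b (g z)\<close>, whose real part is a Euclidean component of
  \<open>g z\<close>.\<close>

lemma holo_identity:
  fixes g :: "complex \<Rightarrow> 'v::complex_euclidean"
  assumes g: "holo_on D g" and D: "open D" "connected D"
    and z0: "z0 \<in> D" "z0 islimpt U" and U: "U \<subseteq> D" "\<And>z. z \<in> U \<Longrightarrow> g z = 0"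
    and z: "z \<in> D"
  shows "g z = 0"
proof (rule euclidean_eqI)
  fix b :: 'v assume "b \<in> Basis"
  have "complex_coord b (g z) = 0"
  proof (rule analytic_continuation[OF _ D U(1) z0 _ z, of "\<lambda>z. complex_coord b (g z)"])
    show "(\<lambda>z. complex_coord b (g z)) holomorphic_on D"
      by (rule holo_on_imp_holomorphic_on[OF holo_on_compose[OF g holo_on_complex_coord]]) auto
    show "complex_coord b (g z) = 0" if "z \<in> U" for z
      using U(2)[OF that] complex_coord_scaleC[of b 0 0] by simp
  qed
  then show "g z \<bullet> b = 0 \<bullet> b"
    by (metis Re_complex_coord inner_zero_left zero_complex.sel(1))
qed

lemma circ_neq_1:
  assumes "0 < t" "t < 1"
  shows "circ t \<noteq> 1"
proof
  assume "circ t = 1"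
  then have "cos (2 * pi * t) = 1" by (simp add: circ_def complex_eq_iff)
  then obtain n :: int where "2 * pi * t = n * 2 * pi" by (auto simp: cos_one_2pi_int)
  then have "t = n" by simp
  with assms show False by auto
qed

context gauge
begin

text \<open>In the logarithmic derivative, base point and variable of differentiation coincide. Once
  separated, \<open>N (z, w) = inv F z \<otimes> F w\<close> is holomorphic in both, and the
  coefficient is its partial derivative in \<open>w\<close> on the diagonal.\<close>

lemma holo_on_log_deriv:
  assumes f: "holo_map A B S f" and \<phi>: "\<phi> \<in> A"
  shows "holo_on (dom \<phi>) (\<lambda>z. log_deriv K \<kappa> A S f \<phi> (chart_inv \<phi> z))"
proof -
  define F where "F z = f (chart_inv \<phi> z)" for z
  have F: "mholo B (dom \<phi>) F" unfolding F_def by (rule holo_mholo[OF f \<phi>])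
  define W where "W = dom \<phi> \<times> dom \<phi>"
  define N where "N p = inv F (fst p) \<otimes> F (snd p)" for p
  have W: "open W" unfolding W_def by (intro open_Times open_dom \<phi>)
  have N: "mholo B W N"
    unfolding N_def
    by (intro mholo_mult mholo_inv W mholo_compose[OF F holo_on_fst] mholo_compose[OF F holo_on_snd])
      (auto simp: W_def)
  define U where "U = W \<inter> N -` fst \<kappa>"
  have U: "open U" "holo_on U (\<lambda>p. snd \<kappa> (N p))"
    unfolding U_def
    using continuous_open_preimage[OF mholo_continuous_on[OF N] W chart_open[OF atlas kappa_chart]]
      mholo_holo_on[OF N kappa_chart] by auto
  have diag: "(z, z) \<in> U" if "z \<in> dom \<phi>" for z
    using that by (simp add: U_def W_def N_def one_in_kappa)
  have "holo_on (dom \<phi>) (\<lambda>z. frechet_derivative (\<lambda>p. snd \<kappa> (N p)) (at (z, z)) (0, 1))"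
    by (rule holo_on_frechet_derivative[OF U, where u = "\<lambda>z. (z, z)" and w = "\<lambda>z. (0, 1)"])
      (use diag in \<open>auto intro!: holo_on_Pair holo_on_ident holo_on_const\<close>)
  then show ?thesis
  proof (rule holo_on_cong[OF _ open_dom[OF \<phi>]])
    fix z assume z: "z \<in> dom \<phi>"
    have zz: "snd \<phi> (chart_inv \<phi> z) = z"
      by (rule chart_chart_inv[OF surface_atlas \<phi>]) (use z in auto)
    have "((\<lambda>w. snd \<kappa> (N (z, w))) has_derivative
        (\<lambda>h. frechet_derivative (\<lambda>p. snd \<kappa> (N p)) (at (z, z)) (0, h))) (at z)"
      by (rule has_derivative_compose[where g = "\<lambda>p. snd \<kappa> (N p)" and f = "\<lambda>w. (z, w)",
            OF _ holo_on_has_derivative[OF U(2) diag[OF z]]])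
        (auto intro!: derivative_eq_intros)
    from frechet_derivative_at[OF this]
    show "log_deriv K \<kappa> A S f \<phi> (chart_inv \<phi> z) =
        frechet_derivative (\<lambda>p. snd \<kappa> (N p)) (at (z, z)) (0, 1)"
      using chart_inv_dom[OF \<phi> z] \<phi> by (simp add: log_deriv_def zz N_def F_def fun_eq_iff)
  qed
qed

text \<open>The same device with \<open>N (z, w) = F z \<otimes> k_inv w \<otimes> inv F z\<close>,
  differentiated in \<open>w\<close> at \<open>e0\<close> in the direction
  \<open>v z\<close>.\<close>

lemma holo_on_Ad:
  assumes D: "open D" and F: "mholo B D F" and v: "holo_on D v"
  shows "holo_on D (\<lambda>z. Ad K \<kappa> (F z) (v z))"
proof -
  define W where "W = D \<times> snd \<kappa> ` fst \<kappa>"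
  define N where "N p = F (fst p) \<otimes> k_inv (snd p) \<otimes> inv F (fst p)" for p
  have W: "open W" unfolding W_def by (intro open_Times open_kappa_image D)
  have N: "mholo B W N"
    unfolding N_def
    by (intro mholo_mult mholo_inv W mholo_compose[OF F holo_on_fst] mholo_compose[OF mholo_k_inv holo_on_snd])
      (auto simp: W_def)
  define U where "U = W \<inter> N -` fst \<kappa>"
  have U: "open U" "holo_on U (\<lambda>p. snd \<kappa> (N p))"
    unfolding U_def
    using continuous_open_preimage[OF mholo_continuous_on[OF N] W chart_open[OF atlas kappa_chart]]
      mholo_holo_on[OF N kappa_chart] by auto
  have in_U: "(z, e0) \<in> U" if "z \<in> D" for z
    using that e0_in by (simp add: U_def W_def N_def one_in_kappa)
  have "holo_on D (\<lambda>z. frechet_derivative (\<lambda>p. snd \<kappa> (N p)) (at (z, e0)) (0, v z))"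
    by (rule holo_on_frechet_derivative[OF U, where u = "\<lambda>z. (z, e0)" and w = "\<lambda>z. (0, v z)"])
      (use in_U in \<open>auto intro!: holo_on_Pair holo_on_ident holo_on_const v\<close>)
  then show ?thesis
  proof (rule holo_on_cong[OF _ D])
    fix z assume z: "z \<in> D"
    have "((\<lambda>w. snd \<kappa> (N (z, w))) has_derivative
        (\<lambda>h. frechet_derivative (\<lambda>p. snd \<kappa> (N p)) (at (z, e0)) (0, h))) (at e0)"
      by (rule has_derivative_compose[where g = "\<lambda>p. snd \<kappa> (N p)" and f = "\<lambda>w. (z, w)",
            OF _ holo_on_has_derivative[OF U(2) in_U[OF z]]])
        (auto intro!: derivative_eq_intros)
    moreover have "(\<lambda>w. snd \<kappa> (N (z, w))) = (\<lambda>w. snd \<kappa> (F z \<otimes> k_inv w \<otimes> inv F z))"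
      by (simp add: N_def)
    ultimately show "Ad K \<kappa> (F z) (v z) = frechet_derivative (\<lambda>p. snd \<kappa> (N p)) (at (z, e0)) (0, v z)"
      using has_derivative_unique[OF Ad_has_derivative[of "F z"]] by (simp add: fun_eq_iff)
  qed
qed

lemma holo_on_gauge_diff:
  assumes f: "holo_map A B S f" and \<xi>: "\<xi> \<in> holo_forms A S" and \<phi>: "\<phi> \<in> A"
  shows "holo_on (dom \<phi>) (\<lambda>z. gauge_diff \<xi> f \<phi> (chart_inv \<phi> z))"
proof -
  have "\<forall>\<phi>\<in>A. holo_on (snd \<phi> ` (fst \<phi> \<inter> S)) (\<xi> \<phi> \<circ> chart_inv \<phi>)"
    using \<xi> unfolding holo_forms_def by blast
  then have "holo_on (dom \<phi>) (\<lambda>z. \<xi> \<phi> (chart_inv \<phi> z))"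
    using \<phi> by (simp add: o_def Int_commute)
  then show ?thesis
    unfolding gauge_diff_def
    by (intro holo_on_diff holo_on_add holo_on_log_deriv holo_on_Ad open_dom mholo_inv holo_mholo f \<phi>)
qed

text \<open>The logarithmic derivative transforms by the chain rule, \<open>\<xi>\<close> by the
  definition of a form, and complex linearity of \<open>Ad\<close> lets the common factor be pulled
  out.\<close>

lemma gauge_diff_transition:
  assumes f: "holo_map A B S f" and \<xi>: "\<xi> \<in> holo_forms A S"
    and \<phi>: "\<phi> \<in> A" "q \<in> fst \<phi>" and \<psi>: "\<psi> \<in> A" "q \<in> fst \<psi>" and q: "q \<in> S"
  shows "gauge_diff \<xi> f \<phi> q = deriv (snd \<psi> \<circ> chart_inv \<phi>) (snd \<phi> q) *\<^sub>C gauge_diff \<xi> f \<psi> q"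
proof -
  define T where "T = snd \<psi> \<circ> chart_inv \<phi>"
  define W where "W = snd \<phi> ` (fst \<phi> \<inter> fst \<psi>)"
  have W: "open W"
    unfolding W_def by (rule chart_image_open[OF surface_atlas \<phi>(1)])
      (auto intro!: open_Int chart_open[OF surface_atlas] \<phi>(1) \<psi>(1))
  have qW: "snd \<phi> q \<in> W" using \<phi> \<psi> by (simp add: W_def)
  have T: "holo_on W T"
    unfolding T_def W_def by (rule chart_transition_holo[OF surface_atlas \<phi>(1) \<psi>(1)])
  have Tq: "T (snd \<phi> q) = snd \<psi> q"
    by (simp add: T_def chart_inv_chart[OF surface_atlas \<phi>])
  have "(T has_field_derivative deriv T (snd \<phi> q)) (at (snd \<phi> q))"
    using DERIV_imp_deriv holo_on_complex_has_field_derivative[OF T qW] by metis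
  then have T': "(T has_derivative (\<lambda>h. h * deriv T (snd \<phi> q))) (at (snd \<phi> q))"
    by (simp add: has_field_derivative_def mult_commute_abs)
  have "has_ld (\<lambda>w. f (chart_inv \<psi> (T w)))
      (\<lambda>h. (h * deriv T (snd \<phi> q)) *\<^sub>C log_deriv K \<kappa> A S f \<psi> q) (snd \<phi> q) UNIV"
    by (rule has_ld_compose[where u = T, OF _ T' UNIV_I subset_UNIV])
      (use log_deriv_has_ld[OF f \<psi>(1) q \<psi>(2)] in \<open>simp add: Tq\<close>)
  then have "has_ld (\<lambda>w. f (chart_inv \<phi> w))
      (\<lambda>h. (h * deriv T (snd \<phi> q)) *\<^sub>C log_deriv K \<kappa> A S f \<psi> q) (snd \<phi> q) UNIV"
  proof (rule has_ld_open[OF _ W qW])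
    fix w assume "w \<in> W"
    then obtain y where y: "w = snd \<phi> y" "y \<in> fst \<phi>" "y \<in> fst \<psi>" by (auto simp: W_def)
    show "f (chart_inv \<psi> (T w)) = f (chart_inv \<phi> w)"
      by (simp add: T_def y chart_inv_chart[OF surface_atlas \<phi>(1)] chart_inv_chart[OF surface_atlas \<psi>(1)])
  qed
  from fun_cong[OF has_ld_unique[OF this log_deriv_has_ld[OF f \<phi>(1) q \<phi>(2)]], of 1]
  have "log_deriv K \<kappa> A S f \<phi> q = deriv T (snd \<phi> q) *\<^sub>C log_deriv K \<kappa> A S f \<psi> q" by simp
  moreover have "\<forall>\<phi>\<in>A. \<forall>\<psi>\<in>A. \<forall>p \<in> fst \<phi> \<inter> fst \<psi> \<inter> S. \<xi> \<phi> p = deriv (snd \<psi> \<circ> chart_inv \<phi>) (snd \<phi> p) *\<^sub>C \<xi> \<psi> p"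
    using \<xi> unfolding holo_forms_def by blast
  then have "\<xi> \<phi> q = deriv T (snd \<phi> q) *\<^sub>C \<xi> \<psi> q"
    unfolding T_def using \<phi> \<psi> q by blast
  ultimately show ?thesis
    unfolding T_def[symmetric] gauge_diff_def by (simp add: Ad_scaleC scaleC_add_right scaleC.diff_right)
qed

section \<open>Propagation of zeros over the surface\<close>

lemma gauge_diff_zero_all_charts:
  assumes "holo_map A B S f" "\<xi> \<in> holo_forms A S" "\<phi> \<in> A" "q \<in> fst \<phi>" "q \<in> S" "gauge_diff \<xi> f \<phi> q = 0"
    and "\<psi> \<in> A" "q \<in> fst \<psi>"
  shows "gauge_diff \<xi> f \<psi> q = 0"
  using gauge_diff_transition[OF assms(1,2,7,8,3,4,5)] assms(6) by simp

text \<open>Also defined at a puncture \<open>x\<close>, where the condition concerns the nearby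
  points of \<open>S\<close>. The points with this property thus form a subset of the whole surface,
  whose connectedness is given.\<close>

definition zero_germ :: "('a, 'v) form \<Rightarrow> ('a \<Rightarrow> 'k) \<Rightarrow> 'a \<Rightarrow> bool"
  where "zero_germ \<xi> f x \<longleftrightarrow> (\<exists>U. open U \<and> x \<in> U \<and>
    (\<forall>q\<in>U \<inter> S. \<forall>\<phi>\<in>A. q \<in> fst \<phi> \<longrightarrow> gauge_diff \<xi> f \<phi> q = 0))"

text \<open>There are finitely many punctures, so a small disc contains none except possibly its
  centre; a disc and a punctured disc in the plane are both connected.\<close>

lemma punctured_chart_ball:
  assumes "finite (- S)" and \<phi>: "\<phi> \<in> A" "x \<in> fst \<phi>"
  obtains r where "r > 0" "ball (snd \<phi> x) r \<subseteq> snd \<phi> ` fst \<phi>"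
    "ball (snd \<phi> x) r - {snd \<phi> x} \<subseteq> dom \<phi>"
    "open (ball (snd \<phi> x) r \<inter> dom \<phi>)" "connected (ball (snd \<phi> x) r \<inter> dom \<phi>)"
proof -
  have "open (fst \<phi> - (- S - {x}))"
    using assms(1) by (intro open_Diff chart_open[OF surface_atlas \<phi>(1)] finite_imp_closed) auto
  then have "open (snd \<phi> ` (fst \<phi> - (- S - {x})))"
    by (rule chart_image_open[OF surface_atlas \<phi>(1)]) auto
  moreover have "snd \<phi> x \<in> snd \<phi> ` (fst \<phi> - (- S - {x}))" using \<phi>(2) by blast
  ultimately obtain r where r: "r > 0" "ball (snd \<phi> x) r \<subseteq> snd \<phi> ` (fst \<phi> - (- S - {x}))"
    using open_contains_ball by metis
  have sub: "ball (snd \<phi> x) r - {snd \<phi> x} \<subseteq> dom \<phi>"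
    using r(2) by blast
  consider "ball (snd \<phi> x) r \<inter> dom \<phi> = ball (snd \<phi> x) r" |
      "ball (snd \<phi> x) r \<inter> dom \<phi> = ball (snd \<phi> x) r - {snd \<phi> x}"
    using sub by blast
  then have "connected (ball (snd \<phi> x) r \<inter> dom \<phi>)"
  proof cases
    case 1
    show ?thesis unfolding 1 by (rule connected_ball)
  next
    case 2
    show ?thesis unfolding 2 by (rule connected_punctured_ball) simp
  qed
  moreover have "open (ball (snd \<phi> x) r \<inter> dom \<phi>)"
    by (intro open_Int open_ball open_dom \<phi>)
  moreover have "ball (snd \<phi> x) r \<subseteq> snd \<phi> ` fst \<phi>" using r(2) by blast
  ultimately show thesis using that r(1) sub by blast
qed

text \<open>The accumulation point \<open>z0\<close> of zeros is kept separate from the centre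
  \<open>snd \<phi> x\<close>, because \<open>x\<close> may be a puncture while \<open>z0\<close>
  must lie in the domain of holomorphy.\<close>

lemma zero_germ_of_zeros:
  assumes f: "holo_map A B S f" and \<xi>: "\<xi> \<in> holo_forms A S"
    and \<phi>: "\<phi> \<in> A" "x \<in> fst \<phi>"
    and r: "r > 0" "ball (snd \<phi> x) r \<subseteq> snd \<phi> ` fst \<phi>"
    and D: "open (ball (snd \<phi> x) r \<inter> dom \<phi>)" "connected (ball (snd \<phi> x) r \<inter> dom \<phi>)"
    and z0: "z0 \<in> ball (snd \<phi> x) r \<inter> dom \<phi>" "z0 islimpt U" and U: "U \<subseteq> ball (snd \<phi> x) r \<inter> dom \<phi>"
      "\<And>z. z \<in> U \<Longrightarrow> gauge_diff \<xi> f \<phi> (chart_inv \<phi> z) = 0"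
  shows "zero_germ \<xi> f x"
proof -
  have zero: "gauge_diff \<xi> f \<phi> (chart_inv \<phi> z) = 0" if "z \<in> ball (snd \<phi> x) r \<inter> dom \<phi>" for z
    by (rule holo_identity[OF _ D z0 U that]) (rule holo_on_subset[OF holo_on_gauge_diff[OF f \<xi> \<phi>(1)]], blast)
  define V where "V = fst \<phi> \<inter> snd \<phi> -` ball (snd \<phi> x) r"
  have "open V"
    unfolding V_def
    by (intro continuous_open_preimage chart_continuous_on[OF surface_atlas \<phi>(1)] chart_open[OF surface_atlas \<phi>(1)]) auto
  moreover have "x \<in> V" using \<phi> r by (simp add: V_def)
  moreover have "gauge_diff \<xi> f \<psi> q = 0" if q: "q \<in> V \<inter> S" "\<psi> \<in> A" "q \<in> fst \<psi>" for q \<psi>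
  proof (rule gauge_diff_zero_all_charts[OF f \<xi> \<phi>(1) _ _ _ q(2,3)])
    have "snd \<phi> q \<in> ball (snd \<phi> x) r \<inter> dom \<phi>" using q(1) by (auto simp: V_def)
    from zero[OF this] show "gauge_diff \<xi> f \<phi> q = 0"
      using q(1) chart_inv_chart[OF surface_atlas \<phi>(1), of q] by (simp add: V_def)
  qed (use q(1) in \<open>auto simp: V_def\<close>)
  ultimately show ?thesis unfolding zero_germ_def by blast
qed

text \<open>A limit point \<open>x\<close> of such germs has in its disc a nonempty open set of
  zeros; the identity theorem spreads them over the disc, minus \<open>x\<close> if that is a
  puncture.\<close>

lemma zero_germ_closed:
  assumes f: "holo_map A B S f" and \<xi>: "\<xi> \<in> holo_forms A S" and fin: "finite (- S)"
  shows "closed {x. zero_germ \<xi> f x}"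
proof -
  have "zero_germ \<xi> f x" if x: "x \<in> closure {x. zero_germ \<xi> f x}" for x
  proof -
    obtain \<phi> where \<phi>: "\<phi> \<in> A" "x \<in> fst \<phi>" using complex_atlas_cover[OF surface_atlas] by metis
    obtain r where r: "r > 0" "ball (snd \<phi> x) r \<subseteq> snd \<phi> ` fst \<phi>"
      "ball (snd \<phi> x) r - {snd \<phi> x} \<subseteq> dom \<phi>"
      "open (ball (snd \<phi> x) r \<inter> dom \<phi>)" "connected (ball (snd \<phi> x) r \<inter> dom \<phi>)"
      using punctured_chart_ball[OF fin \<phi>] by metis
    define V where "V = fst \<phi> \<inter> snd \<phi> -` ball (snd \<phi> x) r"
    have V: "open V"
      unfolding V_def
      by (intro continuous_open_preimage chart_continuous_on[OF surface_atlas \<phi>(1)] chart_open[OF surface_atlas \<phi>(1)]) auto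
    have "x \<in> V" using \<phi> r by (simp add: V_def)
    then obtain y where y: "y \<in> V" "zero_germ \<xi> f y"
      using x V by (auto simp: closure_iff_nhds_not_empty)
    then obtain Y where Y: "open Y" "y \<in> Y" "\<And>q \<phi>. q \<in> Y \<Longrightarrow> q \<in> S \<Longrightarrow> \<phi> \<in> A \<Longrightarrow> q \<in> fst \<phi> \<Longrightarrow> gauge_diff \<xi> f \<phi> q = 0"
      unfolding zero_germ_def by blast
    have VY: "open (snd \<phi> ` (V \<inter> Y))"
      by (rule chart_image_open[OF surface_atlas \<phi>(1)]) (use V Y in \<open>auto simp: V_def\<close>)
    have "snd \<phi> y \<in> snd \<phi> ` (V \<inter> Y)" using y Y by blast
    then have "infinite (snd \<phi> ` (V \<inter> Y))"
      using VY by (metis empty_iff finite_imp_not_open)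
    \<comment> \<open>A point other than the centre is chosen, in case the centre is a puncture; an
      infinite set contains one.\<close>
    then obtain z0 where z0: "z0 \<in> snd \<phi> ` (V \<inter> Y)" "z0 \<noteq> snd \<phi> x"
      by (metis finite.simps finite_subset insertCI subsetI)
    define U where "U = snd \<phi> ` (V \<inter> Y) \<inter> (ball (snd \<phi> x) r \<inter> dom \<phi>)"
    have "open U" unfolding U_def by (intro open_Int VY r(4))
    have z0U: "z0 \<in> U" using z0 r(3) by (auto simp: U_def V_def)
    show ?thesis
    proof (rule zero_germ_of_zeros[OF f \<xi> \<phi> r(1,2,4,5)])
      show "z0 \<in> ball (snd \<phi> x) r \<inter> dom \<phi>" "U \<subseteq> ball (snd \<phi> x) r \<inter> dom \<phi>"
        using z0U by (auto simp: U_def)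
      show "z0 islimpt U"
        by (rule interior_limit_point) (simp add: interior_open[OF \<open>open U\<close>] z0U)
      fix z assume "z \<in> U"
      then obtain q where q: "z = snd \<phi> q" "q \<in> V \<inter> Y" "z \<in> dom \<phi>" unfolding U_def by blast
      then have "chart_inv \<phi> z = q"
        using chart_inv_chart[OF surface_atlas \<phi>(1)] by (simp add: V_def)
      moreover from this have "q \<in> S \<inter> fst \<phi>" using chart_inv_dom[OF \<phi>(1) q(3)] by simp
      ultimately show "gauge_diff \<xi> f \<phi> (chart_inv \<phi> z) = 0"
        using Y(3)[of q \<phi>] q(2) \<phi>(1) by simp
    qed
  qed
  then show ?thesis by (metis closure_subset_eq mem_Collect_eq subsetI)
qed

lemma zero_germ_open: "open {x. zero_germ \<xi> f x}"
proof (subst open_subopen, intro ballI)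
  fix x assume "x \<in> {x. zero_germ \<xi> f x}"
  then obtain U where "open U" "x \<in> U" "\<forall>q\<in>U \<inter> S. \<forall>\<phi>\<in>A. q \<in> fst \<phi> \<longrightarrow> gauge_diff \<xi> f \<phi> q = 0"
    unfolding zero_germ_def by blast
  then show "\<exists>T. open T \<and> x \<in> T \<and> T \<subseteq> {x. zero_germ \<xi> f x}"
    unfolding zero_germ_def by blast
qed

text \<open>Nonzero tangent vectors turn vanishing of the pullback into vanishing of the coefficient
  on the circle. By injectivity, its points near \<open>\<alpha> 1\<close> are zeros distinct from
  \<open>\<alpha> 1\<close> that accumulate there.\<close>

lemma embedded_circle_zero_germ:
  assumes f: "holo_map A B S f" and \<xi>: "\<xi> \<in> holo_forms A S" and fin: "finite (- S)"
    and \<alpha>: "embedded_circle A S \<alpha>"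
    and zero: "\<And>t. vector_derivative (snd (chart_at A (\<alpha> (circ t))) \<circ> (\<alpha> \<circ> circ)) (at t) *\<^sub>C
      gauge_diff \<xi> f (chart_at A (\<alpha> (circ t))) (\<alpha> (circ t)) = 0"
  shows "zero_germ \<xi> f (\<alpha> 1)"
proof -
  have S: "\<alpha> (circ t) \<in> S" for t
    using \<alpha> circ_in_sphere unfolding embedded_circle_def by blast
  have inj: "inj_on \<alpha> (sphere 0 1)" using \<alpha> by (simp add: embedded_circle_def)
  have "continuous_on UNIV (\<alpha> \<circ> circ)"
    using \<alpha> by (simp add: embedded_circle_def smooth_curve_def)
  then have cont: "isCont (\<lambda>t. \<alpha> (circ t)) t" for t
    by (simp add: continuous_on_eq_continuous_at o_def)
  have "\<forall>t. \<forall>\<phi>\<in>A. \<alpha> (circ t) \<in> fst \<phi> \<longrightarrow> vector_derivative (snd \<phi> \<circ> (\<alpha> \<circ> circ)) (at t) \<noteq> 0"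
    using \<alpha> by (simp add: embedded_circle_def comp_assoc)
  then have zero': "gauge_diff \<xi> f (chart_at A (\<alpha> (circ t))) (\<alpha> (circ t)) = 0" for t
    using zero[of t] chart_at[OF surface_atlas, of "\<alpha> (circ t)"] by auto
  define x where "x = \<alpha> 1"
  define \<phi> where "\<phi> = chart_at A x"
  have \<phi>: "\<phi> \<in> A" "x \<in> fst \<phi>" unfolding \<phi>_def using chart_at[OF surface_atlas] by auto
  have on_curve: "gauge_diff \<xi> f \<phi> (\<alpha> (circ t)) = 0" if "\<alpha> (circ t) \<in> fst \<phi>" for t
    using gauge_diff_zero_all_charts[OF f \<xi> chart_at[OF surface_atlas] S zero' \<phi>(1) that] .
  obtain r where r: "r > 0" "ball (snd \<phi> x) r \<subseteq> snd \<phi> ` fst \<phi>"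
    "open (ball (snd \<phi> x) r \<inter> dom \<phi>)" "connected (ball (snd \<phi> x) r \<inter> dom \<phi>)"
    using punctured_chart_ball[OF fin \<phi>] by metis
  have x0: "\<alpha> (circ 0) = x" by (simp add: x_def)
  have xS: "x \<in> S" using S[of 0] x0 by simp
  define U where "U = {z \<in> ball (snd \<phi> x) r \<inter> dom \<phi>. gauge_diff \<xi> f \<phi> (chart_inv \<phi> z) = 0}"
  have "zero_germ \<xi> f x"
  proof (rule zero_germ_of_zeros[OF f \<xi> \<phi> r])
    show "snd \<phi> x \<in> ball (snd \<phi> x) r \<inter> dom \<phi>" using r(1) \<phi>(2) xS by simp
    show "snd \<phi> x islimpt U"
      unfolding islimpt_approachable
    proof (intro allI impI)
      fix e :: real assume "e > 0"
      have lim: "((\<lambda>t. \<alpha> (circ t)) \<longlongrightarrow> x) (at 0)"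
        using cont[of 0] by (simp add: isCont_def x0[symmetric])
      then have "((\<lambda>t. snd \<phi> (\<alpha> (circ t))) \<longlongrightarrow> snd \<phi> x) (at 0)"
        by (rule isCont_tendsto_compose[OF chart_isCont[OF surface_atlas \<phi>]])
      then have "\<forall>\<^sub>F t in at 0. dist (snd \<phi> (\<alpha> (circ t))) (snd \<phi> x) < min e r"
        using \<open>e > 0\<close> r(1) by (intro tendstoD) auto
      moreover have "\<forall>\<^sub>F t in at 0. \<alpha> (circ t) \<in> fst \<phi>"
        by (rule topological_tendstoD[OF lim chart_open[OF surface_atlas \<phi>(1)] \<phi>(2)])
      ultimately have "\<forall>\<^sub>F t in at 0. dist (snd \<phi> (\<alpha> (circ t))) (snd \<phi> x) < min e r \<and> \<alpha> (circ t) \<in> fst \<phi>"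
        by (rule eventually_conj)
      then obtain d where d: "d > 0" "\<And>t. t \<noteq> 0 \<Longrightarrow> dist t 0 < d \<Longrightarrow>
          dist (snd \<phi> (\<alpha> (circ t))) (snd \<phi> x) < min e r \<and> \<alpha> (circ t) \<in> fst \<phi>"
        unfolding eventually_at by blast
      \<comment> \<open>Below \<open>d\<close> for closeness, and below 1 so that
        \<open>circ t\<close> has not returned to the base point.\<close>
      define t where "t = min (d / 2) (1 / 2)"
      have t: "0 < t" "t < 1" "dist t 0 < d" using d(1) by (auto simp: t_def dist_real_def)
      then have dt: "dist (snd \<phi> (\<alpha> (circ t))) (snd \<phi> x) < min e r" "\<alpha> (circ t) \<in> fst \<phi>"
        using d(2)[of t] by auto
      have "\<alpha> (circ t) \<noteq> x"
        using inj circ_neq_1[OF t(1,2)] circ_in_sphere[of t] circ_in_sphere[of 0]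
        by (auto simp: x_def inj_on_def)
      then have "snd \<phi> (\<alpha> (circ t)) \<noteq> snd \<phi> x"
        using chart_inj_on[OF surface_atlas \<phi>(1)] dt(2) \<phi>(2) by (meson inj_onD)
      moreover have "snd \<phi> (\<alpha> (circ t)) \<in> U"
        using dt S[of t] on_curve[OF dt(2)] chart_inv_chart[OF surface_atlas \<phi>(1) dt(2)]
        by (simp add: U_def dist_commute)
      ultimately show "\<exists>z\<in>U. z \<noteq> snd \<phi> x \<and> dist z (snd \<phi> x) < e"
        using dt(1) by auto
    qed
  qed (auto simp: U_def)
  then show ?thesis by (simp add: x_def)
qed

lemma in_Stab_of_circle:
  assumes conn: "connected (UNIV :: 'a set)" and fin: "finite (- S)"
    and f: "f \<in> carrier G" and \<xi>: "\<xi> \<in> holo_forms A S" and \<alpha>: "embedded_circle A S \<alpha>"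
    and stab: "(\<lambda>x\<in>sphere 0 1. f (\<alpha> x)) \<in> loop_stab K B \<kappa> (pullback A (\<alpha> \<circ> circ) \<xi>)"
  shows "f \<in> Stab K B \<kappa> A S \<xi> lam"
proof -
  have fh: "holo_map A B S f" using f by (simp add: in_G_iff)
  have "smooth_curve A UNIV (\<alpha> \<circ> circ)" "\<alpha> ` sphere 0 1 \<subseteq> S"
    using \<alpha> by (auto simp: embedded_circle_def)
  from stab[unfolded restrict_circle_in_loop_stab_iff[OF f this]]
  have "zero_germ \<xi> f (\<alpha> 1)"
    by (intro embedded_circle_zero_germ[OF fh \<xi> fin \<alpha>]) blast
  moreover have "{x. zero_germ \<xi> f x} = {} \<or> {x. zero_germ \<xi> f x} = UNIV"
  proof -
    have "\<forall>T. open T \<and> closed T \<longrightarrow> T = {} \<or> T = (UNIV :: 'a set)"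
      using conn by (simp add: connected_clopen)
    then show ?thesis using zero_germ_open zero_germ_closed[OF fh \<xi> fin] by blast
  qed
  ultimately have "zero_germ \<xi> f x" for x by blast
  then have "gauge_diff \<xi> f \<phi> q = 0" if "\<phi> \<in> A" "q \<in> S \<inter> fst \<phi>" for \<phi> q
    using that unfolding zero_germ_def by blast
  then show ?thesis
    using f by (simp add: Stab_iff[OF \<xi>])
qed

end

section \<open>The coset map\<close>

lemma mem_r_coset_iff: "x \<in> H #>\<^bsub>G\<^esub> a \<longleftrightarrow> (\<exists>h\<in>H. x = h \<otimes>\<^bsub>G\<^esub> a)"
  by (auto simp: r_coset_def)

context gauge
begin

context
  fixes \<xi> :: "('a, 'v) form" and l :: nat and \<alpha> :: "nat \<Rightarrow> complex \<Rightarrow> 'a" and lam :: complex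
  assumes \<xi>: "\<xi> \<in> holo_forms A S"
    and \<alpha>: "\<And>i. i < l \<Longrightarrow> embedded_circle A S (\<alpha> i)"
    and monodromy: "\<And>i. i < l \<Longrightarrow> has_evol K \<kappa> (pullback A (\<alpha> i \<circ> circ) \<xi>) (monodromy K \<kappa> A \<xi> (\<alpha> i))"
begin

abbreviation L :: "(nat \<Rightarrow> complex \<Rightarrow> 'k) monoid"
  where "L \<equiv> product_group {..<l} (\<lambda>i. loop_group B K)"

abbreviation H :: "(nat \<Rightarrow> complex \<Rightarrow> 'k) set"
  where "H \<equiv> \<Pi>\<^sub>E i\<in>{..<l}. centralizer_loops K B \<kappa> A \<xi> (\<alpha> i)"

abbreviation R :: "('a \<Rightarrow> 'k) \<Rightarrow> nat \<Rightarrow> complex \<Rightarrow> 'k"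
  where "R \<equiv> restrict_to_circles l \<alpha>"

abbreviation St :: "('a \<Rightarrow> 'k) set"
  where "St \<equiv> Stab K B \<kappa> A S \<xi> lam"

lemma circle_smooth:
  assumes "i < l"
  shows "smooth_curve A UNIV (\<alpha> i \<circ> circ)" "\<alpha> i ` sphere 0 1 \<subseteq> S"
  using \<alpha>[OF assms] by (auto simp: embedded_circle_def)

lemma H_eq: "H = (\<Pi>\<^sub>E i\<in>{..<l}. loop_stab K B \<kappa> (pullback A (\<alpha> i \<circ> circ) \<xi>))"
  by (rule PiE_cong) (simp add: centralizer_loops_eq monodromy)

lemma R_in_L: "f \<in> carrier G \<Longrightarrow> R f \<in> carrier L"
  using restrict_circle_in_loop_group[OF _ circle_smooth]
  by (auto simp: restrict_to_circles_def)

lemma R_in_H: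
  assumes "f \<in> St"
  shows "R f \<in> H"
proof -
  have f: "f \<in> carrier G" and zero: "\<And>\<phi> q. \<phi> \<in> A \<Longrightarrow> q \<in> S \<inter> fst \<phi> \<Longrightarrow> gauge_diff \<xi> f \<phi> q = 0"
    using assms by (auto simp: Stab_iff[OF \<xi>])
  have "(\<lambda>x\<in>sphere 0 1. f (\<alpha> i x)) \<in> loop_stab K B \<kappa> (pullback A (\<alpha> i \<circ> circ) \<xi>)" if "i < l" for i
  proof -
    have "\<alpha> i (circ t) \<in> S" for t
      using circle_smooth(2)[OF that] circ_in_sphere by blast
    then show ?thesis
      unfolding restrict_circle_in_loop_stab_iff[OF f circle_smooth[OF that]]
      using zero chart_at[OF surface_atlas] by simp
  qed
  then show ?thesis unfolding H_eq restrict_to_circles_def by auto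
qed

lemma H_mult: "h \<in> H \<Longrightarrow> h' \<in> H \<Longrightarrow> h \<otimes>\<^bsub>L\<^esub> h' \<in> H"
  unfolding H_eq by (auto simp: loop_group_mult intro!: loop_stab_mult)

text \<open>The factor \<open>h\<close> is carried along so that elements of cosets can be rewritten
  directly. Products in \<open>L\<close> are cut off to the indices and the circle, hence
  \<open>h\<close> is arbitrary; the circles lie in \<open>S\<close>, where products in
  \<open>G\<close> are pointwise.\<close>

lemma R_mult:
  assumes "f \<in> carrier G" "g \<in> carrier G"
  shows "h \<otimes>\<^bsub>L\<^esub> R (f \<otimes>\<^bsub>G\<^esub> g) = (h \<otimes>\<^bsub>L\<^esub> R f) \<otimes>\<^bsub>L\<^esub> R g"
proof -
  have "\<alpha> i x \<in> S" if "i < l" "x \<in> sphere 0 1" for i x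
    using circle_smooth(2)[OF that(1)] that(2) by blast
  then show ?thesis
    by (auto simp: fun_eq_iff loop_group_mult restrict_to_circles_def G_mult m_assoc)
qed

lemma R_one_mult:
  assumes "f \<in> carrier G"
  shows "R \<one>\<^bsub>G\<^esub> \<otimes>\<^bsub>L\<^esub> R f = R f"
proof -
  have "\<alpha> i x \<in> S" if "i < l" "x \<in> sphere 0 1" for i x
    using circle_smooth(2)[OF that(1)] that(2) by blast
  then show ?thesis
    by (auto simp: fun_eq_iff loop_group_mult restrict_to_circles_def G_one)
qed

lemma St_coset_iff:
  assumes "f \<in> carrier G" "g \<in> carrier G"
  shows "St #>\<^bsub>G\<^esub> f = St #>\<^bsub>G\<^esub> g \<longleftrightarrow> f \<otimes>\<^bsub>G\<^esub> inv\<^bsub>G\<^esub> g \<in> St"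
  using subgroup.rcos_module[OF Stab_subgroup[OF \<xi>] group_G assms(2,1)]
    group.repr_independence[OF group_G _ assms(2) Stab_subgroup[OF \<xi>]]
    group.rcos_self[OF group_G assms(1) Stab_subgroup[OF \<xi>]] by metis

text \<open>Writing \<open>f\<close> as \<open>(f g\<^sup>-\<^sup>1) g\<close>, the restriction of
  \<open>f g\<^sup>-\<^sup>1\<close> lies in \<open>H\<close> and is absorbed on the left.\<close>

lemma H_coset_subset:
  assumes f: "f \<in> carrier G" and g: "g \<in> carrier G" and fg: "f \<otimes>\<^bsub>G\<^esub> inv\<^bsub>G\<^esub> g \<in> St"
  shows "H #>\<^bsub>L\<^esub> R f \<subseteq> H #>\<^bsub>L\<^esub> R g"
proof
  interpret G: group G by (rule group_G)
  fix z assume "z \<in> H #>\<^bsub>L\<^esub> R f"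
  then obtain h where h: "h \<in> H" "z = h \<otimes>\<^bsub>L\<^esub> R f" unfolding mem_r_coset_iff by (rule bexE)
  have "f = (f \<otimes>\<^bsub>G\<^esub> inv\<^bsub>G\<^esub> g) \<otimes>\<^bsub>G\<^esub> g" using f g by (simp add: G.m_assoc)
  then have "z = (h \<otimes>\<^bsub>L\<^esub> R (f \<otimes>\<^bsub>G\<^esub> inv\<^bsub>G\<^esub> g)) \<otimes>\<^bsub>L\<^esub> R g"
    using R_mult[of "f \<otimes>\<^bsub>G\<^esub> inv\<^bsub>G\<^esub> g" g h] f g h(2) by (metis G.inv_closed G.m_closed)
  moreover have "h \<otimes>\<^bsub>L\<^esub> R (f \<otimes>\<^bsub>G\<^esub> inv\<^bsub>G\<^esub> g) \<in> H"
    by (rule H_mult[OF h(1) R_in_H[OF fg]])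
  ultimately show "z \<in> H #>\<^bsub>L\<^esub> R g" unfolding mem_r_coset_iff by (rule bexI)
qed

lemma coset_map_well_defined:
  assumes f: "f \<in> carrier G" and g: "g \<in> carrier G" and eq: "St #>\<^bsub>G\<^esub> f = St #>\<^bsub>G\<^esub> g"
  shows "H #>\<^bsub>L\<^esub> R f = H #>\<^bsub>L\<^esub> R g"
  using H_coset_subset[OF f g] H_coset_subset[OF g f] St_coset_iff[OF f g] St_coset_iff[OF g f] eq
  by (metis subset_antisym)

lemma coset_map_injective:
  assumes conn: "connected (UNIV :: 'a set)" and fin: "finite (- S)" and l: "0 < l"
    and f: "f \<in> carrier G" and g: "g \<in> carrier G" and eq: "H #>\<^bsub>L\<^esub> R f = H #>\<^bsub>L\<^esub> R g"
  shows "St #>\<^bsub>G\<^esub> f = St #>\<^bsub>G\<^esub> g"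
proof -
  interpret G: group G by (rule group_G)
  have "\<one>\<^bsub>G\<^esub> \<in> St" by (rule subgroup.one_closed[OF Stab_subgroup[OF \<xi>]])
  then have "R \<one>\<^bsub>G\<^esub> \<in> H" by (rule R_in_H)
  then have "R \<one>\<^bsub>G\<^esub> \<otimes>\<^bsub>L\<^esub> R f \<in> H #>\<^bsub>L\<^esub> R f"
    unfolding mem_r_coset_iff by (rule bexI[rotated]) (rule refl)
  \<comment> \<open>The unit of \<open>G\<close> restricts into \<open>H\<close>, so
    \<open>R f\<close> belongs to its own coset.\<close>
  then have "R f \<in> H #>\<^bsub>L\<^esub> R f"
    unfolding R_one_mult[OF f] .
  then have "\<exists>h\<in>H. R f = h \<otimes>\<^bsub>L\<^esub> R g" unfolding eq mem_r_coset_iff .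
  then obtain h where h: "h \<in> H" "R f = h \<otimes>\<^bsub>L\<^esub> R g" by (rule bexE)
  \<comment> \<open>A single circle carries the argument; index 0 exists because
    \<open>0 < l\<close>.\<close>
  have h0: "h 0 \<in> loop_stab K B \<kappa> (pullback A (\<alpha> 0 \<circ> circ) \<xi>)"
    using h(1) l unfolding H_eq by auto
  have "f (\<alpha> 0 x) = h 0 x \<otimes> g (\<alpha> 0 x)" if "x \<in> sphere 0 1" for x
    using fun_cong[OF fun_cong[OF h(2), of 0], of x] l that
    by (simp add: restrict_to_circles_def loop_group_mult)
  then have hx: "h 0 x = f (\<alpha> 0 x) \<otimes> inv g (\<alpha> 0 x)" if "x \<in> sphere 0 1" for x
    using that by (simp add: m_assoc)
  have "(\<lambda>x\<in>sphere 0 1. (f \<otimes>\<^bsub>G\<^esub> inv\<^bsub>G\<^esub> g) (\<alpha> 0 x)) = h 0"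
  proof (rule extensionalityI[of _ "sphere 0 1"])
    show "h 0 \<in> extensional (sphere 0 1)"
      using h0 by (simp add: loop_stab_iff in_loop_group_iff)
    fix x :: complex assume x: "x \<in> sphere 0 1"
    then have "\<alpha> 0 x \<in> S" using circle_smooth(2)[OF l] by blast
    then show "(\<lambda>x\<in>sphere 0 1. (f \<otimes>\<^bsub>G\<^esub> inv\<^bsub>G\<^esub> g) (\<alpha> 0 x)) x = h 0 x"
      using x hx[OF x] by (simp add: G_mult G_inv[OF g])
  qed simp
  with h0 have "(\<lambda>x\<in>sphere 0 1. (f \<otimes>\<^bsub>G\<^esub> inv\<^bsub>G\<^esub> g) (\<alpha> 0 x)) \<in> loop_stab K B \<kappa> (pullback A (\<alpha> 0 \<circ> circ) \<xi>)"
    by simp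
  moreover have "f \<otimes>\<^bsub>G\<^esub> inv\<^bsub>G\<^esub> g \<in> carrier G" using f g by simp
  ultimately have "f \<otimes>\<^bsub>G\<^esub> inv\<^bsub>G\<^esub> g \<in> St"
    by (intro in_Stab_of_circle[OF conn fin _ \<xi> \<alpha>[OF l]])
  then show ?thesis by (simp add: St_coset_iff[OF f g])
qed

lemma coset_map_exists:
  assumes conn: "connected (UNIV :: 'a set)" and fin: "finite (- S)" and l: "0 < l"
  shows "\<exists>\<Phi>. (\<forall>f\<in>carrier G. \<Phi> (St #>\<^bsub>G\<^esub> f) = H #>\<^bsub>L\<^esub> R f) \<and>
    \<Phi> \<in> (rcosets\<^bsub>G\<^esub> St) \<rightarrow> (rcosets\<^bsub>L\<^esub> H) \<and> inj_on \<Phi> (rcosets\<^bsub>G\<^esub> St)"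
proof -
  \<comment> \<open>A representative is chosen; \<open>coset_map_well_defined\<close> makes the
    value independent of it.\<close>
  define \<Phi> where "\<Phi> X = H #>\<^bsub>L\<^esub> R (SOME f. f \<in> carrier G \<and> X = St #>\<^bsub>G\<^esub> f)" for X
  have \<Phi>: "\<Phi> (St #>\<^bsub>G\<^esub> f) = H #>\<^bsub>L\<^esub> R f" if f: "f \<in> carrier G" for f
  proof -
    define f' where "f' = (SOME f'. f' \<in> carrier G \<and> St #>\<^bsub>G\<^esub> f = St #>\<^bsub>G\<^esub> f')"
    have "f' \<in> carrier G \<and> St #>\<^bsub>G\<^esub> f = St #>\<^bsub>G\<^esub> f'"
      unfolding f'_def by (rule someI[of _ f]) (use f in simp)
    then show ?thesis
      unfolding \<Phi>_def f'_def[symmetric] using coset_map_well_defined[OF f, of f'] by simp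
  qed
  moreover have "\<Phi> \<in> (rcosets\<^bsub>G\<^esub> St) \<rightarrow> (rcosets\<^bsub>L\<^esub> H)"
  proof
    fix X assume "X \<in> rcosets\<^bsub>G\<^esub> St"
    then obtain f where f: "f \<in> carrier G" "X = St #>\<^bsub>G\<^esub> f" unfolding RCOSETS_def by blast
    then show "\<Phi> X \<in> rcosets\<^bsub>L\<^esub> H"
      using \<Phi>[OF f(1)] R_in_L[OF f(1)] unfolding RCOSETS_def by blast
  qed
  moreover have "inj_on \<Phi> (rcosets\<^bsub>G\<^esub> St)"
  proof (rule inj_onI)
    fix X Y assume "X \<in> rcosets\<^bsub>G\<^esub> St" "Y \<in> rcosets\<^bsub>G\<^esub> St" and eq: "\<Phi> X = \<Phi> Y"
    then obtain f g where f: "f \<in> carrier G" "X = St #>\<^bsub>G\<^esub> f" and g: "g \<in> carrier G" "Y = St #>\<^bsub>G\<^esub> g"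
      unfolding RCOSETS_def by blast
    then show "X = Y"
      using coset_map_injective[OF conn fin l f(1) g(1)] eq \<Phi> by simp
  qed
  ultimately show ?thesis by blast
qed

end

end

theorem proposition4p8:
  fixes K :: "'k::t2_space monoid"
    and B :: "('k, 'v::complex_euclidean) chart set"
    and \<kappa> :: "('k, 'v) chart"
    and A :: "('a::t2_space, complex) chart set"
    and g k l :: nat
    and p :: "nat \<Rightarrow> 'a"
    and S :: "'a set"
    and x0 :: 'a
    and \<alpha> :: "nat \<Rightarrow> complex \<Rightarrow> 'a"
    and \<tau> :: "nat \<Rightarrow> real \<Rightarrow> 'a"
    and lam :: complex
    and \<xi> :: "('a, 'v) form"
    and \<rho> :: "(real \<Rightarrow> 'a) set \<Rightarrow> 'k"
    and C :: "nat \<Rightarrow> 'k set"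
  defines "G \<equiv> holo_group A S B K"
    and "L \<equiv> product_group {..<l} (\<lambda>i. loop_group B K)"
    and "H \<equiv> (\<Pi>\<^sub>E i\<in>{..<l}. centralizer_loops K B \<kappa> A \<xi> (\<alpha> i))"
    and "m \<equiv> (\<lambda>i. monodromy K \<kappa> A \<xi> (\<alpha> i))"
  assumes K: "complex_lie_group K B"
    and K_1_connected: "connected (UNIV :: 'k set)" "simply_connected (UNIV :: 'k set)"
    and \<kappa>: "\<kappa> \<in> B" "\<one>\<^bsub>K\<^esub> \<in> fst \<kappa>"
    and simple: "simple_bracket (lie_bracket K \<kappa>)"
    and surface: "compact_riemann_surface A"
    and genus: "has_genus TYPE('a) g"
    and k: "k \<ge> 1" and p: "inj_on p {..<k}"
    and S: "S = UNIV - p ` {..<k}"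
    and l: "l = 2 * g + k - 1" "l \<ge> 1"
    and circles: "\<forall>i<l. embedded_circle A S (\<alpha> i)"
    and tails: "\<forall>i<l. piecewise_smooth_path A S (\<tau> i) \<and>
          pathstart (\<tau> i) = x0 \<and> pathfinish (\<tau> i) = \<alpha> i 1"
    and generating: "generate (pi1 S x0) ((\<lambda>i. hclass S (lasso (\<tau> i) (\<alpha> i))) ` {..<l})
          = carrier (pi1 S x0)"
    and \<xi>: "\<xi> \<in> holo_forms A S"
    and \<rho>: "\<rho> \<in> period_map K \<kappa> A S x0 \<xi>"
    and C: "\<forall>i<l. C i = conj_class K (\<rho> (hclass S (lasso (\<tau> i) (\<alpha> i))))"
  shows "(\<forall>i<l. m i \<in> C i \<and>
            (\<exists>b. bij_betw b (rcosets\<^bsub>K\<^esub> (centralizer K (m i))) (C i) \<and>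
              (\<forall>x\<in>carrier K. b (centralizer K (m i) #>\<^bsub>K\<^esub> x) = inv\<^bsub>K\<^esub> x \<otimes>\<^bsub>K\<^esub> m i \<otimes>\<^bsub>K\<^esub> x)))
       \<and> (\<exists>\<phi>bar. (\<forall>f\<in>carrier G. \<phi>bar (Stab K B \<kappa> A S \<xi> lam #>\<^bsub>G\<^esub> f) =
                      H #>\<^bsub>L\<^esub> restrict_to_circles l \<alpha> f)
            \<and> \<phi>bar \<in> (rcosets\<^bsub>G\<^esub> (Stab K B \<kappa> A S \<xi> lam)) \<rightarrow> (rcosets\<^bsub>L\<^esub> H)
            \<and> inj_on \<phi>bar (rcosets\<^bsub>G\<^esub> (Stab K B \<kappa> A S \<xi> lam)))"
proof -
  have "- S = p ` {..<k}" using S by auto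
  then have fin: "finite (- S)" by simp
  then have "open S" using finite_imp_closed[OF fin] by (simp add: closed_def)
  have A: "complex_atlas A" and conn: "connected (UNIV :: 'a set)"
    using surface by (auto simp: compact_riemann_surface_def)
  have "group K" using K by (simp add: complex_lie_group_def)
  then interpret gauge: gauge K B \<kappa> A S
    using K \<kappa> A \<open>open S\<close> by (simp add: gauge_def gauge_axioms_def complex_lie_def complex_lie_axioms_def)
  \<comment> \<open>Membership of \<open>\<rho>\<close> in the period map yields a solution along
    each circle, on whose existence the coset map is built.\<close>
  have mono: "has_evol K \<kappa> (pullback A (\<alpha> i \<circ> circ) \<xi>) (m i)" and in_C: "m i \<in> C i" if "i < l" for i
    using gauge.monodromy_in_conj_class[OF A _ _ _ _ _ \<rho>, of "\<tau> i" "\<alpha> i"] circles tails C that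
    by (auto simp: m_def embedded_circle_def)
  have orbit: "\<exists>b. bij_betw b (rcosets\<^bsub>K\<^esub> (centralizer K (m i))) (C i) \<and>
      (\<forall>x\<in>carrier K. b (centralizer K (m i) #>\<^bsub>K\<^esub> x) = inv\<^bsub>K\<^esub> x \<otimes>\<^bsub>K\<^esub> m i \<otimes>\<^bsub>K\<^esub> x)" if "i < l" for i
  proof -
    \<comment> \<open>\<open>C i\<close> is the class of the value of \<open>\<rho>\<close> on a
      lasso; containing \<open>m i\<close>, it is the class of \<open>m i\<close> too.\<close>
    have "C i = conj_class K (m i)"
      using gauge.conj_class_eq[of _ "m i"] in_C[OF that] C that by simp
    then show ?thesis using gauge.orbit_stabilizer_conj[of "m i"] by simp
  qed
  have "\<exists>\<phi>bar. (\<forall>f\<in>carrier G. \<phi>bar (Stab K B \<kappa> A S \<xi> lam #>\<^bsub>G\<^esub> f) = H #>\<^bsub>L\<^esub> restrict_to_circles l \<alpha> f)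
      \<and> \<phi>bar \<in> (rcosets\<^bsub>G\<^esub> (Stab K B \<kappa> A S \<xi> lam)) \<rightarrow> (rcosets\<^bsub>L\<^esub> H)
      \<and> inj_on \<phi>bar (rcosets\<^bsub>G\<^esub> (Stab K B \<kappa> A S \<xi> lam))"
    unfolding G_def L_def H_def
    by (rule gauge.coset_map_exists[OF \<xi> _ _ conn fin]) (use circles mono l(2) in \<open>auto simp: m_def\<close>)
  with in_C orbit show ?thesis by blast
qed

end
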